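(* Let $(E,\mathcal{E},m)$ be a finite measure space. Let $\alpha:\mathbb{R}\to[c,d]\subset(0,2)$ be a $C^1$ function and let $b:\mathbb{R}\to\mathbb{R}$ be a $C^1$ function. Let $f(t,u,\cdot)$, $(t,u)\in\mathbb{R}^2$, be a family of functions such that $f(t,u,\cdot)\in\mathcal{F}_{\alpha(u)}(E,\mathcal{E},m)$ for all $(t,u)\in\mathbb{R}^2$. Let $(\Gamma_i)_{i\ge1}$ be the sequence of arrival times of a Poisson process with unit rate, let $(V_i)_{i\ge1}$ be a sequence of i.i.d. random variables with distribution $\hat m=m/m(E)$ on $E$, and let $(\gamma_i)_{i\ge1}$ be a sequence of i.i.d. random variables with $P(\gamma_i=1)=P(\gamma_i=-1)=1/2$. Assume that the three sequences $(\Gamma_i)_{i\ge1}$, $(V_i)_{i\ge1}$, $(\gamma_i)_{i\ge1}$ are independent. Consider the random field $$X(t,u)=b(u)\,(m(E))^{1/\alpha(u)}\,C_{\alpha(u)}^{1/\alpha(u)}\sum_{i=1}^{\infty}\gamma_i\,\Gamma_i^{-1/\alpha(u)}f(t,u,V_i),\qquad C_\alpha=\left(\int_0^\infty x^{-\alpha}\sin(x)\,dx\right)^{-1}.$$ Fix $u\in\mathbb{R}$ and assume that $t\mapsto X(t,u)$ is localisable at $u$ with exponent $h\in(0,1)$ and local form $X'_u(\cdot,u)$. Assume in addition that: (C1) the function $v\mapsto f(t,v,x)$ is differentiable for all $(v,t)$ in a neighbourhood of $(u,u)$ and almost all $x\in E$ (that is, for each $t$ near $u$ and almost every $x$, it is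 differentiable at every $v$ in a neighbourhood of $u$, the neighbourhoods not depending on $x$); its derivative with respect to $v$ is denoted $f'_v$; (C2) there exists $\varepsilon>0$ such that $\displaystyle\sup_{t\in B(u,\varepsilon)}\int_E\sup_{w\in B(u,\varepsilon)}|f(t,w,x)|^{\alpha(w)}\,\hat m(dx)<\infty$; (C3) there exists $\varepsilon>0$ such that $\displaystyle\sup_{t\in B(u,\varepsilon)}\int_E\sup_{w\in B(u,\varepsilon)}|f'_v(t,w,x)|^{\alpha(w)}\,\hat m(dx)<\infty$; (C4) there exists $\varepsilon>0$ such that $\displaystyle\sup_{t\in B(u,\varepsilon)}\int_E\sup_{w\in B(u,\varepsilon)}\big|f(t,w,x)\log|f(t,w,x)|\big|^{\alpha(w)}\,\hat m(dx)<\infty$. Then the process $Y(t):=X(t,t)$ is localisable at $u$ with exponent $h$ and local form $Y'_u(t)=X'_u(t,u)$.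
   Context: $B(u,\varepsilon)$ is the open interval $(u-\varepsilon,u+\varepsilon)$. $\mathcal{F}_{\alpha}(E,\mathcal{E},m)$ is the set of measurable $f:E\to\mathbb{R}$ with $\int_E|f|^\alpha\,dm<\infty$. The convention $0\log 0=0$ is used. $f'_v(t,w,x)$ denotes the derivative of $f$ with respect to its second argument, evaluated at $(t,w,x)$. Localisability: a process $Y=\{Y(t)\}$ is $h$-localisable at $u$ (localisable at $u$ with exponent $h$) if there is a non-trivial process $Y'_u=\{Y'_u(t):t\in\mathbb{R}\}$, called the local form of $Y$ at $u$, such that $$\frac{Y(u+rt)-Y(u)}{r^h}\longrightarrow Y'_u(t)\quad\text{as } r\to0^+$$ in the sense of convergence of finite-dimensional distributions (as processes in $t$). Local forms are identified up to equality of finite-dimensional distributions. *)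

theory Defs
  imports "HOL-Probability.Probability"
begin

subsection \<open>Convergence of finite-dimensional distributions and localisability\<close>

text \<open>
  \<open>\<real>\<^sup>n\<close> is realised as the space of real sequences vanishing from index \<open>n\<close> on, with the
  product topology on \<^typ>\<open>nat \<Rightarrow> real\<close>; its bounded continuous functions are exactly the
  restrictions of bounded continuous functions on \<^typ>\<open>nat \<Rightarrow> real\<close>. The limit process may
  live on another probability space.
\<close>

definition fdd_vec :: "nat \<Rightarrow> (nat \<Rightarrow> real) \<Rightarrow> (real \<Rightarrow> 'w \<Rightarrow> real) \<Rightarrow> 'w \<Rightarrow> nat \<Rightarrow> real" where
  "fdd_vec n ts Z \<omega> = (\<lambda>i. if i < n then Z (ts i) \<omega> else 0)"

definition fdd_tendsto ::
  "'w measure \<Rightarrow> ('r \<Rightarrow> real \<Rightarrow> 'w \<Rightarrow> real) \<Rightarrow> 'v measure \<Rightarrow> (real \<Rightarrow> 'v \<Rightarrow> real) \<Rightarrow> 'r filter \<Rightarrow> bool" where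
  "fdd_tendsto M Z M' Z' F \<longleftrightarrow>
     (\<forall>n ts. \<forall>g :: (nat \<Rightarrow> real) \<Rightarrow> real. continuous_on UNIV g \<longrightarrow> bounded (range g) \<longrightarrow>
        ((\<lambda>r. \<integral>\<omega>. g (fdd_vec n ts (Z r) \<omega>) \<partial>M) \<longlongrightarrow> (\<integral>\<omega>. g (fdd_vec n ts Z' \<omega>) \<partial>M')) F)"

definition nontrivial_process :: "'v measure \<Rightarrow> (real \<Rightarrow> 'v \<Rightarrow> real) \<Rightarrow> bool" where
  "nontrivial_process M Z \<longleftrightarrow> (\<exists>t. \<not> (AE \<omega> in M. Z t \<omega> = 0))"

text \<open>\<open>Y\<close>, defined on \<open>M\<close>, is \<open>h\<close>-localisable at \<open>u\<close> with local form \<open>Y'\<close>, defined on \<open>M'\<close>.\<close>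

definition localisable ::
  "'w measure \<Rightarrow> (real \<Rightarrow> 'w \<Rightarrow> real) \<Rightarrow> real \<Rightarrow> real \<Rightarrow> 'v measure \<Rightarrow> (real \<Rightarrow> 'v \<Rightarrow> real) \<Rightarrow> bool" where
  "localisable M Y u h M' Y' \<longleftrightarrow>
     prob_space M \<and> (\<forall>t. Y t \<in> borel_measurable M) \<and>
     prob_space M' \<and> (\<forall>t. Y' t \<in> borel_measurable M') \<and>
     nontrivial_process M' Y' \<and>
     fdd_tendsto M (\<lambda>r t \<omega>. (Y (u + r * t) \<omega> - Y u \<omega>) / r powr h) M' Y' (at_right 0)"

subsection \<open>The random sequences\<close>

definition poisson_process :: "'w measure \<Rightarrow> real \<Rightarrow> (real \<Rightarrow> 'w \<Rightarrow> nat) \<Rightarrow> bool" where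
  "poisson_process M rate N \<longleftrightarrow>
     (\<forall>t\<ge>0. N t \<in> measurable M (count_space UNIV)) \<and>
     (AE \<omega> in M. N 0 \<omega> = 0 \<and> mono_on {0..} (\<lambda>t. N t \<omega>) \<and>
        (\<forall>t\<ge>0. continuous (at_right t) (\<lambda>s. N s \<omega>))) \<and>
     (\<forall>s t. 0 \<le> s \<longrightarrow> s < t \<longrightarrow>
        distr M (count_space UNIV) (\<lambda>\<omega>. N t \<omega> - N s \<omega>) = measure_pmf (poisson_pmf (rate * (t - s)))) \<and>
     (\<forall>ts :: nat \<Rightarrow> real. 0 \<le> ts 0 \<longrightarrow> incseq ts \<longrightarrow>
        prob_space.indep_vars M (\<lambda>_. count_space UNIV) (\<lambda>k \<omega>. N (ts (Suc k)) \<omega> - N (ts k) \<omega>) UNIV)"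

text \<open>Sequences are indexed from \<open>0\<close>: \<open>\<Gamma> i\<close> is the \<open>(i + 1)\<close>-st arrival time.\<close>

definition poisson_arrival_times :: "'w measure \<Rightarrow> real \<Rightarrow> (nat \<Rightarrow> 'w \<Rightarrow> real) \<Rightarrow> bool" where
  "poisson_arrival_times M rate \<Gamma> \<longleftrightarrow>
     (\<forall>i. \<Gamma> i \<in> borel_measurable M) \<and>
     (\<exists>N. poisson_process M rate N \<and>
        (AE \<omega> in M. \<forall>i. \<Gamma> i \<omega> = Inf {t. 0 \<le> t \<and> Suc i \<le> N t \<omega>}))"

definition iid_with_law :: "'w measure \<Rightarrow> 'e measure \<Rightarrow> (nat \<Rightarrow> 'w \<Rightarrow> 'e) \<Rightarrow> bool" where
  "iid_with_law M L V \<longleftrightarrow>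
     prob_space.indep_vars M (\<lambda>_. L) V UNIV \<and> (\<forall>i. distr M L (V i) = L)"

definition iid_signs :: "'w measure \<Rightarrow> (nat \<Rightarrow> 'w \<Rightarrow> real) \<Rightarrow> bool" where
  "iid_signs M \<gamma> \<longleftrightarrow>
     prob_space.indep_vars M (\<lambda>_. borel) \<gamma> UNIV \<and>
     (\<forall>i. measure M {\<omega> \<in> space M. \<gamma> i \<omega> = 1} = 1/2 \<and>
          measure M {\<omega> \<in> space M. \<gamma> i \<omega> = -1} = 1/2)"

text \<open>The \<open>\<sigma>\<close>-algebra generated by a whole sequence of random elements of \<open>L\<close>.\<close>

definition seq_events :: "'w measure \<Rightarrow> 'e measure \<Rightarrow> (nat \<Rightarrow> 'w \<Rightarrow> 'e) \<Rightarrow> 'w set set" where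
  "seq_events M L X = sets (vimage_algebra (space M) (\<lambda>\<omega> i. X i \<omega>) (PiM UNIV (\<lambda>_. L)))"

definition indep_sequences ::
  "'w measure \<Rightarrow> 'a measure \<Rightarrow> (nat \<Rightarrow> 'w \<Rightarrow> 'a) \<Rightarrow> 'b measure \<Rightarrow> (nat \<Rightarrow> 'w \<Rightarrow> 'b) \<Rightarrow>
     'c measure \<Rightarrow> (nat \<Rightarrow> 'w \<Rightarrow> 'c) \<Rightarrow> bool" where
  "indep_sequences M A X B Y C Z \<longleftrightarrow>
     prob_space.indep_sets M
       (\<lambda>k::nat. [seq_events M A X, seq_events M B Y, seq_events M C Z] ! k) {0, 1, 2}"

subsection \<open>The random field\<close>

definition F_space :: "real \<Rightarrow> 'e measure \<Rightarrow> ('e \<Rightarrow> real) set" where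
  "F_space a m = {g \<in> borel_measurable m. (\<integral>\<^sup>+x. ennreal (\<bar>g x\<bar> powr a) \<partial>m) < \<infinity>}"

definition normalised :: "'e measure \<Rightarrow> 'e measure" where
  "normalised m = scale_measure (1 / emeasure m (space m)) m"

text \<open>
  For \<open>a \<le> 1\<close> the integral over \<open>(0, \<infinity>)\<close> converges only conditionally, so it has to be taken
  as an improper integral; a Lebesgue integral over the half-line would be \<open>0\<close> by convention.
\<close>

definition C_stable :: "real \<Rightarrow> real" where
  "C_stable a = inverse (Lim at_top (\<lambda>T::real. LBINT x=0..T. x powr (-a) * sin x))"

definition multistable_field ::
  "'e measure \<Rightarrow> (real \<Rightarrow> real) \<Rightarrow> (real \<Rightarrow> real) \<Rightarrow> (real \<Rightarrow> real \<Rightarrow> 'e \<Rightarrow> real) \<Rightarrow>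
     (nat \<Rightarrow> 'w \<Rightarrow> real) \<Rightarrow> (nat \<Rightarrow> 'w \<Rightarrow> 'e) \<Rightarrow> (nat \<Rightarrow> 'w \<Rightarrow> real) \<Rightarrow> real \<Rightarrow> real \<Rightarrow> 'w \<Rightarrow> real" where
  "multistable_field m \<alpha> b f \<Gamma> V \<gamma> t u \<omega> =
     b u * measure m (space m) powr (1 / \<alpha> u) * C_stable (\<alpha> u) powr (1 / \<alpha> u) *
       (\<Sum>i. \<gamma> i \<omega> * \<Gamma> i \<omega> powr (- (1 / \<alpha> u)) * f t u (V i \<omega>))"

end

theory Submission
  imports Defs
begin

text \<open>
  Put \<open>v = u + r * t\<close> and split the increment of the diagonal process as
  \<open>X(v,v) - X(u,u) = (X(v,u) - X(u,u)) + (X(v,v) - X(v,u))\<close>. After division by \<open>r powr h\<close> the first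
  bracket converges to the local form by hypothesis. The second is of order \<open>\<bar>v - u\<bar> = r * \<bar>t\<bar>\<close> in
  probability, uniformly for \<open>v\<close> near \<open>u\<close> (\<open>multistable_increment_tight\<close>), so it vanishes in the limit
  because \<open>h < 1\<close>; a perturbation that tends to \<open>0\<close> in probability does not change a limit of
  finite-dimensional distributions (\<open>fdd_tendsto_perturb\<close>).

  Every series involved has the form \<open>\<Sum>\<^sub>i \<gamma>\<^sub>i a(\<Gamma>\<^sub>i, V\<^sub>i)\<close>. Given the points \<open>(\<Gamma>\<^sub>i, V\<^sub>i)\<close> it is a series of
  independent signs with fixed coefficients \<open>a\<^sub>i\<close>, and Kolmogorov's maximal inequality bounds the
  probability that some partial sum reaches \<open>l\<close> by \<open>min(1, \<Sum>\<^sub>i a\<^sub>i\<^sup>2 / l\<^sup>2) \<le> \<Sum>\<^sub>i min(1, a\<^sub>i\<^sup>2 / l\<^sup>2)\<close>. The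
  mean measure of the points is Lebesgue measure on the half-line times the law of the marks, so
  averaging over the points leaves the deterministic integral \<open>\<integral>\<integral> min(1, a(y,x)\<^sup>2 / l\<^sup>2) dy dx\<close>
  (\<open>marked_signed_series\<close>). If \<open>\<bar>a(y,x)\<bar> \<le> C \<phi>(q(x) / y)\<close> with \<open>\<phi>(q) = q\<^sup>s + q\<^sup>S\<close> and \<open>s > 1/2\<close>, the substitution
  \<open>y = q(x) z\<close> bounds it by \<open>\<integral> q\<close> times a factor that depends on \<open>C\<close>, \<open>s\<close>, \<open>S\<close> and \<open>l\<close> only and tends to
  \<open>0\<close> as \<open>l\<close> grows (\<open>gauge_dominated_integral\<close>). Tightness is thereby reduced to a pointwise estimate
  whose dominating function \<open>q\<close> has a bounded integral.

  The pointwise estimate concerns the difference quotient in \<open>w\<close> of \<open>y powr (- (1 / \<alpha> w)) * f v w x\<close>. Its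
  derivative contains \<open>f'\<close>, controlled by \<open>C3\<close>, and the product \<open>f ln y\<close>. With \<open>p = \<bar>f\<bar> powr \<alpha>\<close> one writes
  \<open>ln y = ln p - ln (p / y)\<close>: the first logarithm yields \<open>f ln \<bar>f\<bar>\<close>, controlled by \<open>C4\<close>, and the second
  is absorbed by a small change of the exponents, after which \<open>C2\<close> applies (\<open>scaled_increment_bound\<close>).
  Here \<open>d < 2\<close> is what keeps the smaller exponent above \<open>1/2\<close>.

  The factor in front of the series is Lipschitz at \<open>u\<close> because integration by parts turns the
  improper integral in \<open>C_stable\<close> into \<open>a\<close> times the integral of
  \<open>x powr (-a - 1) * (1 - cos x)\<close> over \<open>(0, \<infinity>)\<close>, which converges absolutely,
  is positive, and is locally Lipschitz in \<open>a\<close>.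

  The supremum of \<open>\<bar>f'\<bar> powr \<alpha>\<close> over an interval need not be measurable in \<open>x\<close>. Its integral is then a lower
  integral, which is monotone but not additive. This is why the dominating function is carried as a
  sum \<open>A + B\<close> in which only \<open>B\<close> is measurable; the suprema that involve \<open>f\<close> alone go into \<open>B\<close>, as they
  may be taken over the rationals by continuity.
\<close>

section \<open>Series with random signs\<close>

lemma (in prob_space) iid_signsD:
  assumes "iid_signs M \<gamma>"
  shows "\<gamma> i \<in> borel_measurable M"
    and "AE \<omega> in M. \<bar>\<gamma> i \<omega>\<bar> = 1"
    and "integrable M (\<gamma> i)"
    and "expectation (\<gamma> i) = 0"
proof -
  have ind: "indep_vars (\<lambda>_. borel) \<gamma> UNIV"
    and p1: "prob {\<omega> \<in> space M. \<gamma> i \<omega> = 1} = 1/2"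
    and p2: "prob {\<omega> \<in> space M. \<gamma> i \<omega> = -1} = 1/2"
    using assms by (auto simp: iid_signs_def)
  show [measurable]: "\<gamma> i \<in> borel_measurable M"
    using ind by (auto simp: indep_vars_def)
  have "prob ({\<omega> \<in> space M. \<gamma> i \<omega> = 1} \<union> {\<omega> \<in> space M. \<gamma> i \<omega> = -1}) = 1"
    using p1 p2 by (subst finite_measure_Union) auto
  then have "AE \<omega> in M. \<omega> \<in> {\<omega> \<in> space M. \<gamma> i \<omega> = 1} \<union> {\<omega> \<in> space M. \<gamma> i \<omega> = -1}"
    by (subst (asm) prob_eq_1) auto
  then show ae: "AE \<omega> in M. \<bar>\<gamma> i \<omega>\<bar> = 1"
    by eventually_elim auto
  show "integrable M (\<gamma> i)"
    by (rule integrable_const_bound[where B=1]) (use ae in auto)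
  have "expectation (\<gamma> i) = (\<integral>\<omega>. indicator {\<omega> \<in> space M. \<gamma> i \<omega> = 1} \<omega> - indicator {\<omega> \<in> space M. \<gamma> i \<omega> = -1} \<omega> \<partial>M)"
    using ae by (intro integral_cong_AE) (auto simp: indicator_def abs_if split: if_splits)
  also have "\<dots> = 0"
    using p1 p2 by (subst Bochner_Integration.integral_diff) (auto simp: emeasure_eq_measure)
  finally show "expectation (\<gamma> i) = 0" .
qed

text \<open>
  Stopping the walk as soon as it leaves the interval \<open>(-l, l)\<close> turns the maximal inequality into
  Chebyshev's inequality for a single variable.
\<close>

primrec stopped_sum :: "real \<Rightarrow> (nat \<Rightarrow> real) \<Rightarrow> nat \<Rightarrow> real" where
  "stopped_sum l x 0 = 0"
| "stopped_sum l x (Suc n) = stopped_sum l x n + (if \<bar>stopped_sum l x n\<bar> < l then x n else 0)"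

lemma stopped_sum_crossing:
  "l \<le> \<bar>stopped_sum l x n\<bar> \<or>
     stopped_sum l x n = (\<Sum>i<n. x i) \<and> (\<forall>k\<le>n. \<bar>\<Sum>i<k. x i\<bar> < l)"
  by (induction n) (auto simp: le_Suc_eq not_le)

lemma stopped_sum_bound:
  assumes "\<And>i. i < n \<Longrightarrow> \<bar>x i\<bar> \<le> c i"
  shows "\<bar>stopped_sum l x n\<bar> \<le> (\<Sum>i<n. c i)"
  using assms
proof (induction n)
  case (Suc n)
  have "\<bar>stopped_sum l x n\<bar> \<le> (\<Sum>i<n. c i)" "\<bar>x n\<bar> \<le> c n" using Suc by auto
  then show ?case by auto
qed simp

lemma stopped_sum_cong:
  assumes "\<And>i. i < n \<Longrightarrow> x i = y i"
  shows "stopped_sum l x n = stopped_sum l y n"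
  using assms by (induction n) auto

lemma measurable_stopped_sum[measurable]:
  assumes [measurable]: "\<And>i. i < n \<Longrightarrow> (\<lambda>\<omega>. x \<omega> i) \<in> borel_measurable M"
  shows "(\<lambda>\<omega>. stopped_sum l (x \<omega>) n) \<in> borel_measurable M"
  using assms
proof (induction n)
  case (Suc n)
  then have [measurable]: "(\<lambda>\<omega>. stopped_sum l (x \<omega>) n) \<in> borel_measurable M" "(\<lambda>\<omega>. x \<omega> n) \<in> borel_measurable M"
    by auto
  show ?case by simp
qed simp

lemma (in prob_space) sign_indep_of_past:
  assumes "iid_signs M \<gamma>"
    and H[measurable]: "H \<in> borel_measurable (PiM {..<n} (\<lambda>_. borel))"
    and bd: "AE \<omega> in M. \<bar>H (restrict (\<lambda>i. \<gamma> i \<omega>) {..<n})\<bar> \<le> B"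
  shows "integrable M (\<lambda>\<omega>. H (restrict (\<lambda>i. \<gamma> i \<omega>) {..<n}) * \<gamma> n \<omega>)"
    and "(\<integral>\<omega>. H (restrict (\<lambda>i. \<gamma> i \<omega>) {..<n}) * \<gamma> n \<omega> \<partial>M) = 0"
proof -
  note [measurable] = iid_signsD(1)[OF assms(1)]
  have "indep_var (PiM {..<n} (\<lambda>_. borel)) (\<lambda>\<omega>. restrict (\<lambda>i. \<gamma> i \<omega>) {..<n})
          (PiM {n} (\<lambda>_. borel)) (\<lambda>\<omega>. restrict (\<lambda>i. \<gamma> i \<omega>) {n})"
    using assms(1) by (intro indep_var_restrict[where I=UNIV]) (auto simp: iid_signs_def)
  then have "indep_var borel (H \<circ> (\<lambda>\<omega>. restrict (\<lambda>i. \<gamma> i \<omega>) {..<n}))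
          borel ((\<lambda>g. g n) \<circ> (\<lambda>\<omega>. restrict (\<lambda>i. \<gamma> i \<omega>) {n}))"
    by (rule indep_var_compose) auto
  then have ind: "indep_var borel (\<lambda>\<omega>. H (restrict (\<lambda>i. \<gamma> i \<omega>) {..<n})) borel (\<gamma> n)"
    by (simp add: comp_def)
  have int: "integrable M (\<lambda>\<omega>. H (restrict (\<lambda>i. \<gamma> i \<omega>) {..<n}))"
    using bd by (intro integrable_const_bound[where B=B]) auto
  note iid_signsD[OF assms(1), of n]
  from indep_var_lebesgue_integral[OF ind int this(3)] this(4)
  show "(\<integral>\<omega>. H (restrict (\<lambda>i. \<gamma> i \<omega>) {..<n}) * \<gamma> n \<omega> \<partial>M) = 0" by simp
  show "integrable M (\<lambda>\<omega>. H (restrict (\<lambda>i. \<gamma> i \<omega>) {..<n}) * \<gamma> n \<omega>)"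
    by (rule indep_var_integrable[OF ind int iid_signsD(3)[OF assms(1)]])
qed

text \<open>
  The walk is a martingale: a new sign is independent of everything before it and centred, so the
  cross terms vanish and each step adds at most \<open>(a i)\<^sup>2\<close> to the second moment.
\<close>

lemma (in prob_space) stopped_sum_second_moment:
  assumes s: "iid_signs M \<gamma>"
  shows "integrable M (\<lambda>\<omega>. (stopped_sum l (\<lambda>i. \<gamma> i \<omega> * a i) n)\<^sup>2)
    \<and> (\<integral>\<omega>. (stopped_sum l (\<lambda>i. \<gamma> i \<omega> * a i) n)\<^sup>2 \<partial>M) \<le> (\<Sum>i<n. (a i)\<^sup>2)"
proof (induction n)
  case (Suc n)
  note [measurable] = iid_signsD(1)[OF s]
  let ?T = "\<lambda>\<omega>. stopped_sum l (\<lambda>i. \<gamma> i \<omega> * a i) n"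
  let ?H = "\<lambda>g. let T = stopped_sum l (\<lambda>i. g i * a i) n in if \<bar>T\<bar> < l then T else (0::real)"
  define B where "B = (\<Sum>i<n. \<bar>a i\<bar>)"
  have ae: "AE \<omega> in M. \<forall>i. \<bar>\<gamma> i \<omega>\<bar> = 1"
    using iid_signsD(2)[OF s] by (simp add: AE_all_countable)
  have H: "?H (restrict (\<lambda>i. \<gamma> i \<omega>) {..<n}) = (if \<bar>?T \<omega>\<bar> < l then ?T \<omega> else 0)" for \<omega>
  proof -
    have "stopped_sum l (\<lambda>i. restrict (\<lambda>i. \<gamma> i \<omega>) {..<n} i * a i) n = ?T \<omega>"
      by (rule stopped_sum_cong) auto
    then show ?thesis by (simp add: Let_def)
  qed
  have bdT: "AE \<omega> in M. \<bar>?T \<omega>\<bar> \<le> B"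
    using ae unfolding B_def
    by eventually_elim (auto intro!: stopped_sum_bound simp: abs_mult)
  then have bd: "AE \<omega> in M. \<bar>?H (restrict (\<lambda>i. \<gamma> i \<omega>) {..<n})\<bar> \<le> B"
    unfolding H by eventually_elim (auto simp: Let_def)
  have [measurable]: "?H \<in> borel_measurable (PiM {..<n} (\<lambda>_. borel))"
    by (simp add: Let_def, measurable)
  note cross = sign_indep_of_past[OF s this bd, unfolded H]
  have eq: "AE \<omega> in M. (stopped_sum l (\<lambda>i. \<gamma> i \<omega> * a i) (Suc n))\<^sup>2
      = (?T \<omega>)\<^sup>2 + (2 * a n * ((if \<bar>?T \<omega>\<bar> < l then ?T \<omega> else 0) * \<gamma> n \<omega>)
         + (if \<bar>?T \<omega>\<bar> < l then (a n)\<^sup>2 else 0))"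
    using ae
  proof eventually_elim
    case (elim \<omega>)
    then have "(\<gamma> n \<omega>)\<^sup>2 = 1" by (metis power2_abs power_one)
    then show ?case by (simp add: power2_sum power_mult_distrib)
  qed
  have i3: "integrable M (\<lambda>\<omega>. if \<bar>?T \<omega>\<bar> < l then (a n)\<^sup>2 else 0)"
    by (rule integrable_const_bound[where B="(a n)\<^sup>2"]) auto
  have i23: "integrable M (\<lambda>\<omega>. (?T \<omega>)\<^sup>2 + (2 * a n * ((if \<bar>?T \<omega>\<bar> < l then ?T \<omega> else 0) * \<gamma> n \<omega>)
         + (if \<bar>?T \<omega>\<bar> < l then (a n)\<^sup>2 else 0)))"
    using Suc cross(1) i3 by auto
  have "integrable M (\<lambda>\<omega>. (stopped_sum l (\<lambda>i. \<gamma> i \<omega> * a i) (Suc n))\<^sup>2)"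
    by (subst integrable_cong_AE[OF _ _ eq]) (use i23 in auto)
  moreover have "(\<integral>\<omega>. (stopped_sum l (\<lambda>i. \<gamma> i \<omega> * a i) (Suc n))\<^sup>2 \<partial>M) =
      (\<integral>\<omega>. (?T \<omega>)\<^sup>2 + (2 * a n * ((if \<bar>?T \<omega>\<bar> < l then ?T \<omega> else 0) * \<gamma> n \<omega>)
         + (if \<bar>?T \<omega>\<bar> < l then (a n)\<^sup>2 else 0)) \<partial>M)"
    by (rule integral_cong_AE[OF _ _ eq]) auto
  moreover have "\<dots> = (\<integral>\<omega>. (?T \<omega>)\<^sup>2 \<partial>M) + (\<integral>\<omega>. (if \<bar>?T \<omega>\<bar> < l then (a n)\<^sup>2 else 0) \<partial>M)"
    using Suc cross i3
    by (subst Bochner_Integration.integral_add, auto)+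
  moreover have "(\<integral>\<omega>. (if \<bar>?T \<omega>\<bar> < l then (a n)\<^sup>2 else 0) \<partial>M) \<le> (\<integral>\<omega>. (a n)\<^sup>2 \<partial>M)"
    using i3 by (intro integral_mono) auto
  ultimately show ?case using Suc by (simp add: prob_space)
qed simp

text \<open>
  If some partial sum has reached \<open>l\<close>, then the stopped walk has been frozen at a value of modulus at
  least \<open>l\<close>.
\<close>

lemma (in prob_space) kolmogorov_inequality_signs:
  assumes s: "iid_signs M \<gamma>" and l: "0 < l"
  shows "prob {\<omega> \<in> space M. \<exists>k\<le>n. l \<le> \<bar>\<Sum>i<k. \<gamma> i \<omega> * a i\<bar>} \<le> (\<Sum>i<n. (a i)\<^sup>2) / l\<^sup>2"
proof -
  note [measurable] = iid_signsD(1)[OF s]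
  let ?T = "\<lambda>\<omega>. stopped_sum l (\<lambda>i. \<gamma> i \<omega> * a i) n"
  have "prob {\<omega> \<in> space M. \<exists>k\<le>n. l \<le> \<bar>\<Sum>i<k. \<gamma> i \<omega> * a i\<bar>} \<le> prob {\<omega> \<in> space M. l\<^sup>2 \<le> (?T \<omega>)\<^sup>2}"
  proof (rule finite_measure_mono)
    show "{\<omega> \<in> space M. \<exists>k\<le>n. l \<le> \<bar>\<Sum>i<k. \<gamma> i \<omega> * a i\<bar>} \<subseteq> {\<omega> \<in> space M. l\<^sup>2 \<le> (?T \<omega>)\<^sup>2}"
    proof safe
      fix \<omega> k assume "k \<le> n" "l \<le> \<bar>\<Sum>i<k. \<gamma> i \<omega> * a i\<bar>"
      then have "l \<le> \<bar>?T \<omega>\<bar>"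
        using stopped_sum_crossing[of l "\<lambda>i. \<gamma> i \<omega> * a i" n] by force
      then show "l\<^sup>2 \<le> (?T \<omega>)\<^sup>2"
        using l by (metis abs_le_square_iff abs_of_pos)
    qed
  qed measurable
  also have "\<dots> \<le> (\<integral>\<omega>. (?T \<omega>)\<^sup>2 \<partial>M) / l\<^sup>2"
    using l stopped_sum_second_moment[OF s] by (intro integral_Markov_inequality_measure[where A="{}"]) auto
  also have "\<dots> \<le> (\<Sum>i<n. (a i)\<^sup>2) / l\<^sup>2"
    using stopped_sum_second_moment[OF s] by (intro divide_right_mono) auto
  finally show ?thesis .
qed

text \<open>
  Truncation at \<open>1\<close> may be moved inside the sum. It is this form that can be averaged over random
  coefficients whose sum of squares has no finite mean.
\<close>

lemma ennreal_min_one_suminf_le: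
  fixes x :: "nat \<Rightarrow> ennreal"
  shows "min 1 (\<Sum>i. x i) \<le> (\<Sum>i. min 1 (x i))"
proof (cases "\<exists>i. 1 \<le> x i")
  case True
  then obtain i where "1 \<le> x i" ..
  then have "1 = (\<Sum>j\<in>{i}. min 1 (x j))" by simp
  also have "\<dots> \<le> (\<Sum>i. min 1 (x i))" by (rule sum_le_suminf) auto
  finally show ?thesis by (simp add: min.coboundedI1)
next
  case False
  then have "min 1 (x i) = x i" for i by (metis linear min.absorb2)
  then show ?thesis by simp
qed

text \<open>
  The number of terms tends to infinity in \<open>kolmogorov_inequality_signs\<close>; the trivial bound \<open>1\<close> for a
  probability is built in through truncation.
\<close>

lemma (in prob_space) kolmogorov_tail_signs:
  assumes s: "iid_signs M \<gamma>" and l: "0 < l"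
  shows "emeasure M {\<omega> \<in> space M. \<exists>k. l \<le> \<bar>\<Sum>i<k. \<gamma> i \<omega> * a i\<bar>} \<le> (\<Sum>i. min 1 (ennreal ((a i / l)\<^sup>2)))"
proof -
  note [measurable] = iid_signsD(1)[OF s]
  let ?E = "\<lambda>n. {\<omega> \<in> space M. \<exists>k\<le>n. l \<le> \<bar>\<Sum>i<k. \<gamma> i \<omega> * a i\<bar>}"
  have [measurable]: "?E n \<in> sets M" for n by measurable
  have "{\<omega> \<in> space M. \<exists>k. l \<le> \<bar>\<Sum>i<k. \<gamma> i \<omega> * a i\<bar>} = (\<Union>n. ?E n)"
    by blast
  also have "emeasure M (\<Union>n. ?E n) = (SUP n. emeasure M (?E n))"
    by (rule SUP_emeasure_incseq[symmetric]) (auto simp: incseq_def intro: order_trans)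
  also have "\<dots> \<le> (\<Sum>i. ennreal ((a i / l)\<^sup>2))"
  proof (rule SUP_least)
    fix n
    have "emeasure M (?E n) \<le> ennreal ((\<Sum>i<n. (a i)\<^sup>2) / l\<^sup>2)"
      unfolding emeasure_eq_measure by (rule ennreal_leI) (rule kolmogorov_inequality_signs[OF s l])
    also have "\<dots> = (\<Sum>i<n. ennreal ((a i / l)\<^sup>2))"
      by (simp add: sum_divide_distrib power_divide)
    also have "\<dots> \<le> (\<Sum>i. ennreal ((a i / l)\<^sup>2))" by (rule sum_le_suminf) auto
    finally show "emeasure M (?E n) \<le> (\<Sum>i. ennreal ((a i / l)\<^sup>2))" .
  qed
  finally have "emeasure M {\<omega> \<in> space M. \<exists>k. l \<le> \<bar>\<Sum>i<k. \<gamma> i \<omega> * a i\<bar>} \<le> min 1 (\<Sum>i. ennreal ((a i / l)\<^sup>2))"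
    using emeasure_le_1 by (intro min.boundedI) auto
  also have "\<dots> \<le> (\<Sum>i. min 1 (ennreal ((a i / l)\<^sup>2)))" by (rule ennreal_min_one_suminf_le)
  finally show ?thesis .
qed

text \<open>
  The maximal inequality, applied to the coefficients from index \<open>m\<close> on, makes the oscillation of the
  partial sums after \<open>m\<close> small with high probability, whence they are almost surely Cauchy.
\<close>

lemma (in prob_space) random_signs_summable:
  assumes s: "iid_signs M \<gamma>" and a: "summable (\<lambda>i. (a i)\<^sup>2)"
  shows "AE \<omega> in M. summable (\<lambda>i. \<gamma> i \<omega> * a i)"
proof -
  note [measurable] = iid_signsD(1)[OF s]
  \<comment> \<open>Zeroing the first \<open>m\<close> coefficients avoids shifting the sequence of signs.\<close>
  define t where "t m i = (if i < m then 0 else a i)" for m i :: nat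
  have tail: "summable (\<lambda>i. (t m i)\<^sup>2)" "(\<Sum>i. (t m i)\<^sup>2) = (\<Sum>i. (a (i + m))\<^sup>2)" for m
  proof -
    show *: "summable (\<lambda>i. (t m i)\<^sup>2)"
      by (rule summable_comparison_test'[OF a, of 0]) (auto simp: t_def)
    show "(\<Sum>i. (t m i)\<^sup>2) = (\<Sum>i. (a (i + m))\<^sup>2)"
      by (subst suminf_split_initial_segment[OF *, of m]) (simp add: t_def)
  qed
  have *: "AE \<omega> in M. \<exists>m. \<forall>k. \<bar>\<Sum>i<k. \<gamma> i \<omega> * t m i\<bar> < e" if e: "e > 0" for e :: real
  proof -
    let ?E = "\<lambda>m. {\<omega> \<in> space M. \<exists>k. e \<le> \<bar>\<Sum>i<k. \<gamma> i \<omega> * t m i\<bar>}"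
    have [measurable]: "?E m \<in> sets M" for m by measurable
    have le: "emeasure M (\<Inter>m. ?E m) \<le> ennreal ((\<Sum>i. (a (i + m))\<^sup>2) / e\<^sup>2)" for m
    proof -
      have "emeasure M (\<Inter>m. ?E m) \<le> emeasure M (?E m)" by (rule emeasure_mono) auto
      also have "\<dots> \<le> (\<Sum>i. min 1 (ennreal ((t m i / e)\<^sup>2)))"
        by (rule kolmogorov_tail_signs[OF s e])
      also have "\<dots> \<le> (\<Sum>i. ennreal ((t m i / e)\<^sup>2))" by (intro suminf_le) auto
      also have "\<dots> = ennreal (\<Sum>i. (t m i)\<^sup>2 / e\<^sup>2)"
        using summable_divide[OF tail(1), of m "e\<^sup>2"]
        by (subst suminf_ennreal2) (auto simp: power_divide)
      also have "\<dots> = ennreal ((\<Sum>i. (a (i + m))\<^sup>2) / e\<^sup>2)"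
        using tail[of m] by (simp add: suminf_divide)
      finally show ?thesis .
    qed
    have "(\<lambda>m. ennreal ((\<Sum>i. (a (i + m))\<^sup>2) / e\<^sup>2)) \<longlonglongrightarrow> ennreal (0 / e\<^sup>2)"
      using e by (intro tendsto_ennrealI tendsto_divide suminf_exist_split2 a) auto
    then have "emeasure M (\<Inter>m. ?E m) \<le> ennreal (0 / e\<^sup>2)"
      by (rule tendsto_lowerbound) (use le in auto)
    then have "(\<Inter>m. ?E m) \<in> null_sets M" by auto
    from AE_not_in[OF this] show ?thesis
      by (rule AE_mp) (auto intro!: AE_I2 simp: not_le)
  qed
  have "AE \<omega> in M. \<forall>j. \<exists>m. \<forall>k. \<bar>\<Sum>i<k. \<gamma> i \<omega> * t m i\<bar> < 1 / real (Suc j)"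
    unfolding AE_all_countable by (intro allI *) simp
  then show ?thesis
  proof eventually_elim
    case (elim \<omega>)
    let ?x = "\<lambda>i. \<gamma> i \<omega> * a i"
    show ?case unfolding summable_Cauchy
    proof (intro allI impI)
      fix e :: real assume "0 < e"
      then obtain j where j: "1 / real (Suc j) < e / 2"
        using nat_approx_posE[of "e/2"] by auto
      from elim obtain m where m: "\<And>k. \<bar>\<Sum>i<k. \<gamma> i \<omega> * t m i\<bar> < 1 / real (Suc j)" by blast
      show "\<exists>N. \<forall>p\<ge>N. \<forall>q. norm (sum ?x {p..<q}) < e"
      proof (intro exI[of _ m] allI impI)
        fix p q assume p: "p \<ge> m"
        show "norm (sum ?x {p..<q}) < e"
        proof (cases "p \<le> q")
          case True
          have "(\<Sum>i<q. \<gamma> i \<omega> * t m i) = (\<Sum>i<p. \<gamma> i \<omega> * t m i) + (\<Sum>i=p..<q. \<gamma> i \<omega> * t m i)"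
            using True by (simp add: lessThan_atLeast0 sum.atLeastLessThan_concat)
          moreover have "(\<Sum>i=p..<q. \<gamma> i \<omega> * t m i) = sum ?x {p..<q}"
            using p by (intro sum.cong) (auto simp: t_def)
          ultimately show ?thesis using m[of p] m[of q] j unfolding real_norm_def by linarith
        qed (use \<open>0 < e\<close> in auto)
      qed
    qed
  qed
qed

text \<open>
  Fubini's theorem for the joint law: an independent variable may be integrated out first, with the
  other one frozen.
\<close>

lemma (in prob_space) emeasure_indep_pair:
  assumes ind: "indep_var S X T Y" and Z[measurable]: "Z \<in> sets (S \<Otimes>\<^sub>M T)"
  shows "emeasure M {\<omega> \<in> space M. (X \<omega>, Y \<omega>) \<in> Z} =
    (\<integral>\<^sup>+\<omega>. emeasure M {\<omega>' \<in> space M. (X \<omega>, Y \<omega>') \<in> Z} \<partial>M)"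
proof -
  have X[measurable]: "X \<in> measurable M S" and Y[measurable]: "Y \<in> measurable M T"
    and eq: "distr M S X \<Otimes>\<^sub>M distr M T Y = distr M (S \<Otimes>\<^sub>M T) (\<lambda>x. (X x, Y x))"
    using ind unfolding indep_var_distribution_eq by auto
  interpret X: prob_space "distr M S X" by (rule prob_space_distr) fact
  interpret Y: prob_space "distr M T Y" by (rule prob_space_distr) fact
  have "emeasure M {\<omega> \<in> space M. (X \<omega>, Y \<omega>) \<in> Z} = emeasure (distr M (S \<Otimes>\<^sub>M T) (\<lambda>x. (X x, Y x))) Z"
    by (subst emeasure_distr) (auto intro!: arg_cong[where f="emeasure M"])
  also have "\<dots> = (\<integral>\<^sup>+x. emeasure (distr M T Y) (Pair x -` Z) \<partial>distr M S X)"
    by (subst eq[symmetric], rule Y.emeasure_pair_measure_alt) auto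
  also have "\<dots> = (\<integral>\<^sup>+\<omega>. emeasure (distr M T Y) (Pair (X \<omega>) -` Z) \<partial>M)"
    using Y.measurable_emeasure_Pair[of Z] by (subst nn_integral_distr) auto
  also have "\<dots> = (\<integral>\<^sup>+\<omega>. emeasure M {\<omega>' \<in> space M. (X \<omega>, Y \<omega>') \<in> Z} \<partial>M)"
  proof (rule nn_integral_cong)
    fix \<omega> assume "\<omega> \<in> space M"
    then have "X \<omega> \<in> space S" using measurable_space[OF X] by auto
    then show "emeasure (distr M T Y) (Pair (X \<omega>) -` Z) = emeasure M {\<omega>' \<in> space M. (X \<omega>, Y \<omega>') \<in> Z}"
      by (subst emeasure_distr) (auto intro!: arg_cong[where f="emeasure M"] sets_Pair1)
  qed
  finally show ?thesis .
qed

abbreviation "real_sequences \<equiv> PiM (UNIV :: nat set) (\<lambda>_. borel :: real measure)"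

text \<open>
  Freezing the coefficients \<open>A\<close>, which are independent of the signs, reduces random coefficients to
  deterministic ones.
\<close>

lemma (in prob_space) signed_series_tail:
  assumes s: "iid_signs M \<gamma>" and ind: "indep_var real_sequences (\<lambda>\<omega> i. A i \<omega>) real_sequences (\<lambda>\<omega> i. \<gamma> i \<omega>)"
    and l: "0 < l"
  shows "emeasure M {\<omega> \<in> space M. \<exists>k. l \<le> \<bar>\<Sum>i<k. \<gamma> i \<omega> * A i \<omega>\<bar>} \<le> (\<integral>\<^sup>+\<omega>. (\<Sum>i. min 1 (ennreal ((A i \<omega> / l)\<^sup>2))) \<partial>M)"
proof -
  let ?Z = "{p \<in> space (real_sequences \<Otimes>\<^sub>M real_sequences). \<exists>k. l \<le> \<bar>\<Sum>i<k. snd p i * fst p i\<bar>}"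
  have [measurable]: "?Z \<in> sets (real_sequences \<Otimes>\<^sub>M real_sequences)" by measurable
  have "emeasure M {\<omega> \<in> space M. \<exists>k. l \<le> \<bar>\<Sum>i<k. \<gamma> i \<omega> * A i \<omega>\<bar>} =
     emeasure M {\<omega> \<in> space M. ((\<lambda>i. A i \<omega>), (\<lambda>i. \<gamma> i \<omega>)) \<in> ?Z}"
    by (simp add: space_pair_measure space_PiM PiE_def)
  also have "\<dots> = (\<integral>\<^sup>+\<omega>. emeasure M {\<omega>' \<in> space M. ((\<lambda>i. A i \<omega>), (\<lambda>i. \<gamma> i \<omega>')) \<in> ?Z} \<partial>M)"
    by (rule emeasure_indep_pair[OF ind]) measurable
  also have "\<dots> \<le> (\<integral>\<^sup>+\<omega>. (\<Sum>i. min 1 (ennreal ((A i \<omega> / l)\<^sup>2))) \<partial>M)"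
    using kolmogorov_tail_signs[OF s l]
    by (intro nn_integral_mono) (simp add: space_pair_measure space_PiM PiE_def)
  finally show ?thesis .
qed

lemma summable_if_min_one_summable:
  assumes "(\<Sum>i. min 1 (ennreal (x i))) < \<infinity>" and x: "\<And>i. 0 \<le> x i"
  shows "summable x"
proof -
  have "min 1 (ennreal (x i)) = ennreal (min 1 (x i))" for i
    using x[of i] by (cases "x i \<le> 1") (auto simp: min_def ennreal_le_1)
  then have "(\<Sum>i. ennreal (min 1 (x i))) \<noteq> top" using assms(1) by auto
  then have s: "summable (\<lambda>i. min 1 (x i))"
    using x by (intro summable_suminf_not_top) auto
  have "(\<lambda>i. min 1 (x i)) \<longlonglongrightarrow> 0" by (rule summable_LIMSEQ_zero[OF s])
  then have "\<forall>\<^sub>F i in sequentially. min 1 (x i) < 1" by (rule order_tendstoD) simp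
  then have "\<forall>\<^sub>F i in sequentially. min 1 (x i) = x i" by eventually_elim auto
  then show ?thesis using summable_cong[of "\<lambda>i. min 1 (x i)" x] s by blast
qed

text \<open>
  Cauchy's criterion with tolerances \<open>1 / (j + 1)\<close> uses countable quantifiers only.
\<close>

lemma measurable_summable[measurable]:
  fixes x :: "nat \<Rightarrow> 'a \<Rightarrow> real"
  assumes [measurable]: "\<And>i. x i \<in> borel_measurable N"
  shows "Measurable.pred N (\<lambda>\<omega>. summable (\<lambda>i. x i \<omega>))"
proof -
  have "summable f \<longleftrightarrow> (\<forall>j. \<exists>N. \<forall>m. \<forall>n. N \<le> m \<longrightarrow> \<bar>sum f {m..<n}\<bar> < 1 / real (Suc j))" for f :: "nat \<Rightarrow> real"
    unfolding summable_Cauchy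
  proof safe
    fix e :: real assume e: "0 < e" and *: "\<forall>j. \<exists>N. \<forall>m n. N \<le> m \<longrightarrow> \<bar>sum f {m..<n}\<bar> < 1 / real (Suc j)"
    obtain j where "1 / real (Suc j) < e" using nat_approx_posE[OF e] by auto
    with * show "\<exists>N. \<forall>m\<ge>N. \<forall>n. norm (sum f {m..<n}) < e"
      unfolding real_norm_def by (meson less_trans)
  qed (auto simp del: of_nat_Suc)
  then show ?thesis by simp
qed

lemma (in prob_space) signed_series_summable:
  assumes s: "iid_signs M \<gamma>" and ind: "indep_var real_sequences (\<lambda>\<omega> i. A i \<omega>) real_sequences (\<lambda>\<omega> i. \<gamma> i \<omega>)"
    and fin: "(\<integral>\<^sup>+\<omega>. (\<Sum>i. min 1 (ennreal ((A i \<omega>)\<^sup>2))) \<partial>M) < \<infinity>"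
  shows "AE \<omega> in M. summable (\<lambda>i. \<gamma> i \<omega> * A i \<omega>)"
proof -
  note [measurable] = iid_signsD(1)[OF s]
  have A[measurable]: "A i \<in> borel_measurable M" for i
    using measurable_compose[OF indep_var_rv1[OF ind] measurable_component_singleton[of i]] by simp
  let ?Z = "{p \<in> space (real_sequences \<Otimes>\<^sub>M real_sequences). \<not> summable (\<lambda>i. snd p i * fst p i)}"
  have [measurable]: "?Z \<in> sets (real_sequences \<Otimes>\<^sub>M real_sequences)"
    by measurable
  have "AE \<omega> in M. (\<Sum>i. min 1 (ennreal ((A i \<omega>)\<^sup>2))) \<noteq> \<infinity>"
    by (rule nn_integral_PInf_AE) (use fin in auto)
  then have ae: "AE \<omega> in M. summable (\<lambda>i. (A i \<omega>)\<^sup>2)"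
    by eventually_elim (auto intro!: summable_if_min_one_summable simp: less_top)
  have "emeasure M {\<omega> \<in> space M. \<not> summable (\<lambda>i. \<gamma> i \<omega> * A i \<omega>)} =
     emeasure M {\<omega> \<in> space M. ((\<lambda>i. A i \<omega>), (\<lambda>i. \<gamma> i \<omega>)) \<in> ?Z}"
    by (simp add: space_pair_measure space_PiM PiE_def)
  also have "\<dots> = (\<integral>\<^sup>+\<omega>. emeasure M {\<omega>' \<in> space M. ((\<lambda>i. A i \<omega>), (\<lambda>i. \<gamma> i \<omega>')) \<in> ?Z} \<partial>M)"
    by (rule emeasure_indep_pair[OF ind]) measurable
  also have "\<dots> = (\<integral>\<^sup>+\<omega>. 0 \<partial>M)"
  proof (rule nn_integral_cong_AE)
    show "AE \<omega> in M. emeasure M {\<omega>' \<in> space M. ((\<lambda>i. A i \<omega>), (\<lambda>i. \<gamma> i \<omega>')) \<in> ?Z} = 0"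
      using ae
    proof eventually_elim
      case (elim \<omega>)
      have "{\<omega>' \<in> space M. \<not> summable (\<lambda>i. \<gamma> i \<omega>' * A i \<omega>)} \<in> null_sets M"
        using random_signs_summable[OF s elim]
        by (subst (asm) AE_iff_null) auto
      then show ?case by (simp add: space_pair_measure space_PiM PiE_def null_setsD1)
    qed
  qed
  finally have "emeasure M {\<omega> \<in> space M. \<not> summable (\<lambda>i. \<gamma> i \<omega> * A i \<omega>)} = 0" by simp
  then show ?thesis
    by (subst AE_iff_null) auto
qed

section \<open>Sums over the marked arrival times\<close>

lemma poisson_pmf_mean:
  assumes r: "0 < r"
  shows "(\<integral>\<^sup>+k. ennreal (real k) \<partial>measure_pmf (poisson_pmf r)) = ennreal r"
proof -
  let ?f = "\<lambda>k. r ^ k / fact k * exp (- r) * real k"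
  have "(\<lambda>k. r * exp (- r) * (r ^ k /\<^sub>R fact k)) sums (r * exp (- r) * exp r)"
    by (intro sums_mult exp_converges)
  moreover have "r * exp (- r) * (r ^ k /\<^sub>R fact k) = ?f (Suc k)" for k
    by (simp add: field_simps del: of_nat_Suc)
  moreover have "r * exp (- r) * exp r = r"
    by (simp add: exp_minus)
  ultimately have "(\<lambda>k. ?f (Suc k)) sums r"
    by (simp only:)
  then have sums: "?f sums r"
    using sums_Suc[of ?f r] by simp
  have "(\<integral>\<^sup>+k. ennreal (real k) \<partial>measure_pmf (poisson_pmf r))
      = (\<Sum>k. ennreal (pmf (poisson_pmf r) k) * ennreal (real k))"
    by (subst nn_integral_measure_pmf) (rule nn_integral_count_space_nat)
  also have "\<dots> = (\<Sum>k. ennreal (?f k))"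
    using r by (intro suminf_cong) (simp add: ennreal_mult'[symmetric])
  also have "\<dots> = ennreal r"
    using r by (intro suminf_ennreal_eq sums) auto
  finally show ?thesis .
qed

lemma poisson_pmf_escapes:
  "((\<lambda>r. measure (measure_pmf (poisson_pmf r)) {..n}) \<longlongrightarrow> 0) at_top"
proof -
  have "((\<lambda>r::real. \<Sum>k\<le>n. (r ^ k / exp r) / fact k) \<longlongrightarrow> (\<Sum>k\<le>n. 0 / fact k)) at_top"
    by (intro tendsto_sum tendsto_divide[OF tendsto_power_div_exp_0 tendsto_const]) auto
  moreover have "\<forall>\<^sub>F r in at_top. (\<Sum>k\<le>n. (r ^ k / exp r) / fact k) = measure (measure_pmf (poisson_pmf r)) {..n}"
    using eventually_gt_at_top[of 0]
    by eventually_elim (simp add: measure_measure_pmf_finite exp_minus field_simps)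
  ultimately show ?thesis by (simp cong: filterlim_cong)
qed

text \<open>
  The event \<open>N n \<le> i\<close> for all \<open>n\<close> is contained in \<open>N n \<le> i\<close> for each \<open>n\<close>, whose Poisson probability
  tends to \<open>0\<close>. Without this an arrival time could be the infimum of an empty set.
\<close>

lemma poisson_process_unbounded:
  assumes "prob_space M" and N: "poisson_process M 1 N"
  shows "AE \<omega> in M. \<forall>i. \<exists>n::nat. Suc i \<le> N (real n) \<omega>"
  unfolding AE_all_countable
proof
  fix i
  interpret prob_space M by fact
  have N_meas: "N t \<in> measurable M (count_space UNIV)" if "0 \<le> t" for t
    using N that by (auto simp: poisson_process_def)
  note [measurable] = N_meas[of "real n" for n, simplified] N_meas[of 0, simplified]
  have N0: "AE \<omega> in M. N 0 \<omega> = 0"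
    using N unfolding poisson_process_def by auto
  let ?E = "\<lambda>n. {\<omega> \<in> space M. N (real n) \<omega> \<le> i}"
  have [measurable]: "?E n \<in> sets M" for n by measurable
  have prob_E: "prob (\<Inter>n. ?E n) \<le> measure (measure_pmf (poisson_pmf (real n))) {..i}" if "n > 0" for n
  proof -
    have "distr M (count_space UNIV) (\<lambda>\<omega>. N (real n) \<omega> - N 0 \<omega>) = measure_pmf (poisson_pmf (1 * (real n - 0)))"
      using N that unfolding poisson_process_def by (metis of_nat_0_less_iff order_refl)
    then have "measure (measure_pmf (poisson_pmf (real n))) {..i} =
        measure (distr M (count_space UNIV) (\<lambda>\<omega>. N (real n) \<omega> - N 0 \<omega>)) {..i}" by simp
    also have "\<dots> = prob {\<omega> \<in> space M. N (real n) \<omega> - N 0 \<omega> \<le> i}"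
      by (subst measure_distr) (auto intro!: arg_cong[where f=prob])
    also have "\<dots> = prob (?E n)"
      using N0 by (intro measure_eq_AE) auto
    finally show ?thesis by (auto intro!: finite_measure_mono)
  qed
  have lim: "(\<lambda>n. measure (measure_pmf (poisson_pmf (real n))) {..i}) \<longlonglongrightarrow> 0"
    by (rule filterlim_compose[OF poisson_pmf_escapes filterlim_real_sequentially])
  have "prob (\<Inter>n. ?E n) \<le> 0"
    by (rule tendsto_lowerbound[OF lim])
       (use prob_E in \<open>auto intro!: eventually_mono[OF eventually_gt_at_top[of 0]]\<close>)
  then have "(\<Inter>n. ?E n) \<in> null_sets M"
    by (simp add: null_sets_def emeasure_eq_measure measure_le_0_iff)
  from AE_not_in[OF this] show "AE \<omega> in M. \<exists>n::nat. Suc i \<le> N (real n) \<omega>"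
    by (rule AE_mp) (auto intro!: AE_I2 simp: not_le Suc_le_eq)
qed

text \<open>
  A right-continuous counting path is constant just after the infimum, so the infimum is attained.
\<close>

lemma arrival_le_iff:
  fixes n :: "real \<Rightarrow> nat"
  assumes n0: "n 0 = 0" and mono: "mono_on {0..} n"
    and cont: "\<forall>t\<ge>0. continuous (at_right t) n"
    and unb: "\<exists>k::nat. Suc i \<le> n (real k)" and t: "0 \<le> t"
  shows "Inf {t. 0 \<le> t \<and> Suc i \<le> n t} \<le> t \<longleftrightarrow> Suc i \<le> n t"
proof -
  \<comment> \<open>The set of times by which the count exceeds \<open>i\<close>.\<close>
  define S where "S = {t. 0 \<le> t \<and> Suc i \<le> n t}"
  have ne: "S \<noteq> {}" using unb unfolding S_def by force
  have bdd: "bdd_below S" by (rule bdd_belowI[of _ 0]) (auto simp: S_def)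
  define g where "g = Inf S"
  have g0: "0 \<le> g" unfolding g_def using ne by (intro cInf_greatest) (auto simp: S_def)
  have "(n \<longlongrightarrow> n g) (at_right g)"
    using cont g0 by (auto simp: continuous_within)
  then have "\<forall>\<^sub>F s in at_right g. n s = n g"
    by (simp add: tendsto_discrete)
  then obtain e where e: "g < e" "\<And>s. g < s \<Longrightarrow> s < e \<Longrightarrow> n s = n g"
    unfolding eventually_at_right_field by blast
  obtain s where s: "s \<in> S" "s < e" using cInf_lessD[OF ne, of e] e(1) by (auto simp: g_def)
  have "g \<le> s" unfolding g_def using s bdd by (intro cInf_lower)
  then have "Suc i \<le> n g"
    using e(2)[of s] s by (cases "s = g") (auto simp: S_def)
  moreover have "n g \<le> n t" if "g \<le> t"
    using mono g0 that t by (auto simp: mono_on_def)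
  ultimately show ?thesis
    unfolding S_def[symmetric] g_def[symmetric]
    using cInf_lower[OF _ bdd, of t] t by (force simp: S_def g_def)
qed

lemma arrival_counting_process:
  assumes M: "prob_space M" and \<Gamma>: "poisson_arrival_times M 1 \<Gamma>"
  obtains N where "poisson_process M 1 N"
    "AE \<omega> in M. N 0 \<omega> = 0 \<and> mono_on {0..} (\<lambda>t. N t \<omega>) \<and> (\<forall>i. \<forall>t\<ge>0. \<Gamma> i \<omega> \<le> t \<longleftrightarrow> Suc i \<le> N t \<omega>)"
proof -
  obtain N where N: "poisson_process M 1 N"
    and \<Gamma>N: "AE \<omega> in M. \<forall>i. \<Gamma> i \<omega> = Inf {t. 0 \<le> t \<and> Suc i \<le> N t \<omega>}"
    using \<Gamma> by (auto simp: poisson_arrival_times_def)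
  have path: "AE \<omega> in M. N 0 \<omega> = 0 \<and> mono_on {0..} (\<lambda>t. N t \<omega>) \<and> (\<forall>t\<ge>0. continuous (at_right t) (\<lambda>s. N s \<omega>))"
    using N by (auto simp: poisson_process_def)
  have "AE \<omega> in M. N 0 \<omega> = 0 \<and> mono_on {0..} (\<lambda>t. N t \<omega>) \<and> (\<forall>i. \<forall>t\<ge>0. \<Gamma> i \<omega> \<le> t \<longleftrightarrow> Suc i \<le> N t \<omega>)"
    using \<Gamma>N path poisson_process_unbounded[OF M N]
  proof eventually_elim
    case (elim \<omega>)
    then show ?case
      using arrival_le_iff[of "\<lambda>t. N t \<omega>"] by auto
  qed
  with N show thesis by (rule that)
qed

lemma arrivals_positive:
  assumes "prob_space M" and "poisson_arrival_times M 1 \<Gamma>"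
  shows "AE \<omega> in M. \<forall>i. 0 < \<Gamma> i \<omega>"
proof -
  obtain N where "AE \<omega> in M. N 0 \<omega> = 0 \<and> mono_on {0..} (\<lambda>t. N t \<omega>) \<and> (\<forall>i. \<forall>t\<ge>0. \<Gamma> i \<omega> \<le> t \<longleftrightarrow> Suc i \<le> N t \<omega>)"
    using arrival_counting_process[OF assms] by blast
  then show ?thesis
  proof eventually_elim
    case (elim \<omega>)
    show ?case
    proof
      fix i
      have "\<Gamma> i \<omega> \<le> 0 \<longleftrightarrow> Suc i \<le> N 0 \<omega>" using elim by blast
      moreover have "N 0 \<omega> = 0" using elim by blast
      ultimately show "0 < \<Gamma> i \<omega>" by simp
    qed
  qed
qed

text \<open>
  The arrivals in \<open>(s, t]\<close> are exactly those with index between \<open>N s\<close> and \<open>N t\<close>, so their number is the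
  Poisson increment of the process, with mean \<open>t - s\<close>.
\<close>

lemma expected_arrivals:
  assumes M: "prob_space M" and \<Gamma>: "poisson_arrival_times M 1 \<Gamma>"
    and st: "0 \<le> s" "s < t"
  shows "(\<Sum>i. emeasure M {\<omega> \<in> space M. \<Gamma> i \<omega> \<in> {s<..t}}) = ennreal (t - s)"
proof -
  interpret prob_space M by fact
  have [measurable]: "\<Gamma> i \<in> borel_measurable M" for i
    using \<Gamma> by (auto simp: poisson_arrival_times_def)
  obtain N where N: "poisson_process M 1 N"
    and iff: "AE \<omega> in M. N 0 \<omega> = 0 \<and> mono_on {0..} (\<lambda>t. N t \<omega>) \<and> (\<forall>i. \<forall>t\<ge>0. \<Gamma> i \<omega> \<le> t \<longleftrightarrow> Suc i \<le> N t \<omega>)"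
    using arrival_counting_process[OF M \<Gamma>] by blast
  have [measurable]: "N s \<in> measurable M (count_space UNIV)" "N t \<in> measurable M (count_space UNIV)"
    using N st by (auto simp: poisson_process_def)
  have "(\<Sum>i. emeasure M {\<omega> \<in> space M. \<Gamma> i \<omega> \<in> {s<..t}}) =
      (\<Sum>i. \<integral>\<^sup>+\<omega>. indicator {s<..t} (\<Gamma> i \<omega>) \<partial>M)"
  proof (rule suminf_cong)
    fix i
    have "(\<integral>\<^sup>+\<omega>. indicator {s<..t} (\<Gamma> i \<omega>) \<partial>M) = (\<integral>\<^sup>+\<omega>. indicator {\<omega> \<in> space M. \<Gamma> i \<omega> \<in> {s<..t}} \<omega> \<partial>M)"
      by (intro nn_integral_cong) (auto simp: indicator_def)
    then show "emeasure M {\<omega> \<in> space M. \<Gamma> i \<omega> \<in> {s<..t}} = (\<integral>\<^sup>+\<omega>. indicator {s<..t} (\<Gamma> i \<omega>) \<partial>M)"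
      by simp
  qed
  also have "\<dots> = (\<integral>\<^sup>+\<omega>. (\<Sum>i. indicator {s<..t} (\<Gamma> i \<omega>)) \<partial>M)"
    by (subst nn_integral_suminf) auto
  also have "\<dots> = (\<integral>\<^sup>+\<omega>. ennreal (real (N t \<omega> - N s \<omega>)) \<partial>M)"
  proof (rule nn_integral_cong_AE)
    show "AE \<omega> in M. (\<Sum>i. indicator {s<..t} (\<Gamma> i \<omega>)) = ennreal (real (N t \<omega> - N s \<omega>))"
      using iff
    proof eventually_elim
      case (elim \<omega>)
      have "indicator {s<..t} (\<Gamma> i \<omega>) = (indicator {N s \<omega>..<N t \<omega>} i :: ennreal)" for i
        using elim st by (auto simp: indicator_def not_le[symmetric])
      then have "(\<Sum>i. indicator {s<..t} (\<Gamma> i \<omega>)) = (\<Sum>i. indicator {N s \<omega>..<N t \<omega>} i :: ennreal)"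
        by simp
      also have "\<dots> = (\<Sum>i\<in>{N s \<omega>..<N t \<omega>}. indicator {N s \<omega>..<N t \<omega>} i)"
        by (rule suminf_finite) auto
      also have "\<dots> = ennreal (real (N t \<omega> - N s \<omega>))"
        by (simp add: ennreal_of_nat_eq_real_of_nat)
      finally show ?case .
    qed
  qed
  also have "\<dots> = (\<integral>\<^sup>+k. ennreal (real k) \<partial>distr M (count_space UNIV) (\<lambda>\<omega>. N t \<omega> - N s \<omega>))"
    by (subst nn_integral_distr) auto
  also have "distr M (count_space UNIV) (\<lambda>\<omega>. N t \<omega> - N s \<omega>) = measure_pmf (poisson_pmf (t - s))"
    using N st unfolding poisson_process_def by (metis mult_1)
  also have "(\<integral>\<^sup>+k. ennreal (real k) \<partial>\<dots>) = ennreal (t - s)"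
    using st by (intro poisson_pmf_mean) auto
  finally show "(\<Sum>i. emeasure M {\<omega> \<in> space M. \<Gamma> i \<omega> \<in> {s<..t}}) = ennreal (t - s)" .
qed

text \<open>
  The mean measure of the arrival times and Lebesgue measure on \<open>(0, \<infinity>)\<close> agree on half-open
  intervals by \<open>expected_arrivals\<close>, hence everywhere.
\<close>

lemma campbell_arrivals:
  assumes M: "prob_space M" and \<Gamma>: "poisson_arrival_times M 1 \<Gamma>"
    and h[measurable]: "h \<in> borel_measurable borel"
  shows "(\<Sum>i. \<integral>\<^sup>+\<omega>. h (\<Gamma> i \<omega>) \<partial>M) = (\<integral>\<^sup>+y. indicator {0<..} y * h y \<partial>lborel)"
proof -
  interpret prob_space M by fact
  have \<Gamma>_meas[measurable]: "\<Gamma> i \<in> borel_measurable M" for i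
    using \<Gamma> by (auto simp: poisson_arrival_times_def)
  have pos: "AE \<omega> in M. \<forall>i. 0 < \<Gamma> i \<omega>"
    by (rule arrivals_positive[OF M \<Gamma>])
  have [measurable]: "(\<lambda>p. \<Gamma> (fst p) (snd p)) \<in> borel_measurable (count_space UNIV \<Otimes>\<^sub>M M)"
    by (rule measurable_pair_measure_countable1) auto
  \<comment> \<open>The mean measure of the points, as an image of counting measure on the indices times \<open>M\<close>.\<close>
  define \<nu> where "\<nu> = distr (count_space UNIV \<Otimes>\<^sub>M M) borel (\<lambda>p. \<Gamma> (fst p) (snd p))"
  have int_\<nu>: "(\<integral>\<^sup>+y. h y \<partial>\<nu>) = (\<Sum>i. \<integral>\<^sup>+\<omega>. h (\<Gamma> i \<omega>) \<partial>M)"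
    if [measurable]: "h \<in> borel_measurable borel" for h
    unfolding \<nu>_def
    by (subst nn_integral_distr, simp, simp, subst nn_integral_fst[symmetric])
       (auto simp: nn_integral_count_space_nat)
  let ?L = "density lborel (indicator {0<..})"
  have Ioc: "emeasure \<nu> {a<..b} = emeasure ?L {a<..b}" for a b
  proof -
    let ?a = "max 0 a" and ?b = "max 0 b"
    have "emeasure \<nu> {a<..b} = (\<integral>\<^sup>+y. indicator {a<..b} y \<partial>\<nu>)"
      by (rule nn_integral_indicator[symmetric]) (simp add: \<nu>_def)
    also have "\<dots> = (\<Sum>i. \<integral>\<^sup>+\<omega>. indicator {a<..b} (\<Gamma> i \<omega>) \<partial>M)"
      by (rule int_\<nu>) simp
    also have "\<dots> = (\<Sum>i. \<integral>\<^sup>+\<omega>. indicator {\<omega> \<in> space M. \<Gamma> i \<omega> \<in> {?a<..?b}} \<omega> \<partial>M)"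
    proof (intro suminf_cong nn_integral_cong_AE)
      fix i
      show "AE \<omega> in M. indicator {a<..b} (\<Gamma> i \<omega>) = (indicator {\<omega> \<in> space M. \<Gamma> i \<omega> \<in> {?a<..?b}} \<omega> :: ennreal)"
        using pos AE_space
      proof eventually_elim
        case (elim \<omega>)
        then have "0 < \<Gamma> i \<omega>" by simp
        with elim(2) show ?case by (auto simp: indicator_def max_def)
      qed
    qed
    also have "\<dots> = (\<Sum>i. emeasure M {\<omega> \<in> space M. \<Gamma> i \<omega> \<in> {?a<..?b}})"
      by (intro suminf_cong nn_integral_indicator) simp
    also have "\<dots> = emeasure lborel {?a<..?b}"
    proof (cases "?a < ?b")
      case True
      then show ?thesis using expected_arrivals[OF M \<Gamma>, of ?a ?b] by simp
    next
      case False
      then have "{?a<..?b} = {}" by auto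
      then show ?thesis by (simp del: max_less_iff_conj greaterThanAtMost_iff greaterThanAtMost_empty_iff)
    qed
    also have "\<dots> = emeasure ?L {a<..b}"
      by (subst emeasure_density)
         (auto simp: nn_integral_indicator[symmetric] indicator_def intro!: nn_integral_cong simp del: nn_integral_indicator)
    finally show ?thesis .
  qed
  have "\<nu> = ?L"
  proof (rule measure_eqI_generator_eq)
    show "Int_stable (range (\<lambda>(a, b). {a<..b::real}))"
      by (auto simp: Int_stable_def)
    show "range (\<lambda>(a, b). {a<..b::real}) \<subseteq> Pow UNIV" by simp
    show "emeasure \<nu> X = emeasure ?L X" if "X \<in> range (\<lambda>(a, b). {a<..b::real})" for X
      using that Ioc by auto
    show "sets \<nu> = sigma_sets UNIV (range (\<lambda>(a, b). {a<..b::real}))"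
      "sets ?L = sigma_sets UNIV (range (\<lambda>(a, b). {a<..b::real}))"
      by (simp_all add: \<nu>_def borel_sigma_sets_Ioc)
    show "range (\<lambda>n::nat. {-real n<..real n}) \<subseteq> range (\<lambda>(a, b). {a<..b::real})" by auto
    show "(\<Union>n::nat. {-real n<..real n}) = UNIV"
    proof safe
      fix x :: real
      obtain n :: nat where "\<bar>x\<bar> < real n" using reals_Archimedean2 by blast
      then show "x \<in> (\<Union>n::nat. {-real n<..real n})" by (intro UN_I[of n]) auto
    qed simp
    fix n :: nat
    have "emeasure ?L {-real n<..real n} \<le> emeasure lborel {-real n<..real n}"
      by (subst emeasure_density)
         (auto simp: nn_integral_indicator[symmetric] indicator_def intro!: nn_integral_mono simp del: nn_integral_indicator)
    also have "\<dots> < \<infinity>" by simp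
    finally show "emeasure \<nu> {-real n<..real n} \<noteq> \<infinity>" by (simp add: Ioc)
  qed
  then show ?thesis
    using int_\<nu>[OF h] by (simp add: nn_integral_density)
qed

text \<open>
  Campbell's formula for independent marks, obtained by integrating out the mark of each point first.
  Independence is stated as an equation between laws because the arrival times and the marks have
  different types.
\<close>

lemma campbell_marked:
  assumes M: "prob_space M" and \<Gamma>: "poisson_arrival_times M 1 \<Gamma>"
    and V[measurable]: "\<And>i. V i \<in> measurable M L" and law: "\<And>i. distr M L (V i) = L"
    and ind: "\<And>i. distr M (borel \<Otimes>\<^sub>M L) (\<lambda>\<omega>. (\<Gamma> i \<omega>, V i \<omega>)) = distr M borel (\<Gamma> i) \<Otimes>\<^sub>M distr M L (V i)"
    and g[measurable]: "(\<lambda>(y, x). g y x) \<in> borel_measurable (borel \<Otimes>\<^sub>M L)"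
  shows "(\<Sum>i. \<integral>\<^sup>+\<omega>. g (\<Gamma> i \<omega>) (V i \<omega>) \<partial>M) = (\<integral>\<^sup>+y. indicator {0<..} y * (\<integral>\<^sup>+x. g y x \<partial>L) \<partial>lborel)"
proof -
  interpret prob_space M by fact
  have [measurable]: "\<Gamma> i \<in> borel_measurable M" for i
    using \<Gamma> by (auto simp: poisson_arrival_times_def)
  have "prob_space (distr M L (V 0))" by (rule prob_space_distr) simp
  then interpret L: prob_space L by (simp only: law)
  have "(\<integral>\<^sup>+\<omega>. g (\<Gamma> i \<omega>) (V i \<omega>) \<partial>M) = (\<integral>\<^sup>+\<omega>. (\<integral>\<^sup>+x. g (\<Gamma> i \<omega>) x \<partial>L) \<partial>M)" for i
  proof -
    have "(\<integral>\<^sup>+\<omega>. g (\<Gamma> i \<omega>) (V i \<omega>) \<partial>M) =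
        (\<integral>\<^sup>+p. g (fst p) (snd p) \<partial>distr M (borel \<Otimes>\<^sub>M L) (\<lambda>\<omega>. (\<Gamma> i \<omega>, V i \<omega>)))"
      by (subst nn_integral_distr) (auto simp: split_beta')
    also have "distr M (borel \<Otimes>\<^sub>M L) (\<lambda>\<omega>. (\<Gamma> i \<omega>, V i \<omega>)) = distr M borel (\<Gamma> i) \<Otimes>\<^sub>M L"
      by (simp only: ind law)
    also have "(\<integral>\<^sup>+p. g (fst p) (snd p) \<partial>\<dots>) = (\<integral>\<^sup>+y. (\<integral>\<^sup>+x. g y x \<partial>L) \<partial>distr M borel (\<Gamma> i))"
      by (subst L.nn_integral_fst[symmetric]) (auto simp: split_beta')
    also have "\<dots> = (\<integral>\<^sup>+\<omega>. (\<integral>\<^sup>+x. g (\<Gamma> i \<omega>) x \<partial>L) \<partial>M)"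
      by (subst nn_integral_distr) auto
    finally show ?thesis .
  qed
  then show ?thesis
    by (simp add: campbell_arrivals[OF M \<Gamma>, of "\<lambda>y. \<integral>\<^sup>+x. g y x \<partial>L"])
qed

lemma Int_stable_seq_events: "Int_stable (seq_events M D S)"
  unfolding seq_events_def by (rule sets.Int_stable)

lemma seq_events_Pow: "seq_events M D S \<subseteq> Pow (space M)"
  unfolding seq_events_def by (metis sets.space_closed space_vimage_algebra)

lemma seq_events_sequence:
  assumes "\<And>i. S i \<in> measurable M D" and "A \<in> sets (PiM UNIV (\<lambda>_. D))"
  shows "(\<lambda>\<omega> i. S i \<omega>) -` A \<inter> space M \<in> seq_events M D S"
  unfolding seq_events_def using assms(2) by (rule in_vimage_algebra)

lemma seq_events_component:
  assumes S: "\<And>i. S i \<in> measurable M D" and A: "A \<in> sets D"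
  shows "S i -` A \<inter> space M \<in> seq_events M D S"
proof -
  have "(\<lambda>s. s i) \<in> measurable (PiM UNIV (\<lambda>_. D)) D" by (rule measurable_component_singleton) simp
  then have "(\<lambda>s. s i) -` A \<inter> space (PiM UNIV (\<lambda>_. D)) \<in> sets (PiM UNIV (\<lambda>_. D))"
    using A by (rule measurable_sets)
  from seq_events_sequence[OF S this]
  have "(\<lambda>\<omega> i. S i \<omega>) -` ((\<lambda>s. s i) -` A \<inter> space (PiM UNIV (\<lambda>_. D))) \<inter> space M \<in> seq_events M D S" .
  moreover have "(\<lambda>\<omega> i. S i \<omega>) -` ((\<lambda>s. s i) -` A \<inter> space (PiM UNIV (\<lambda>_. D))) \<inter> space M = S i -` A \<inter> space M"
    using S by (auto simp: space_PiM PiE_def dest: measurable_space)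
  ultimately show ?thesis by simp
qed

lemma indep_sequences_joint_law:
  assumes M: "prob_space M" and ind: "indep_sequences M A X B Y C Z"
    and X[measurable]: "\<And>i. X i \<in> measurable M A" and Y[measurable]: "\<And>i. Y i \<in> measurable M B"
  shows "distr M (A \<Otimes>\<^sub>M B) (\<lambda>\<omega>. (X i \<omega>, Y i \<omega>)) = distr M A (X i) \<Otimes>\<^sub>M distr M B (Y i)"
proof -
  interpret prob_space M by fact
  let ?G = "\<lambda>k::nat. [seq_events M A X, seq_events M B Y, seq_events M C Z] ! k"
  interpret X: prob_space "distr M A (X i)" by (rule prob_space_distr) simp
  interpret Y: prob_space "distr M B (Y i)" by (rule prob_space_distr) simp
  have "distr M A (X i) \<Otimes>\<^sub>M distr M B (Y i) = distr M (A \<Otimes>\<^sub>M B) (\<lambda>\<omega>. (X i \<omega>, Y i \<omega>))"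
  proof (rule pair_measure_eqI)
    show "sets (distr M A (X i) \<Otimes>\<^sub>M distr M B (Y i)) = sets (distr M (A \<Otimes>\<^sub>M B) (\<lambda>\<omega>. (X i \<omega>, Y i \<omega>)))"
      by (simp cong: sets_pair_measure_cong)
    fix P Q assume "P \<in> sets (distr M A (X i))" "Q \<in> sets (distr M B (Y i))"
    then have P[measurable]: "P \<in> sets A" and Q[measurable]: "Q \<in> sets B" by auto
    define T where "T k = (if k = (0::nat) then X i -` P \<inter> space M else Y i -` Q \<inter> space M)" for k
    have "indep_sets ?G {0, 1, 2}" using ind by (simp add: indep_sequences_def)
    then have "prob (\<Inter>k\<in>{0, 1}. T k) = (\<Prod>k\<in>{0, 1}. prob (T k))"
      by (rule indep_setsD) (auto simp: T_def intro: seq_events_component X Y P Q)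
    then have "prob (X i -` P \<inter> space M \<inter> (Y i -` Q \<inter> space M)) = prob (X i -` P \<inter> space M) * prob (Y i -` Q \<inter> space M)"
      by (simp add: T_def Int_commute)
    moreover have "(\<lambda>\<omega>. (X i \<omega>, Y i \<omega>)) -` (P \<times> Q) \<inter> space M = X i -` P \<inter> space M \<inter> (Y i -` Q \<inter> space M)"
      by auto
    ultimately show "emeasure (distr M A (X i)) P * emeasure (distr M B (Y i)) Q =
        emeasure (distr M (A \<Otimes>\<^sub>M B) (\<lambda>\<omega>. (X i \<omega>, Y i \<omega>))) (P \<times> Q)"
      by (simp add: emeasure_distr emeasure_eq_measure ennreal_mult'[symmetric])
  qed unfold_locales
  then show ?thesis ..
qed

text \<open>
  A function of the first two sequences is measurable with respect to the \<open>\<sigma>\<close>-algebra that they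
  generate together, and this \<open>\<sigma>\<close>-algebra is independent of the third sequence.
\<close>

lemma indep_sequences_indep_var:
  fixes A :: "'a measure" and B :: "'b measure" and C D :: "'c measure"
  assumes M: "prob_space M" and ind: "indep_sequences M A X B Y C Z"
    and X: "\<And>i. X i \<in> measurable M A" and Y: "\<And>i. Y i \<in> measurable M B" and Z: "\<And>i. Z i \<in> measurable M C"
    and F: "F \<in> measurable (A \<Otimes>\<^sub>M B) D"
  shows "prob_space.indep_var M (PiM UNIV (\<lambda>_. D)) (\<lambda>\<omega> i. F (X i \<omega>, Y i \<omega>)) (PiM UNIV (\<lambda>_. C)) (\<lambda>\<omega> i. Z i \<omega>)"
proof -
  interpret prob_space M by fact
  let ?G = "\<lambda>k::nat. [seq_events M A X, seq_events M B Y, seq_events M C Z] ! k"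
  have G: "indep_sets ?G {0, 1, 2}" using ind by (simp add: indep_sequences_def)
  let ?W = "\<lambda>\<omega> i. F (X i \<omega>, Y i \<omega>)"
  let ?P = "PiM (UNIV :: nat set) (\<lambda>_. D)"
  \<comment> \<open>The \<open>\<sigma>\<close>-algebra generated by the first two sequences together.\<close>
  define H where "H = sigma (space M) (seq_events M A X \<union> seq_events M B Y)"
  have sets_H: "sets H = sigma_sets (space M) (seq_events M A X \<union> seq_events M B Y)"
    unfolding H_def using seq_events_Pow[of M A X] seq_events_Pow[of M B Y] by (intro sets_measure_of) auto
  have space_H: "space H = space M" by (simp add: H_def space_measure_of_conv)
  have "X i \<in> measurable H A" for i
    using seq_events_component[of X M A, OF X] measurable_space[OF X]
    unfolding measurable_def space_H sets_H by auto
  moreover have "Y i \<in> measurable H B" for i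
    using seq_events_component[of Y M B, OF Y] measurable_space[OF Y]
    unfolding measurable_def space_H sets_H by auto
  ultimately have *: "(\<lambda>\<omega>. F (X i \<omega>, Y i \<omega>)) \<in> measurable H D" for i
    by (intro measurable_compose[OF _ F] measurable_Pair)
  then have WH: "?W \<in> measurable H ?P"
    by (intro measurable_PiM_single') (auto dest: measurable_space)
  show "indep_var ?P ?W (PiM UNIV (\<lambda>_. C)) (\<lambda>\<omega> i. Z i \<omega>)"
    unfolding indep_var_eq
  proof (intro conjI)
    show "random_variable (PiM UNIV (\<lambda>_. C)) (\<lambda>\<omega> i. Z i \<omega>)"
      using Z by (intro measurable_PiM_single') (auto simp: space_PiM PiE_def dest: measurable_space)
    show "random_variable ?P ?W"
    proof -
      have "(\<lambda>\<omega>. F (X i \<omega>, Y i \<omega>)) \<in> measurable M D" for i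
        using X Y by (intro measurable_compose[OF _ F] measurable_Pair)
      then show ?thesis by (intro measurable_PiM_single') (auto dest: measurable_space)
    qed
    have "indep_sets (\<lambda>b. sigma_sets (space M) (\<Union>i\<in>(case b of True \<Rightarrow> {0, 1} | False \<Rightarrow> {2::nat}). ?G i)) UNIV"
    proof (rule indep_sets_collect_sigma)
      show "indep_sets ?G (\<Union>b\<in>UNIV. case b of True \<Rightarrow> {0, 1} | False \<Rightarrow> {2::nat})"
        by (rule indep_sets_mono_index[OF _ G]) (auto split: bool.splits)
      show "Int_stable (?G i)" if "i \<in> (case b of True \<Rightarrow> {0, 1} | False \<Rightarrow> {2::nat})" for b i
        using that by (auto split: bool.splits intro: Int_stable_seq_events)
      show "disjoint_family_on (\<lambda>b. case b of True \<Rightarrow> {0, 1} | False \<Rightarrow> {2::nat}) UNIV"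
        by (auto simp: disjoint_family_on_def split: bool.splits)
    qed
    then show "indep_set (sigma_sets (space M) {?W -` S \<inter> space M |S. S \<in> sets ?P})
        (sigma_sets (space M) {(\<lambda>\<omega> i. Z i \<omega>) -` S \<inter> space M |S. S \<in> sets (PiM UNIV (\<lambda>_. C))})"
      unfolding indep_set_def
    proof (rule indep_sets_mono_sets)
      fix b :: bool
      have "{?W -` S \<inter> space M |S. S \<in> sets ?P} \<subseteq> sets H"
        using measurable_sets[OF WH] space_H by auto
      then have "sigma_sets (space M) {?W -` S \<inter> space M |S. S \<in> sets ?P} \<subseteq> sets H"
        using sets.sigma_sets_subset[of "{?W -` S \<inter> space M |S. S \<in> sets ?P}" H] by (simp only: space_H)
      moreover have "sigma_sets (space M) {(\<lambda>\<omega> i. Z i \<omega>) -` S \<inter> space M |S. S \<in> sets (PiM UNIV (\<lambda>_. C))}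
          \<subseteq> sigma_sets (space M) (seq_events M C Z)"
        using seq_events_sequence[of Z M C, OF Z] by (intro sigma_sets_mono') auto
      ultimately show "case_bool (sigma_sets (space M) {?W -` S \<inter> space M |S. S \<in> sets ?P})
          (sigma_sets (space M) {(\<lambda>\<omega> i. Z i \<omega>) -` S \<inter> space M |S. S \<in> sets (PiM UNIV (\<lambda>_. C))}) b
        \<subseteq> sigma_sets (space M) (\<Union>i\<in>(case b of True \<Rightarrow> {0, 1} | False \<Rightarrow> {2::nat}). ?G i)"
        unfolding sets_H by (auto split: bool.splits)
    qed
  qed
qed

section \<open>The stable normalising constant\<close>

lemma powr_le_powr_add:
  fixes q :: real
  assumes "0 \<le> q" "s \<le> a" "a \<le> S"
  shows "q powr a \<le> q powr s + q powr S"
proof (cases "q = 0")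
  case False
  show ?thesis
  proof (cases "1 \<le> q")
    case True
    then have "q powr a \<le> q powr S" using assms by (intro powr_mono) auto
    then show ?thesis using powr_ge_zero[of q s] by linarith
  next
    case c: False
    then have "q powr a \<le> q powr s" using assms False by (intro powr_mono') auto
    then show ?thesis using powr_ge_zero[of q S] by linarith
  qed
qed simp

lemma abs_ln_le_powr:
  fixes q :: real
  assumes q: "0 < q" and \<delta>: "0 < \<delta>"
  shows "\<bar>ln q\<bar> \<le> (q powr \<delta> + q powr (-\<delta>)) / \<delta>"
proof -
  have *: "\<epsilon> * ln q \<le> q powr \<epsilon>" for \<epsilon>
  proof -
    have "ln (q powr \<epsilon>) \<le> q powr \<epsilon> - 1" using q by (intro ln_le_minus_one) auto
    then show ?thesis using q by (simp add: ln_powr)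
  qed
  have "\<delta> * \<bar>ln q\<bar> \<le> q powr \<delta> + q powr (-\<delta>)"
  proof (cases "0 \<le> ln q")
    case True
    then show ?thesis
      using *[of \<delta>] powr_ge_zero[of q "-\<delta>"] unfolding abs_of_nonneg[OF True] by linarith
  next
    case False
    then have "\<delta> * \<bar>ln q\<bar> = (-\<delta>) * ln q" by simp
    then show ?thesis using *[of "-\<delta>"] powr_ge_zero[of q \<delta>] by linarith
  qed
  then show ?thesis using \<delta> by (simp add: field_simps)
qed

text \<open>
  In terms of \<open>A = p * ln x\<close> and \<open>B = r * ln x\<close> this is \<open>\<bar>exp A - exp B\<bar> \<le> \<bar>A - B\<bar> * max (exp A) (exp B)\<close>,
  with the maximum estimated by the sum.
\<close>

lemma abs_powr_diff_le:
  fixes x :: real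
  assumes x: "0 < x"
  shows "\<bar>x powr p - x powr r\<bar> \<le> \<bar>p - r\<bar> * \<bar>ln x\<bar> * (x powr p + x powr r)"
proof -
  have *: "exp A - exp B \<le> (A - B) * exp A" if "B \<le> A" for A B :: real
  proof -
    have "1 - (A - B) \<le> exp (B - A)" using exp_ge_add_one_self[of "B - A"] by linarith
    then have "exp A * (1 - (A - B)) \<le> exp A * exp (B - A)" by (intro mult_left_mono) auto
    then show ?thesis by (simp add: mult_exp_exp algebra_simps)
  qed
  have "\<bar>exp A - exp B\<bar> \<le> \<bar>A - B\<bar> * (exp A + exp B)" for A B :: real
  proof (cases "B \<le> A")
    case True
    then have "\<bar>exp A - exp B\<bar> = exp A - exp B" by simp
    also have "\<dots> \<le> (A - B) * exp A" by (rule *[OF True])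
    also have "\<dots> \<le> (A - B) * (exp A + exp B)" using True by (intro mult_left_mono) auto
    finally show ?thesis using True by simp
  next
    case False
    then have "\<bar>exp A - exp B\<bar> = exp B - exp A" by simp
    also have "\<dots> \<le> (B - A) * exp B" using False by (intro *) auto
    also have "\<dots> \<le> (B - A) * (exp A + exp B)" using False by (intro mult_left_mono) auto
    finally show ?thesis using False by simp
  qed
  from this[of "p * ln x" "r * ln x"] show ?thesis
    using x by (simp add: powr_def left_diff_distrib[symmetric] abs_mult)
qed

lemma powr_nn_integral_near_0:
  assumes "-1 < e"
  shows "(\<integral>\<^sup>+x. indicator {0<..1} x * ennreal (x powr e) \<partial>lborel) = ennreal (1 / (e + 1))"
proof -
  have "((\<lambda>x. x powr e) has_integral (1 powr (e+1) / (e+1))) {0..1::real}"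
    using assms by (intro has_integral_powr_from_0) auto
  then have "((\<lambda>x::real. indicator {0..1} x * x powr e) has_integral (1 / (e+1))) UNIV"
    by (subst (asm) has_integral_restrict_UNIV[symmetric]) (simp add: indicator_def of_bool_def if_distrib if_distribR cong: if_cong)
  then have "(\<integral>\<^sup>+x. ennreal (indicator {0..1} x * x powr e) \<partial>lborel) = ennreal (1 / (e + 1))"
    by (intro nn_integral_has_integral_lborel) (auto simp: indicator_def)
  moreover have "(\<integral>\<^sup>+x. ennreal (indicator {0..1} x * x powr e) \<partial>lborel) =
      (\<integral>\<^sup>+x. indicator {0<..1} x * ennreal (x powr e) \<partial>lborel)"
    by (intro nn_integral_cong) (auto simp: indicator_def)
  ultimately show ?thesis by simp
qed

lemma powr_nn_integral_at_top:
  assumes "e < -1"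
  shows "(\<integral>\<^sup>+x. indicator {1..} x * ennreal (x powr e) \<partial>lborel) = ennreal (- 1 / (e + 1))"
proof -
  have "((\<lambda>x. x powr e) has_integral (-(1 powr (e+1)) / (e+1))) {1::real..}"
    using assms by (intro has_integral_powr_to_inf) auto
  then have "((\<lambda>x::real. indicator {1..} x * x powr e) has_integral (-1 / (e+1))) UNIV"
    by (subst (asm) has_integral_restrict_UNIV[symmetric]) (simp add: indicator_def of_bool_def if_distrib if_distribR cong: if_cong)
  then have "(\<integral>\<^sup>+x. ennreal (indicator {1..} x * x powr e) \<partial>lborel) = ennreal (-1 / (e + 1))"
    by (intro nn_integral_has_integral_lborel) (auto simp: indicator_def)
  moreover have "(\<integral>\<^sup>+x. ennreal (indicator {1..} x * x powr e) \<partial>lborel) =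
      (\<integral>\<^sup>+x. indicator {1..} x * ennreal (x powr e) \<partial>lborel)"
    by (intro nn_integral_cong) (auto simp: indicator_def)
  ultimately show ?thesis by simp
qed

text \<open>
  The integrand that integration by parts produces from \<open>x powr (-a) * sin x\<close>. It decays like
  \<open>x powr (-a - 1)\<close> at infinity and is of order \<open>x powr (1 - a)\<close> at \<open>0\<close>, so for \<open>0 < a < 2\<close> it is
  absolutely integrable.
\<close>

definition stable_kernel :: "real \<Rightarrow> real \<Rightarrow> real" where
  "stable_kernel a x = indicator {0<..} x * (x powr (-a - 1) * (1 - cos x))"

definition stable_integral :: "real \<Rightarrow> real" where
  "stable_integral a = (\<integral>x. stable_kernel a x \<partial>lborel)"

lemma measurable_stable_kernel[measurable]: "stable_kernel a \<in> borel_measurable borel"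
  unfolding stable_kernel_def by measurable

lemma stable_kernel_nonneg: "0 \<le> stable_kernel a x"
  by (auto simp: stable_kernel_def indicator_def)

lemma one_minus_cos_le: "1 - cos x \<le> (x::real)\<^sup>2"
proof -
  have "\<bar>sin (x/2)\<bar> \<le> \<bar>x/2\<bar>" by (rule abs_sin_x_le_abs_x)
  then have "(sin (x/2))\<^sup>2 \<le> (x/2)\<^sup>2" by (simp only: abs_le_square_iff)
  moreover have "cos x = 1 - 2 * (sin (x/2))\<^sup>2" using cos_double_sin[of "x/2"] by simp
  moreover have "(x/2)\<^sup>2 * 2 \<le> x\<^sup>2" by (simp add: power_divide)
  ultimately show ?thesis by linarith
qed

lemma stable_kernel_integrable:
  assumes "0 < a" "a < 2"
  shows "integrable lborel (stable_kernel a)"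
proof (rule integrableI_bounded)
  have le: "stable_kernel a x \<le> indicator {0<..1} x * x powr (1 - a) + 2 * (indicator {1..} x * x powr (-a - 1))" for x
  proof (cases "0 < x")
    case True
    show ?thesis
    proof (cases "x \<le> 1")
      case t: True
      have "x powr (-a - 1) * (1 - cos x) \<le> x powr (-a - 1) * x\<^sup>2"
        by (intro mult_left_mono one_minus_cos_le) auto
      also have "\<dots> = x powr (-a - 1) * x powr 2" using True by (simp add: powr_numeral)
      also have "\<dots> = x powr (1 - a)" by (simp add: powr_add[symmetric])
      finally show ?thesis using True t by (auto simp: stable_kernel_def indicator_def)
    next
      case f: False
      have "1 - cos x \<le> 2" using cos_ge_minus_one[of x] by linarith
      then have "x powr (-a - 1) * (1 - cos x) \<le> x powr (-a - 1) * 2"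
        by (intro mult_left_mono) auto
      then show ?thesis using f by (auto simp: stable_kernel_def indicator_def)
    qed
  qed (auto simp: stable_kernel_def)
  have "(\<integral>\<^sup>+x. ennreal (norm (stable_kernel a x)) \<partial>lborel) \<le>
     (\<integral>\<^sup>+x. indicator {0<..1} x * ennreal (x powr (1 - a)) + 2 * (indicator {1..} x * ennreal (x powr (-a - 1))) \<partial>lborel)"
  proof (rule nn_integral_mono)
    fix x
    have "ennreal (norm (stable_kernel a x)) \<le>
        ennreal (indicator {0<..1} x * x powr (1 - a) + 2 * (indicator {1..} x * x powr (-a - 1)))"
      using le[of x] stable_kernel_nonneg[of a x] by (intro ennreal_leI) auto
    also have "\<dots> = indicator {0<..1} x * ennreal (x powr (1 - a)) + 2 * (indicator {1..} x * ennreal (x powr (-a - 1)))"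
      by (auto simp: indicator_def ennreal_mult' ennreal_plus)
    finally show "ennreal (norm (stable_kernel a x)) \<le> \<dots>" .
  qed
  also have "\<dots> = ennreal (1 / (1 - a + 1)) + 2 * ennreal (- 1 / (- a - 1 + 1))"
    using assms powr_nn_integral_near_0[of "1-a"] powr_nn_integral_at_top[of "-a-1"]
    by (subst nn_integral_add, simp, simp, subst nn_integral_cmult, simp) simp
  also have "\<dots> < \<infinity>" by (simp add: ennreal_mult_less_top)
  finally show "(\<integral>\<^sup>+x. ennreal (norm (stable_kernel a x)) \<partial>lborel) < \<infinity>" .
qed simp

lemma stable_integral_pos:
  assumes "0 < a" "a < 2"
  shows "0 < stable_integral a"
proof -
  define c where "c = 2 powr (-a - 1) * (1 - cos (1::real))"
  have "cos 1 < cos (0::real)" using pi_ge_two by (intro cos_monotone_0_pi) auto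
  then have c: "0 < c" by (simp add: c_def)
  have "c * indicator {1..2} x \<le> stable_kernel a x" for x
  proof (cases "x \<in> {1..2}")
    case True
    have "2 powr (-a - 1) \<le> x powr (-a - 1)"
      using True assms by (intro powr_mono2') auto
    moreover have "cos x \<le> cos 1"
      using True pi_ge_two by (intro cos_monotone_0_pi_le) auto
    ultimately have "c \<le> x powr (-a - 1) * (1 - cos x)"
      unfolding c_def by (intro mult_mono) auto
    then show ?thesis using True by (simp add: stable_kernel_def)
  qed (use stable_kernel_nonneg in simp)
  then have "(\<integral>x. c * indicator {1..2::real} x \<partial>lborel) \<le> stable_integral a"
    unfolding stable_integral_def using stable_kernel_integrable[OF assms]
    by (intro integral_mono) auto
  then show ?thesis using c by simp
qed

text \<open>
  Changing the exponent costs a factor \<open>\<bar>ln x\<bar>\<close>, which is absorbed by moving the exponent a little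
  further in both directions.
\<close>

lemma stable_kernel_lipschitz:
  assumes \<delta>: "0 < \<delta>" and a: "\<bar>a - a0\<bar> \<le> \<delta>"
  shows "\<bar>stable_kernel a x - stable_kernel a0 x\<bar>
    \<le> \<bar>a - a0\<bar> * (4 / \<delta>) * (stable_kernel (a0 - 2 * \<delta>) x + stable_kernel (a0 + 2 * \<delta>) x)"
proof (cases "0 < x")
  case True
  let ?B = "x powr (2 * \<delta>) + x powr (- (2 * \<delta>))"
  have B: "x powr e \<le> ?B" if "\<bar>e\<bar> \<le> 2 * \<delta>" for e
    using powr_le_powr_add[of x "- (2 * \<delta>)" e "2 * \<delta>"] that True by (simp add: abs_le_iff)
  have "\<bar>ln x\<bar> * (x powr (a0 - a) + 1) \<le> (x powr \<delta> + x powr (-\<delta>)) / \<delta> * (x powr (a0 - a) + 1)"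
    using abs_ln_le_powr[OF True \<delta>] by (intro mult_right_mono) auto
  also have "\<dots> = (x powr (\<delta> + (a0 - a)) + x powr (-\<delta> + (a0 - a)) + x powr \<delta> + x powr (-\<delta>)) / \<delta>"
    unfolding powr_add by (simp add: algebra_simps)
  also have "\<dots> \<le> (4 * ?B) / \<delta>"
  proof (intro divide_right_mono)
    have sum4: "p + q + r + t \<le> 4 * b" if "p \<le> b" "q \<le> b" "r \<le> b" "t \<le> b" for p q r t b :: real
      using that by linarith
    show "x powr (\<delta> + (a0 - a)) + x powr (-\<delta> + (a0 - a)) + x powr \<delta> + x powr (-\<delta>) \<le> 4 * ?B"
      using a \<delta> by (intro sum4 B) (auto simp: abs_le_iff)
  qed (use \<delta> in simp)
  finally have ln: "\<bar>ln x\<bar> * (x powr (a0 - a) + 1) \<le> (4 / \<delta>) * ?B" by simp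
  have "\<bar>x powr (-a - 1) - x powr (-a0 - 1)\<bar> \<le> \<bar>a - a0\<bar> * \<bar>ln x\<bar> * (x powr (-a - 1) + x powr (-a0 - 1))"
    using abs_powr_diff_le[OF True, of "-a - 1" "-a0 - 1"] by (simp add: abs_minus_commute)
  also have "x powr (-a - 1) = x powr (-a0 - 1) * x powr (a0 - a)"
    by (simp add: powr_add[symmetric] minus_diff_commute)
  also have "\<bar>a - a0\<bar> * \<bar>ln x\<bar> * (x powr (-a0 - 1) * x powr (a0 - a) + x powr (-a0 - 1))
      = \<bar>a - a0\<bar> * x powr (-a0 - 1) * (\<bar>ln x\<bar> * (x powr (a0 - a) + 1))"
    by (simp add: algebra_simps)
  also have "\<dots> \<le> \<bar>a - a0\<bar> * x powr (-a0 - 1) * ((4 / \<delta>) * ?B)"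
    using ln by (intro mult_left_mono) auto
  also have "\<dots> = \<bar>a - a0\<bar> * (4 / \<delta>) * (x powr (-a0 - 1) * ?B)" by simp
  also have "x powr (-a0 - 1) * ?B = x powr (-(a0 - 2 * \<delta>) - 1) + x powr (-(a0 + 2 * \<delta>) - 1)"
    by (simp add: distrib_left powr_add[symmetric] algebra_simps)
  finally have "\<bar>x powr (-a - 1) - x powr (-a0 - 1)\<bar> * (1 - cos x)
     \<le> \<bar>a - a0\<bar> * (4 / \<delta>) * (x powr (-(a0 - 2 * \<delta>) - 1) + x powr (-(a0 + 2 * \<delta>) - 1)) * (1 - cos x)"
    unfolding \<open>x powr (-a - 1) = x powr (-a0 - 1) * x powr (a0 - a)\<close>[symmetric]
    by (intro mult_right_mono) auto
  moreover have "stable_kernel e x = x powr (-e - 1) * (1 - cos x)" for e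
    using True by (simp add: stable_kernel_def)
  moreover have "\<bar>p * (1 - cos x) - q * (1 - cos x)\<bar> = \<bar>p - q\<bar> * (1 - cos x)" for p q
    by (simp only: left_diff_distrib[symmetric] abs_mult) simp
  ultimately show ?thesis by (simp only: distrib_right[symmetric] mult.assoc)
qed (simp add: stable_kernel_def)

lemma stable_integral_lipschitz:
  assumes "0 < a0" "a0 < 2"
  shows "\<exists>L \<delta>. 0 < \<delta> \<and> (\<forall>a. \<bar>a - a0\<bar> < \<delta> \<longrightarrow> \<bar>stable_integral a - stable_integral a0\<bar> \<le> L * \<bar>a - a0\<bar>)"
proof -
  \<comment> \<open>The exponents \<open>a0 - 2 * \<delta>\<close> and \<open>a0 + 2 * \<delta>\<close> stay inside \<open>(0, 2)\<close>.\<close>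
  define \<delta> where "\<delta> = min a0 (2 - a0) / 3"
  have \<delta>: "0 < \<delta>" "0 < a0 - 2 * \<delta>" "a0 + 2 * \<delta> < 2"
    using assms by (auto simp: \<delta>_def min_def field_simps)
  let ?L = "(4 / \<delta>) * (stable_integral (a0 - 2 * \<delta>) + stable_integral (a0 + 2 * \<delta>))"
  have "\<bar>stable_integral a - stable_integral a0\<bar> \<le> ?L * \<bar>a - a0\<bar>" if a: "\<bar>a - a0\<bar> < \<delta>" for a
  proof -
    have [simp]: "integrable lborel (stable_kernel a)" "integrable lborel (stable_kernel a0)"
      "integrable lborel (stable_kernel (a0 - 2 * \<delta>))" "integrable lborel (stable_kernel (a0 + 2 * \<delta>))"
      using a \<delta> assms by (auto intro!: stable_kernel_integrable)
    have "\<bar>stable_integral a - stable_integral a0\<bar> = \<bar>\<integral>x. stable_kernel a x - stable_kernel a0 x \<partial>lborel\<bar>"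
      by (simp add: stable_integral_def)
    also have "\<dots> \<le> (\<integral>x. \<bar>stable_kernel a x - stable_kernel a0 x\<bar> \<partial>lborel)"
      by (rule integral_abs_bound)
    also have "\<dots> \<le> (\<integral>x. \<bar>a - a0\<bar> * (4 / \<delta>) * (stable_kernel (a0 - 2 * \<delta>) x + stable_kernel (a0 + 2 * \<delta>) x) \<partial>lborel)"
      using a \<delta> by (intro integral_mono stable_kernel_lipschitz) auto
    also have "\<dots> = ?L * \<bar>a - a0\<bar>"
      by (simp add: stable_integral_def)
    finally show ?thesis .
  qed
  then show ?thesis using \<delta>(1) by blast
qed

text \<open>
  Taking \<open>1 - cos x\<close> as the primitive of \<open>sin x\<close> makes the boundary term at \<open>0\<close> vanish.
\<close>

lemma sine_integral_by_parts:
  assumes a: "0 < a" "a < 2" and T: "0 < T"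
  shows "(LBINT x=0..T. x powr (-a) * sin x) =
    T powr (-a) * (1 - cos T) + a * (\<integral>x. indicator {..T} x *\<^sub>R stable_kernel a x \<partial>lborel)"
proof -
  let ?k = "\<lambda>x. x powr (-a - 1) * (1 - cos x)"
  let ?s = "\<lambda>x. x powr (-a) * sin x"
  let ?F = "\<lambda>x. x powr (-a) * (1 - cos x)"
  have ein: "einterval 0 (ereal T) = {0<..<T}"
    by (auto simp: einterval_def zero_ereal_def)
  have k: "set_integrable lborel {0<..<T} ?k"
  proof -
    have "integrable lborel (\<lambda>x. indicator {0<..<T} x *\<^sub>R stable_kernel a x)"
      using stable_kernel_integrable[OF a] by (intro integrable_mult_indicator) auto
    then show ?thesis unfolding set_integrable_def
      by (rule Bochner_Integration.integrable_cong[THEN iffD1, rotated -1])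
         (auto simp: stable_kernel_def indicator_def)
  qed
  have s: "set_integrable lborel {0<..<T} ?s"
  proof (rule set_integrable_bound)
    show "set_integrable lborel {0<..<T} (\<lambda>x. x powr (1 - a))"
      unfolding set_integrable_def
    proof (rule integrableI_bounded)
      have "(\<integral>\<^sup>+x. ennreal (norm (indicator {0<..<T} x *\<^sub>R x powr (1 - a))) \<partial>lborel)
         \<le> (\<integral>\<^sup>+x. indicator {0<..1} x * ennreal (x powr (1 - a)) + ennreal (max 1 T) * indicator {0<..<T} x \<partial>lborel)"
      proof (rule nn_integral_mono)
        fix x
        have "x powr (1 - a) \<le> max 1 T" if "1 < x" "x < T"
        proof -
          have "x powr (1 - a) \<le> x powr 1" using that a by (intro powr_mono) auto
          then show ?thesis using that by simp
        qed
        then show "ennreal (norm (indicator {0<..<T} x *\<^sub>R x powr (1 - a)))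
          \<le> indicator {0<..1} x * ennreal (x powr (1 - a)) + ennreal (max 1 T) * indicator {0<..<T} x"
          by (auto simp: indicator_def ennreal_leI)
      qed
      also have "\<dots> = ennreal (1 / (1 - a + 1)) + ennreal (max 1 T) * ennreal T"
        using a T powr_nn_integral_near_0[of "1 - a"]
        by (subst nn_integral_add, simp, simp, subst nn_integral_cmult_indicator) auto
      also have "\<dots> < \<infinity>" by (simp add: ennreal_mult_less_top)
      finally show "(\<integral>\<^sup>+x. ennreal (norm (indicator {0<..<T} x *\<^sub>R x powr (1 - a))) \<partial>lborel) < \<infinity>" .
    qed simp
    show "AE x in lborel. x \<in> {0<..<T} \<longrightarrow> norm (?s x) \<le> norm (x powr (1 - a))"
    proof (intro AE_I2 impI)
      fix x assume x: "x \<in> {0<..<T}"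
      have "\<bar>sin x\<bar> \<le> \<bar>x\<bar>" by (rule abs_sin_x_le_abs_x)
      then have "x powr (-a) * \<bar>sin x\<bar> \<le> x powr (-a) * x powr 1"
        using x by (intro mult_left_mono) auto
      also have "\<dots> = x powr (1 - a)" by (simp only: powr_add[symmetric]) simp
      finally show "norm (?s x) \<le> norm (x powr (1 - a))" by (simp add: abs_mult)
    qed
  qed (simp add: set_borel_measurable_def)
  have ftc: "(LBINT x=0..T. ?s x - a * ?k x) = ?F T - 0"
  proof (rule interval_integral_FTC_integrable)
    fix x assume "0 < ereal x" "ereal x < ereal T"
    then have x: "0 < x" by simp
    have "(?F has_real_derivative ?s x - a * ?k x) (at x)"
      using x by (auto intro!: derivative_eq_intros simp: field_simps powr_diff)
    then show "(?F has_vector_derivative ?s x - a * ?k x) (at x)"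
      by (simp add: has_real_derivative_iff_has_vector_derivative)
    show "isCont (\<lambda>x. ?s x - a * ?k x) x"
      using x by (intro continuous_intros) auto
  next
    show "set_integrable lborel (einterval 0 (ereal T)) (\<lambda>x. ?s x - a * ?k x)"
      unfolding ein using k s by (intro set_integral_diff set_integrable_mult_right) auto
    have "((\<lambda>x::real. x powr (2 - a)) \<longlongrightarrow> 0 powr (2 - a)) (at_right 0)"
      using a by (intro tendsto_powr' tendsto_intros) (auto simp: eventually_at_right_less eventually_at_topological)
    then have lim: "((\<lambda>x::real. x powr (2 - a)) \<longlongrightarrow> 0) (at_right 0)"
      by simp
    have "(?F \<longlongrightarrow> 0) (at_right 0)"
    proof (rule tendsto_sandwich[OF _ _ tendsto_const lim])
      show "\<forall>\<^sub>F x in at_right 0. 0 \<le> ?F x" by simp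
      show "\<forall>\<^sub>F x in at_right 0. ?F x \<le> x powr (2 - a)"
        using eventually_at_right_less[of 0]
      proof eventually_elim
        case (elim x)
        have "?F x \<le> x powr (-a) * x\<^sup>2" by (intro mult_left_mono one_minus_cos_le) auto
        also have "\<dots> = x powr (-a) * x powr 2" using elim by (simp add: powr_numeral)
        also have "\<dots> = x powr (2 - a)" by (simp only: powr_add[symmetric]) simp
        finally show ?case .
      qed
    qed
    then show "((?F \<circ> real_of_ereal) \<longlongrightarrow> 0) (at_right 0)"
      by (simp add: zero_ereal_def ereal_tendsto_simps)
    have "isCont ?F T" using T by (intro continuous_intros) auto
    then have "(?F \<longlongrightarrow> ?F T) (at_left T)"
      by (auto simp: isCont_def intro: filterlim_at_withinI tendsto_within_subset)
    then show "((?F \<circ> real_of_ereal) \<longlongrightarrow> ?F T) (at_left (ereal T))"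
      by (simp add: ereal_tendsto_simps)
  qed (use T in auto)
  have "(LBINT x=0..T. ?s x) = (LBINT x=0..T. ?s x - a * ?k x) + a * (LBINT x=0..T. ?k x)"
    using k s T
    by (simp add: interval_lebesgue_integral_def ein set_integral_diff set_integrable_mult_right)
  also have "(LBINT x=0..T. ?k x) = (\<integral>x. indicator {..T} x *\<^sub>R stable_kernel a x \<partial>lborel)"
  proof -
    have "(LBINT x=0..T. ?k x) = (\<integral>x. indicator {0<..<T} x *\<^sub>R ?k x \<partial>lborel)"
      using T by (simp add: interval_lebesgue_integral_def ein set_lebesgue_integral_def)
    also have "\<dots> = (\<integral>x. indicator {..T} x *\<^sub>R stable_kernel a x \<partial>lborel)"
      using AE_lborel_singleton[of T]
      by (intro integral_cong_AE) (auto elim!: eventually_mono simp: stable_kernel_def indicator_def)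
    finally show ?thesis .
  qed
  finally show ?thesis using ftc by simp
qed

lemma C_stable_eq:
  assumes a: "0 < a" "a < 2"
  shows "C_stable a = inverse (a * stable_integral a)"
proof -
  have F0: "((\<lambda>T::real. T powr (-a) * (1 - cos T)) \<longlongrightarrow> 0) at_top"
  proof (rule tendsto_sandwich[OF _ _ tendsto_const])
    show "\<forall>\<^sub>F T::real in at_top. 0 \<le> T powr (-a) * (1 - cos T)" by simp
    show "\<forall>\<^sub>F T::real in at_top. T powr (-a) * (1 - cos T) \<le> T powr (-a) * 2"
    proof (intro always_eventually allI mult_left_mono)
      fix T :: real show "1 - cos T \<le> 2" using cos_ge_minus_one[of T] by linarith
    qed simp
    show "((\<lambda>T::real. T powr (-a) * 2) \<longlongrightarrow> 0) at_top"
      using tendsto_mult_right[OF tendsto_neg_powr[OF _ filterlim_ident, of "-a"], of 2] a by simp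
  qed
  have "((\<lambda>T::real. T powr (-a) * (1 - cos T) + a * (\<integral>x. indicator {..T} x *\<^sub>R stable_kernel a x \<partial>lborel))
      \<longlongrightarrow> 0 + a * stable_integral a) at_top"
    unfolding stable_integral_def using stable_kernel_integrable[OF a]
    by (intro tendsto_intros F0 tendsto_integral_at_top) auto
  moreover have "\<forall>\<^sub>F T::real in at_top. T powr (-a) * (1 - cos T) + a * (\<integral>x. indicator {..T} x *\<^sub>R stable_kernel a x \<partial>lborel)
      = (LBINT x=0..T. x powr (-a) * sin x)"
    using eventually_gt_at_top[of "0::real"]
    by eventually_elim (simp add: sine_integral_by_parts[OF a])
  ultimately have "((\<lambda>T::real. LBINT x=0..T. x powr (-a) * sin x) \<longlongrightarrow> a * stable_integral a) at_top"
    by (simp add: filterlim_cong)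
  then show ?thesis unfolding C_stable_def by (subst tendsto_Lim) auto
qed

text \<open>
  A Lipschitz bound with one end point fixed at \<open>u\<close>. This weak notion is all that the factor in front
  of the series has to satisfy, and it is closed under products and compositions.
\<close>

definition lipschitz_at :: "(real \<Rightarrow> real) \<Rightarrow> real \<Rightarrow> bool" where
  "lipschitz_at g u \<longleftrightarrow> (\<exists>L. \<forall>\<^sub>F v in nhds u. \<bar>g v - g u\<bar> \<le> L * \<bar>v - u\<bar>)"

lemma lipschitz_at_nonneg_constant:
  assumes "lipschitz_at g u"
  obtains L where "0 \<le> L" "\<forall>\<^sub>F v in nhds u. \<bar>g v - g u\<bar> \<le> L * \<bar>v - u\<bar>"
proof -
  obtain L where L: "\<forall>\<^sub>F v in nhds u. \<bar>g v - g u\<bar> \<le> L * \<bar>v - u\<bar>"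
    using assms by (auto simp: lipschitz_at_def)
  have "\<forall>\<^sub>F v in nhds u. \<bar>g v - g u\<bar> \<le> \<bar>L\<bar> * \<bar>v - u\<bar>"
    using L
  proof eventually_elim
    case (elim v)
    have "L * \<bar>v - u\<bar> \<le> \<bar>L\<bar> * \<bar>v - u\<bar>" by (intro mult_right_mono) auto
    with elim show ?case by linarith
  qed
  then show ?thesis by (intro that[of "\<bar>L\<bar>"]) auto
qed

lemma lipschitz_at_tendsto:
  assumes "lipschitz_at g u"
  shows "(g \<longlongrightarrow> g u) (nhds u)"
proof -
  obtain L where L: "0 \<le> L" "\<forall>\<^sub>F v in nhds u. \<bar>g v - g u\<bar> \<le> L * \<bar>v - u\<bar>"
    using lipschitz_at_nonneg_constant[OF assms] .
  have "((\<lambda>v. L * \<bar>v - u\<bar>) \<longlongrightarrow> L * \<bar>u - u\<bar>) (nhds u)"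
    by (intro tendsto_intros filterlim_ident)
  then have "((\<lambda>v. L * \<bar>v - u\<bar>) \<longlongrightarrow> 0) (nhds u)" by simp
  moreover have "\<forall>\<^sub>F v in nhds u. norm (g v - g u) \<le> L * \<bar>v - u\<bar>"
    using L(2) by simp
  ultimately have "((\<lambda>v. g v - g u) \<longlongrightarrow> 0) (nhds u)"
    by (rule Lim_null_comparison[rotated])
  then show ?thesis by (rule LIM_zero_cancel)
qed

lemma lipschitz_at_differentiable:
  assumes "(g has_real_derivative D) (at u)"
  shows "lipschitz_at g u"
proof -
  have "((\<lambda>v. (g v - g u) / (v - u)) \<longlongrightarrow> D) (at u)"
    using assms by (simp add: has_field_derivative_iff)
  then have "((\<lambda>v. \<bar>(g v - g u) / (v - u)\<bar>) \<longlongrightarrow> \<bar>D\<bar>) (at u)"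
    by (rule tendsto_rabs)
  then have "\<forall>\<^sub>F v in at u. \<bar>(g v - g u) / (v - u)\<bar> < \<bar>D\<bar> + 1"
    by (rule order_tendstoD) simp
  then have "\<forall>\<^sub>F v in nhds u. v \<noteq> u \<longrightarrow> \<bar>(g v - g u) / (v - u)\<bar> < \<bar>D\<bar> + 1"
    by (simp add: eventually_at_filter)
  then have "\<forall>\<^sub>F v in nhds u. \<bar>g v - g u\<bar> \<le> (\<bar>D\<bar> + 1) * \<bar>v - u\<bar>"
  proof eventually_elim
    case (elim v)
    show ?case
    proof (cases "v = u")
      case False
      then have "\<bar>g v - g u\<bar> / \<bar>v - u\<bar> < \<bar>D\<bar> + 1" using elim by (simp add: abs_divide)
      then show ?thesis using False by (simp add: divide_less_eq)
    qed simp
  qed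
  then show ?thesis by (auto simp: lipschitz_at_def)
qed

lemma lipschitz_at_compose:
  assumes g: "lipschitz_at g u" and \<psi>: "lipschitz_at \<psi> (g u)"
  shows "lipschitz_at (\<lambda>v. \<psi> (g v)) u"
proof -
  obtain L where L: "0 \<le> L" "\<forall>\<^sub>F v in nhds u. \<bar>g v - g u\<bar> \<le> L * \<bar>v - u\<bar>"
    using lipschitz_at_nonneg_constant[OF g] .
  obtain K where K: "0 \<le> K" "\<forall>\<^sub>F z in nhds (g u). \<bar>\<psi> z - \<psi> (g u)\<bar> \<le> K * \<bar>z - g u\<bar>"
    using lipschitz_at_nonneg_constant[OF \<psi>] .
  have "\<forall>\<^sub>F v in nhds u. \<bar>\<psi> (g v) - \<psi> (g u)\<bar> \<le> K * \<bar>g v - g u\<bar>"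
    using eventually_compose_filterlim[OF K(2) lipschitz_at_tendsto[OF g]] .
  with L(2) have "\<forall>\<^sub>F v in nhds u. \<bar>\<psi> (g v) - \<psi> (g u)\<bar> \<le> (K * L) * \<bar>v - u\<bar>"
  proof eventually_elim
    case (elim v)
    have "K * \<bar>g v - g u\<bar> \<le> K * (L * \<bar>v - u\<bar>)" using elim(1) K(1) by (rule mult_left_mono)
    with elim(2) show ?case by (simp add: mult.assoc)
  qed
  then show ?thesis by (auto simp: lipschitz_at_def)
qed

lemma lipschitz_at_mult:
  assumes g: "lipschitz_at g u" and k: "lipschitz_at k u"
  shows "lipschitz_at (\<lambda>v. g v * k v) u"
proof -
  obtain L where L: "0 \<le> L" "\<forall>\<^sub>F v in nhds u. \<bar>g v - g u\<bar> \<le> L * \<bar>v - u\<bar>"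
    using lipschitz_at_nonneg_constant[OF g] .
  obtain K where K: "0 \<le> K" "\<forall>\<^sub>F v in nhds u. \<bar>k v - k u\<bar> \<le> K * \<bar>v - u\<bar>"
    using lipschitz_at_nonneg_constant[OF k] .
  have "\<forall>\<^sub>F v in nhds u. \<bar>k v\<bar> < \<bar>k u\<bar> + 1"
    using tendsto_rabs[OF lipschitz_at_tendsto[OF k]] by (rule order_tendstoD) simp
  with L(2) K(2) have "\<forall>\<^sub>F v in nhds u. \<bar>g v * k v - g u * k u\<bar> \<le> (L * (\<bar>k u\<bar> + 1) + \<bar>g u\<bar> * K) * \<bar>v - u\<bar>"
  proof eventually_elim
    case (elim v)
    have "g v * k v - g u * k u = (g v - g u) * k v + g u * (k v - k u)"
      by (simp add: algebra_simps)
    then have "\<bar>g v * k v - g u * k u\<bar> \<le> \<bar>g v - g u\<bar> * \<bar>k v\<bar> + \<bar>g u\<bar> * \<bar>k v - k u\<bar>"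
      using abs_triangle_ineq[of "(g v - g u) * k v" "g u * (k v - k u)"] by (simp only: abs_mult)
    also have "\<dots> \<le> (L * \<bar>v - u\<bar>) * (\<bar>k u\<bar> + 1) + \<bar>g u\<bar> * (K * \<bar>v - u\<bar>)"
      using elim L(1) by (intro add_mono mult_mono) auto
    finally show ?case by (simp add: algebra_simps)
  qed
  then show ?thesis by (auto simp: lipschitz_at_def)
qed

text \<open>
  \<open>C_stable a powr (1 / a)\<close> is the exponential of \<open>- ln (a * stable_integral a) / a\<close>, in which only
  \<open>stable_integral\<close> is not known to be differentiable.
\<close>

lemma lipschitz_at_stable_prefactor:
  fixes \<alpha> b :: "real \<Rightarrow> real" and c d m u :: real
  assumes cd: "0 < c" "d < 2" and \<alpha>: "\<And>v. \<alpha> v \<in> {c..d}"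
    and D: "(\<alpha> has_real_derivative D) (at u)" and B: "(b has_real_derivative B) (at u)"
    and m: "0 < m"
  shows "lipschitz_at (\<lambda>v. b v * m powr (1 / \<alpha> v) * C_stable (\<alpha> v) powr (1 / \<alpha> v)) u"
proof -
  have pos: "0 < \<alpha> v" "\<alpha> v < 2" for v using \<alpha>[of v] cd by auto
  have J: "0 < stable_integral (\<alpha> v)" for v using pos stable_integral_pos by auto
  have lip_\<alpha>: "lipschitz_at \<alpha> u" by (rule lipschitz_at_differentiable[OF D])
  have "lipschitz_at stable_integral (\<alpha> u)"
  proof -
    obtain L \<delta> where "0 < \<delta>" "\<forall>a. \<bar>a - \<alpha> u\<bar> < \<delta> \<longrightarrow> \<bar>stable_integral a - stable_integral (\<alpha> u)\<bar> \<le> L * \<bar>a - \<alpha> u\<bar>"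
      using stable_integral_lipschitz[OF pos[of u]] by blast
    then show ?thesis
      unfolding lipschitz_at_def eventually_nhds_metric by (auto simp: dist_real_def)
  qed
  then have "lipschitz_at (\<lambda>v. \<alpha> v * stable_integral (\<alpha> v)) u"
    by (intro lipschitz_at_mult lip_\<alpha> lipschitz_at_compose[OF lip_\<alpha>])
  moreover have "lipschitz_at ln (\<alpha> u * stable_integral (\<alpha> u))"
    using pos(1)[of u] J[of u] by (intro lipschitz_at_differentiable[OF DERIV_ln]) auto
  ultimately have ln: "lipschitz_at (\<lambda>v. ln (\<alpha> v * stable_integral (\<alpha> v))) u"
    by (rule lipschitz_at_compose)
  have inv: "((\<lambda>v. - (1 / \<alpha> v)) has_real_derivative D / (\<alpha> u)\<^sup>2) (at u)"
    using D pos(1)[of u] by (auto intro!: derivative_eq_intros simp: power2_eq_square)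
  have "lipschitz_at (\<lambda>v. exp (- (1 / \<alpha> v) * ln (\<alpha> v * stable_integral (\<alpha> v)))) u"
    by (rule lipschitz_at_compose[OF _ lipschitz_at_differentiable[OF DERIV_exp]])
       (rule lipschitz_at_mult[OF lipschitz_at_differentiable[OF inv] ln])
  moreover have "exp (- (1 / \<alpha> v) * ln (\<alpha> v * stable_integral (\<alpha> v))) = C_stable (\<alpha> v) powr (1 / \<alpha> v)" for v
  proof -
    have p: "0 < \<alpha> v * stable_integral (\<alpha> v)" using pos(1)[of v] J[of v] by simp
    then have "inverse (\<alpha> v * stable_integral (\<alpha> v)) \<noteq> 0" by (metis less_irrefl nonzero_imp_inverse_nonzero)
    then have "C_stable (\<alpha> v) powr (1 / \<alpha> v) = exp (1 / \<alpha> v * ln (inverse (\<alpha> v * stable_integral (\<alpha> v))))"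
      unfolding C_stable_eq[OF pos] by (simp only: powr_def if_False)
    also have "ln (inverse (\<alpha> v * stable_integral (\<alpha> v))) = - ln (\<alpha> v * stable_integral (\<alpha> v))"
      by (rule ln_inverse)
    finally show ?thesis by simp
  qed
  ultimately have C: "lipschitz_at (\<lambda>v. C_stable (\<alpha> v) powr (1 / \<alpha> v)) u" by simp
  have "((\<lambda>v. m powr (1 / \<alpha> v)) has_real_derivative (m powr (1 / \<alpha> u) * (- (D / (\<alpha> u)\<^sup>2) * ln m))) (at u)"
    unfolding powr_def using D pos(1)[of u] m
    by (auto intro!: derivative_eq_intros simp: power2_eq_square)
  then show ?thesis
    by (intro lipschitz_at_mult C lipschitz_at_differentiable[OF B] lipschitz_at_differentiable)
qed

section \<open>Coefficients dominated by a power gauge\<close>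

text \<open>
  The two exponents dominate every power in between, so the gauge replaces all the powers
  \<open>1 / \<alpha> w\<close> that occur for \<open>w\<close> near \<open>u\<close>.
\<close>

definition power_gauge :: "real \<Rightarrow> real \<Rightarrow> real \<Rightarrow> real" where
  "power_gauge s S q = q powr s + q powr S"

lemma measurable_power_gauge[measurable]: "power_gauge s S \<in> borel_measurable borel"
  unfolding power_gauge_def by measurable

lemma power_gauge_nonneg: "0 \<le> power_gauge s S q"
  by (simp add: power_gauge_def)

lemma power_gauge_mono: "0 \<le> s \<Longrightarrow> 0 \<le> S \<Longrightarrow> 0 \<le> p \<Longrightarrow> p \<le> q \<Longrightarrow> power_gauge s S p \<le> power_gauge s S q"
  unfolding power_gauge_def by (intro add_mono powr_mono2) auto

text \<open>
  The truncated second moment of the coefficients \<open>C * power_gauge s S (1 / z) / l\<close>, with the points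
  distributed according to Lebesgue measure.
\<close>

definition gauge_integral :: "real \<Rightarrow> real \<Rightarrow> real \<Rightarrow> real \<Rightarrow> ennreal" where
  "gauge_integral s S C l =
     (\<integral>\<^sup>+z. indicator {0<..} z * min 1 (ennreal ((C * power_gauge s S (1 / z) / l)\<^sup>2)) \<partial>lborel)"

text \<open>
  Truncation takes care of \<open>z \<le> 1\<close>. For \<open>z \<ge> 1\<close> the smaller exponent dominates, and its square is
  integrable at infinity exactly when \<open>s > 1/2\<close>.
\<close>

lemma gauge_integrand_bound:
  assumes s: "s \<le> S" and z: "0 < z"
  shows "min 1 (ennreal ((C * power_gauge s S (1 / z))\<^sup>2))
    \<le> indicator {0<..1} z + ennreal (4 * C\<^sup>2) * (indicator {1..} z * ennreal (z powr (- 2 * s)))"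
proof (cases "z \<le> 1")
  case True
  have "min 1 (ennreal ((C * power_gauge s S (1 / z))\<^sup>2)) \<le> indicator {0<..1} z"
    using z True by simp
  then show ?thesis by (rule order_trans) simp
next
  case False
  then have z1: "1 \<le> z" by simp
  have "power_gauge s S (1 / z) = z powr (-s) + z powr (-S)"
    using z by (simp add: power_gauge_def powr_divide powr_minus_divide)
  also have "\<dots> \<le> 2 * z powr (-s)"
    using powr_mono[of "-S" "-s" z] s z1 by simp
  finally have "(power_gauge s S (1 / z))\<^sup>2 \<le> (2 * z powr (-s))\<^sup>2"
    using power_gauge_nonneg by (intro power_mono) auto
  also have "\<dots> = 4 * z powr (- 2 * s)"
    by (simp add: power_mult_distrib power2_eq_square powr_add[symmetric])
  finally have "(C * power_gauge s S (1 / z))\<^sup>2 \<le> 4 * C\<^sup>2 * z powr (- 2 * s)"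
    using mult_left_mono[of "(power_gauge s S (1 / z))\<^sup>2" "4 * z powr (- 2 * s)" "C\<^sup>2"]
    by (simp add: power_mult_distrib algebra_simps)
  then have "ennreal ((C * power_gauge s S (1 / z))\<^sup>2) \<le> ennreal (4 * C\<^sup>2) * ennreal (z powr (- 2 * s))"
    by (simp add: ennreal_mult'[symmetric] ennreal_leI)
  then show ?thesis using False z1
    by (simp add: min.coboundedI2)
qed

lemma gauge_majorant_finite:
  assumes s: "1 / 2 < s"
  shows "(\<integral>\<^sup>+z. indicator {0<..1} z + ennreal K * (indicator {1..} z * ennreal (z powr (- 2 * s))) \<partial>lborel) < \<infinity>"
proof -
  have "(\<integral>\<^sup>+z. indicator {0<..1} z + ennreal K * (indicator {1..} z * ennreal (z powr (- 2 * s))) \<partial>lborel)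
    = 1 + ennreal K * ennreal (- 1 / (- 2 * s + 1))"
    using s powr_nn_integral_at_top[of "- 2 * s"]
    by (subst nn_integral_add, simp, simp, subst nn_integral_cmult, simp) simp
  also have "\<dots> < \<infinity>" by (simp add: ennreal_mult_less_top)
  finally show ?thesis .
qed

lemma gauge_integral_finite:
  assumes "1 / 2 < s" "s \<le> S"
  shows "gauge_integral s S C l < \<infinity>"
proof -
  have "gauge_integral s S C l \<le>
    (\<integral>\<^sup>+z. indicator {0<..1} z + ennreal (4 * (C / l)\<^sup>2) * (indicator {1..} z * ennreal (z powr (- 2 * s))) \<partial>lborel)"
    unfolding gauge_integral_def
  proof (rule nn_integral_mono)
    fix z
    show "indicator {0<..} z * min 1 (ennreal ((C * power_gauge s S (1 / z) / l)\<^sup>2))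
      \<le> indicator {0<..1} z + ennreal (4 * (C / l)\<^sup>2) * (indicator {1..} z * ennreal (z powr (- 2 * s)))"
      using gauge_integrand_bound[OF assms(2), of z "C / l"] by (cases "0 < z") auto
  qed
  also have "\<dots> < \<infinity>" by (rule gauge_majorant_finite) fact
  finally show ?thesis .
qed

text \<open>
  The truncated integrand tends to \<open>0\<close> pointwise as \<open>l\<close> grows, and it is dominated by the integrable
  bound of \<open>gauge_integrand_bound\<close>.
\<close>

lemma gauge_integral_small:
  assumes s: "1 / 2 < s" "s \<le> S" and e: "0 < e"
  shows "\<exists>l>0. gauge_integral s S C l \<le> ennreal e"
proof -
  let ?u = "\<lambda>j::nat. \<lambda>z::real. indicator {0<..} z * min 1 (ennreal ((C * power_gauge s S (1 / z) / real (Suc j))\<^sup>2))"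
  let ?w = "\<lambda>z. indicator {0<..1} z + ennreal (4 * C\<^sup>2) * (indicator {1..} z * ennreal (z powr (- 2 * s)))"
  have "(\<lambda>j. \<integral>\<^sup>+z. ?u j z \<partial>lborel) \<longlonglongrightarrow> (\<integral>\<^sup>+(z::real). 0 \<partial>lborel)"
  proof (rule nn_integral_dominated_convergence)
    show "AE z in lborel. ?u j z \<le> ?w z" for j
    proof (intro AE_I2)
      fix z :: real
      show "?u j z \<le> ?w z"
      proof (cases "0 < z")
        case True
        have "((C * power_gauge s S (1 / z)) / real (Suc j))\<^sup>2 \<le> (C * power_gauge s S (1 / z))\<^sup>2"
        proof -
          have "1 \<le> (real (Suc j))\<^sup>2" by (rule one_le_power) simp
          then have "(C * power_gauge s S (1 / z))\<^sup>2 / (real (Suc j))\<^sup>2 \<le> (C * power_gauge s S (1 / z))\<^sup>2 / 1"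
            by (intro divide_left_mono) auto
          then show ?thesis by (simp only: power_divide div_by_1)
        qed
        then have "?u j z \<le> min 1 (ennreal ((C * power_gauge s S (1 / z))\<^sup>2))"
          using True by (auto intro!: min.mono ennreal_leI simp del: min.bounded_iff)
        also have "\<dots> \<le> ?w z" by (rule gauge_integrand_bound[OF s(2) True])
        finally show ?thesis .
      qed simp
    qed
    show "(\<integral>\<^sup>+z. ?w z \<partial>lborel) < \<infinity>" by (rule gauge_majorant_finite[OF s(1)])
    show "AE z in lborel. (\<lambda>j. ?u j z) \<longlonglongrightarrow> 0"
    proof (intro AE_I2)
      fix z :: real
      let ?g = "C * power_gauge s S (1 / z)"
      have "(\<lambda>j. ?g / real (Suc j)) \<longlonglongrightarrow> 0"
        by (rule tendsto_divide_0[OF tendsto_const filterlim_at_top_imp_at_infinity])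
           (rule filterlim_compose[OF filterlim_real_sequentially filterlim_Suc])
      then have "(\<lambda>j. ennreal ((?g / real (Suc j))\<^sup>2)) \<longlonglongrightarrow> ennreal (0\<^sup>2)"
        by (intro tendsto_ennrealI tendsto_power)
      then have lim: "(\<lambda>j. ennreal ((?g / real (Suc j))\<^sup>2)) \<longlonglongrightarrow> 0" by simp
      show "(\<lambda>j. ?u j z) \<longlonglongrightarrow> 0"
        by (rule tendsto_sandwich[OF _ _ tendsto_const lim])
           (auto simp: indicator_def intro!: always_eventually)
    qed
  qed auto
  then have "(\<lambda>j. \<integral>\<^sup>+z. ?u j z \<partial>lborel) \<longlonglongrightarrow> 0" by simp
  then have "\<forall>\<^sub>F j in sequentially. (\<integral>\<^sup>+z. ?u j z \<partial>lborel) < ennreal e"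
    using e by (intro order_tendstoD(2)) auto
  then obtain j where "(\<integral>\<^sup>+z. ?u j z \<partial>lborel) < ennreal e"
    by (auto dest: eventually_happens)
  then show ?thesis
    unfolding gauge_integral_def by (intro exI[of _ "real (Suc j)"] conjI) (auto intro: less_imp_le)
qed

text \<open>
  Substitute \<open>y = q * z\<close>. For \<open>q = 0\<close> both sides vanish because the gauge does.
\<close>

lemma gauge_integral_scaling:
  assumes s: "0 < s" "s \<le> S" and q: "0 \<le> q"
  shows "(\<integral>\<^sup>+y. indicator {0<..} y * min 1 (ennreal ((C * power_gauge s S (q / y) / l)\<^sup>2)) \<partial>lborel)
    = ennreal q * gauge_integral s S C l"
proof (cases "q = 0")
  case True
  then show ?thesis using s by (simp add: power_gauge_def)
next
  case False
  with q have q: "0 < q" by simp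
  show ?thesis
    unfolding gauge_integral_def
    using q by (subst nn_integral_real_affine[where c=q and t=0])
       (auto intro!: arg_cong2[where f="(*)"] nn_integral_cong simp: indicator_def zero_less_mult_iff)
qed

text \<open>
  Fubini's theorem and \<open>gauge_integral_scaling\<close> bound the inner integral by \<open>e * (A x + B x)\<close>. The
  function \<open>A\<close> stands for a supremum of derivatives that may fail to be measurable; its integral is
  then a lower integral, for which only monotonicity is available.
\<close>

lemma gauge_dominated_integral:
  fixes A B :: "'e \<Rightarrow> ennreal"
  assumes L: "sigma_finite_measure L" and s: "0 < s" "s \<le> S"
    and a[measurable]: "(\<lambda>(y, x). a y x) \<in> borel_measurable (borel \<Otimes>\<^sub>M L)"
    and B[measurable]: "B \<in> borel_measurable L"
    and dom: "AE x in L. \<forall>q y. 0 \<le> q \<longrightarrow> A x + B x = ennreal q \<longrightarrow> 0 < y \<longrightarrow> \<bar>a y x\<bar> \<le> C * power_gauge s S (q / y)"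
    and e: "0 < e" "gauge_integral s S C l \<le> ennreal e"
  shows "(\<integral>\<^sup>+y. indicator {0<..} y * (\<integral>\<^sup>+x. min 1 (ennreal ((a y x / l)\<^sup>2)) \<partial>L) \<partial>lborel)
    \<le> ennreal e * ((\<integral>\<^sup>+x. A x \<partial>L) + (\<integral>\<^sup>+x. B x \<partial>L))"
proof -
  interpret L: sigma_finite_measure L by fact
  interpret P: pair_sigma_finite lborel L ..
  define G where "G x = (\<integral>\<^sup>+y. indicator {0<..} y * min 1 (ennreal ((a y x / l)\<^sup>2)) \<partial>lborel)" for x
  have [measurable]: "(\<lambda>(y, x). a y x) \<in> borel_measurable (lborel \<Otimes>\<^sub>M L)"
    using a by (simp cong: measurable_cong_sets)
  have [measurable]: "G \<in> borel_measurable L" unfolding G_def by measurable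
  have "(\<integral>\<^sup>+y. indicator {0<..} y * (\<integral>\<^sup>+x. min 1 (ennreal ((a y x / l)\<^sup>2)) \<partial>L) \<partial>lborel)
      = (\<integral>\<^sup>+y. (\<integral>\<^sup>+x. indicator {0<..} y * min 1 (ennreal ((a y x / l)\<^sup>2)) \<partial>L) \<partial>lborel)"
    by (simp add: nn_integral_cmult)
  also have "\<dots> = (\<integral>\<^sup>+x. G x \<partial>L)"
    unfolding G_def by (rule P.Fubini'[symmetric]) measurable
  also have "\<dots> = ennreal e * (\<integral>\<^sup>+x. ennreal (1 / e) * G x \<partial>L)"
    using e(1) by (simp add: nn_integral_cmult mult.assoc[symmetric] ennreal_mult'[symmetric])
  also have "(\<integral>\<^sup>+x. ennreal (1 / e) * G x \<partial>L) \<le> (\<integral>\<^sup>+x. A x \<partial>L) + (\<integral>\<^sup>+x. B x \<partial>L)"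
  proof -
    \<comment> \<open>Dividing by \<open>e\<close> keeps constants away from the possibly non-measurable \<open>A\<close>.\<close>
    have le: "AE x in L. ennreal (1 / e) * G x \<le> A x + B x"
      using dom
    proof eventually_elim
      case (elim x)
      show ?case
      proof (cases "A x + B x")
        case (real q)
        have "G x \<le> (\<integral>\<^sup>+y. indicator {0<..} y * min 1 (ennreal ((C * power_gauge s S (q / y) / l)\<^sup>2)) \<partial>lborel)"
          unfolding G_def
        proof (rule nn_integral_mono)
          fix y :: real
          have "(a y x / l)\<^sup>2 \<le> (C * power_gauge s S (q / y) / l)\<^sup>2" if "0 < y"
          proof -
            have "\<bar>a y x\<bar> \<le> \<bar>C * power_gauge s S (q / y)\<bar>" using elim real that by fastforce
            then have "(a y x)\<^sup>2 \<le> (C * power_gauge s S (q / y))\<^sup>2" by (simp only: abs_le_square_iff)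
            then show ?thesis unfolding power_divide by (intro divide_right_mono) auto
          qed
          then show "indicator {0<..} y * min 1 (ennreal ((a y x / l)\<^sup>2))
            \<le> indicator {0<..} y * min 1 (ennreal ((C * power_gauge s S (q / y) / l)\<^sup>2))"
            by (cases "0 < y") (auto intro!: min.mono ennreal_leI simp del: min.bounded_iff)
        qed
        also have "\<dots> = ennreal q * gauge_integral s S C l"
          by (rule gauge_integral_scaling) (use s real in auto)
        also have "\<dots> \<le> ennreal q * ennreal e" using e(2) by (intro mult_left_mono) auto
        finally have "ennreal (1 / e) * G x \<le> ennreal (1 / e) * (ennreal q * ennreal e)"
          by (intro mult_left_mono) auto
        also have "\<dots> = ennreal q"
          using e(1) real by (simp add: ennreal_mult'[symmetric])
        finally show ?thesis using real by simp
      next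
        case top
        show ?thesis unfolding top by (rule top_greatest)
      qed
    qed
    show ?thesis
    proof (cases "(\<integral>\<^sup>+x. B x \<partial>L) = \<infinity>")
      case False
      have fin: "AE x in L. B x \<noteq> \<infinity>" by (rule nn_integral_PInf_AE) (use False in auto)
      \<comment> \<open>Subtracting \<open>B\<close> gives a measurable function below \<open>A\<close>, so additivity is used for measurable functions only.\<close>
      have "(\<integral>\<^sup>+x. ennreal (1 / e) * G x \<partial>L) \<le> (\<integral>\<^sup>+x. (ennreal (1 / e) * G x - B x) + B x \<partial>L)"
      proof (rule nn_integral_mono)
        show "ennreal (1 / e) * G x \<le> (ennreal (1 / e) * G x - B x) + B x" for x
          using ennreal_ineq_diff_add[of "B x" "ennreal (1 / e) * G x"]
          by (cases "B x \<le> ennreal (1 / e) * G x") (auto simp: add.commute not_le intro: add_increasing2 less_imp_le)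
      qed
      also have "\<dots> = (\<integral>\<^sup>+x. ennreal (1 / e) * G x - B x \<partial>L) + (\<integral>\<^sup>+x. B x \<partial>L)"
        by (subst nn_integral_add) auto
      also have "(\<integral>\<^sup>+x. ennreal (1 / e) * G x - B x \<partial>L) \<le> (\<integral>\<^sup>+x. A x \<partial>L)"
      proof (rule nn_integral_mono_AE)
        show "AE x in L. ennreal (1 / e) * G x - B x \<le> A x"
          using le fin by eventually_elim (simp add: ennreal_minus_le_iff add.commute)
      qed
      finally show ?thesis by (simp add: add_right_mono)
    qed simp
  qed
  finally show ?thesis by (simp add: mult_left_mono)
qed

section \<open>Increments in the localisation parameter\<close>

text \<open>
  If \<open>h w\<close> exceeded the supremum, so would \<open>h\<close> at a rational point close to \<open>w\<close>. The countable supremum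
  of measurable functions is measurable, which is not clear for the full one.
\<close>

lemma le_SUP_rationals:
  fixes h :: "real \<Rightarrow> real"
  assumes U: "open U" and h: "continuous_on U h" and w: "w \<in> U"
  shows "ennreal (h w) \<le> (SUP r\<in>U \<inter> \<rat>. ennreal (h r))"
proof (rule ccontr)
  let ?S = "SUP r\<in>U \<inter> \<rat>. ennreal (h r)"
  assume "\<not> ennreal (h w) \<le> ?S"
  then have less: "?S < ennreal (h w)" by simp
  have "continuous_on U (\<lambda>z. ennreal (h z))"
    by (intro continuous_on_ennreal h)
  then have "((\<lambda>z. ennreal (h z)) \<longlongrightarrow> ennreal (h w)) (at w)"
    using U w by (simp add: continuous_on_eq_continuous_at isCont_def)
  then have "\<forall>\<^sub>F z in at w. ?S < ennreal (h z)"
    using less by (rule order_tendstoD)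
  moreover have "\<forall>\<^sub>F z in at w. z \<in> U"
    using U w by (simp add: eventually_at_in_open')
  ultimately have "\<forall>\<^sub>F z in nhds w. z \<in> U \<and> ?S < ennreal (h z)"
    using less w by (auto simp: eventually_nhds_conv_at eventually_conj)
  then obtain d where d: "0 < d" "\<And>z. dist z w < d \<Longrightarrow> z \<in> U \<and> ?S < ennreal (h z)"
    unfolding eventually_nhds_metric by blast
  obtain r where "r \<in> \<rat>" "w < r" "r < w + d"
    using Rats_dense_in_real[of w "w + d"] d(1) by auto
  then have "r \<in> U \<inter> \<rat>" "?S < ennreal (h r)" using d(2)[of r] by (auto simp: dist_real_def)
  moreover have "ennreal (h r) \<le> ?S" using \<open>r \<in> U \<inter> \<rat>\<close> by (rule SUP_upper)
  ultimately show False by simp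
qed

text \<open>
  Only the point \<open>0\<close> needs an argument, where the logarithm grows more slowly than any negative power.
\<close>

lemma isCont_times_ln_abs: "isCont (\<lambda>z::real. z * ln \<bar>z\<bar>) z"
proof (cases "z = 0")
  case False
  then show ?thesis by (intro continuous_intros) auto
next
  case True
  have lim0: "((\<lambda>z::real. \<bar>z\<bar> powr p) \<longlongrightarrow> \<bar>0\<bar> powr p) (at 0)" if "0 < p" for p
    using that by (intro tendsto_powr' tendsto_intros) auto
  have "((\<lambda>z::real. 2 * (\<bar>z\<bar> powr (3/2) + \<bar>z\<bar> powr (1/2))) \<longlongrightarrow> 2 * (\<bar>0\<bar> powr (3/2) + \<bar>0\<bar> powr (1/2))) (at 0)"
    by (intro tendsto_mult tendsto_add tendsto_const lim0) auto
  then have lim: "((\<lambda>z::real. 2 * (\<bar>z\<bar> powr (3/2) + \<bar>z\<bar> powr (1/2))) \<longlongrightarrow> 0) (at 0)" by simp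
  have "norm (z * ln \<bar>z\<bar>) \<le> 2 * (\<bar>z\<bar> powr (3/2) + \<bar>z\<bar> powr (1/2))" if "z \<noteq> 0" for z :: real
  proof -
    have "\<bar>z\<bar> * \<bar>ln \<bar>z\<bar>\<bar> \<le> \<bar>z\<bar> * ((\<bar>z\<bar> powr (1/2) + \<bar>z\<bar> powr (-(1/2))) / (1/2))"
      using that by (intro mult_left_mono abs_ln_le_powr) auto
    also have "\<dots> = 2 * (\<bar>z\<bar> powr 1 * \<bar>z\<bar> powr (1/2) + \<bar>z\<bar> powr 1 * \<bar>z\<bar> powr (-(1/2)))"
      by (simp add: algebra_simps)
    also have "\<dots> = 2 * (\<bar>z\<bar> powr (3/2) + \<bar>z\<bar> powr (1/2))"
      by (simp only: powr_add[symmetric]) simp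
    finally show ?thesis by (simp add: abs_mult)
  qed
  then have "\<forall>\<^sub>F z in at (0::real). norm (z * ln \<bar>z\<bar>) \<le> 2 * (\<bar>z\<bar> powr (3/2) + \<bar>z\<bar> powr (1/2))"
    by (simp add: eventually_at_filter)
  from Lim_null_comparison[OF this lim] show ?thesis
    using True by (simp add: isCont_def)
qed

text \<open>
  \<open>y powr (- (1 / a)) * z\<close> is the power \<open>1 / a\<close> of \<open>z powr a / y\<close>.
\<close>

lemma scaled_le_power_gauge:
  assumes y: "0 < y" and z: "0 \<le> z" and a: "0 < a" and s: "0 \<le> s" "s \<le> 1 / a" "1 / a \<le> S"
    and q: "z powr a \<le> q"
  shows "y powr (- (1 / a)) * z \<le> power_gauge s S (q / y)"
proof -
  have "y powr (- (1 / a)) * z = (z powr a / y) powr (1 / a)"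
    using y z a by (simp add: powr_divide powr_powr powr_minus_divide)
  also have "\<dots> \<le> power_gauge s S (z powr a / y)"
    unfolding power_gauge_def using y s by (intro powr_le_powr_add) auto
  also have "\<dots> \<le> power_gauge s S (q / y)"
    using y s q by (intro power_gauge_mono divide_right_mono) auto
  finally show ?thesis .
qed

text \<open>
  With \<open>p = \<bar>z\<bar> powr a\<close>, split \<open>ln y = ln p - ln (p / y)\<close>. The first part turns \<open>z\<close> into
  \<open>a * z * ln \<bar>z\<bar>\<close>; the second is a function of \<open>r = p / y\<close> alone, and \<open>r powr (1 / a) * \<bar>ln r\<bar>\<close> is
  bounded by powers of \<open>r\<close> with exponents shifted by \<open>\<delta>\<close>.
\<close>

lemma scaled_ln_le_power_gauge:
  fixes z :: real
  assumes y: "0 < y" and a: "0 < a" "a \<le> 2" and \<delta>: "0 < \<delta>"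
    and s: "0 \<le> s" "s \<le> 1 / a - \<delta>" "1 / a + \<delta> \<le> S"
    and q: "\<bar>z\<bar> powr a \<le> q" "\<bar>z * ln \<bar>z\<bar>\<bar> powr a \<le> q"
  shows "y powr (- (1 / a)) * \<bar>z\<bar> * \<bar>ln y\<bar> \<le> (2 + 2 / \<delta>) * power_gauge s S (q / y)"
proof (cases "z = 0")
  case True
  then show ?thesis using \<delta> power_gauge_nonneg[of s S] by (simp add: mult_nonneg_nonneg)
next
  case False
  let ?g = "power_gauge s S (q / y)"
  define r where "r = \<bar>z\<bar> powr a / y"
  have r: "0 < r" using False y by (simp add: r_def)
  have rq: "r \<le> q / y" unfolding r_def using q y by (intro divide_right_mono) auto
  have r_pow: "y powr (- (1 / a)) * \<bar>z\<bar> = r powr (1 / a)"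
    unfolding r_def using y a by (simp add: powr_divide powr_powr powr_minus_divide)
  have "ln r = a * ln \<bar>z\<bar> - ln y"
    unfolding r_def using False y by (simp add: ln_div ln_powr)
  then have ln_y: "\<bar>ln y\<bar> \<le> a * \<bar>ln \<bar>z\<bar>\<bar> + \<bar>ln r\<bar>"
    using a abs_triangle_ineq4[of "a * ln \<bar>z\<bar>" "ln r"] by (simp add: abs_mult)
  have "y powr (- (1 / a)) * \<bar>z\<bar> * (a * \<bar>ln \<bar>z\<bar>\<bar>) = a * (y powr (- (1 / a)) * \<bar>z * ln \<bar>z\<bar>\<bar>)"
    by (simp add: abs_mult)
  also have "\<dots> \<le> 2 * ?g"
    using a s \<delta> q y by (intro mult_mono scaled_le_power_gauge) auto
  finally have 1: "y powr (- (1 / a)) * \<bar>z\<bar> * (a * \<bar>ln \<bar>z\<bar>\<bar>) \<le> 2 * ?g" .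
  have "y powr (- (1 / a)) * \<bar>z\<bar> * \<bar>ln r\<bar> \<le> r powr (1 / a) * ((r powr \<delta> + r powr (-\<delta>)) / \<delta>)"
    unfolding r_pow using r \<delta> by (intro mult_left_mono abs_ln_le_powr) auto
  also have "\<dots> = (r powr (1 / a + \<delta>) + r powr (1 / a - \<delta>)) / \<delta>"
    using powr_add[of r "1/a" \<delta>] powr_add[of r "1/a" "-\<delta>"] by (simp add: distrib_left)
  also have "\<dots> \<le> (power_gauge s S r + power_gauge s S r) / \<delta>"
    unfolding power_gauge_def using r s \<delta>
    by (intro divide_right_mono add_mono powr_le_powr_add) auto
  also have "\<dots> \<le> (?g + ?g) / \<delta>"
    using r rq s \<delta> a by (intro divide_right_mono add_mono power_gauge_mono) (auto intro: order_trans[OF _ s(3)])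
  finally have 2: "y powr (- (1 / a)) * \<bar>z\<bar> * \<bar>ln r\<bar> \<le> (2 / \<delta>) * ?g" by simp
  have "y powr (- (1 / a)) * \<bar>z\<bar> * \<bar>ln y\<bar> \<le> y powr (- (1 / a)) * \<bar>z\<bar> * (a * \<bar>ln \<bar>z\<bar>\<bar> + \<bar>ln r\<bar>)"
    using ln_y by (intro mult_left_mono) auto
  also have "\<dots> \<le> 2 * ?g + (2 / \<delta>) * ?g"
    using 1 2 by (simp only: distrib_left)
  finally show ?thesis by (simp only: distrib_right)
qed

text \<open>
  Mean value inequality for \<open>w \<mapsto> y powr (- (1 / \<alpha> w)) * f w\<close>. It is essential to differentiate the
  product: separate increments of the two factors would pair \<open>f u\<close> with the exponent \<open>\<alpha> v\<close>, and no
  hypothesis controls \<open>\<bar>f u\<bar> powr \<alpha> v\<close>.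
\<close>

lemma scaled_increment_bound:
  fixes f \<alpha> \<alpha>' :: "real \<Rightarrow> real"
  assumes cd: "0 < c" "d < 2" and \<alpha>: "\<And>w. \<alpha> w \<in> {c..d}"
    and D: "\<And>w. w \<in> ball u e \<Longrightarrow> (\<alpha> has_real_derivative \<alpha>' w) (at w)"
    and K: "\<And>w. w \<in> ball u e \<Longrightarrow> \<bar>\<alpha>' w\<bar> \<le> K"
    and f: "\<And>w. w \<in> ball u e \<Longrightarrow> f differentiable (at w)"
    and \<delta>: "0 < \<delta>" and s: "0 \<le> s" "s \<le> 1 / d - \<delta>" "1 / c + \<delta> \<le> S"
    and q: "\<And>w. w \<in> ball u e \<Longrightarrow> \<bar>f w\<bar> powr \<alpha> w \<le> q"
      "\<And>w. w \<in> ball u e \<Longrightarrow> \<bar>deriv f w\<bar> powr \<alpha> w \<le> q"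
      "\<And>w. w \<in> ball u e \<Longrightarrow> \<bar>f w * ln \<bar>f w\<bar>\<bar> powr \<alpha> w \<le> q"
    and y: "0 < y" and v: "v \<in> ball u e"
  shows "\<bar>y powr (- (1 / \<alpha> v)) * f v - y powr (- (1 / \<alpha> u)) * f u\<bar>
    \<le> (1 + K / c\<^sup>2 * (2 + 2 / \<delta>)) * power_gauge s S (q / y) * \<bar>v - u\<bar>"
proof -
  let ?g = "power_gauge s S (q / y)"
  let ?F' = "\<lambda>w. y powr (- (1 / \<alpha> w)) * deriv f w + (\<alpha>' w / (\<alpha> w)\<^sup>2) * (y powr (- (1 / \<alpha> w)) * f w * ln y)"
  have u: "u \<in> ball u e" using v by (auto simp: dist_commute intro: order.strict_trans1[OF zero_le_dist])
  have K0: "0 \<le> K" using K[OF u] by linarith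
  have "norm (y powr (- (1 / \<alpha> v)) * f v - y powr (- (1 / \<alpha> u)) * f u)
    \<le> (1 + K / c\<^sup>2 * (2 + 2 / \<delta>)) * ?g * norm (v - u)"
  proof (rule field_differentiable_bound[where S="ball u e" and f'="?F'"])
    fix w assume w: "w \<in> ball u e"
    have a: "c \<le> \<alpha> w" "\<alpha> w \<le> d" "0 < \<alpha> w" using \<alpha>[of w] cd by auto
    have inv: "1 / d \<le> 1 / \<alpha> w" "1 / \<alpha> w \<le> 1 / c"
      using a cd by (auto intro!: divide_left_mono mult_pos_pos)
    have df: "(f has_real_derivative deriv f w) (at w)"
      using f[OF w] by (simp add: real_differentiable_def DERIV_deriv_iff_real_differentiable)
    have dy: "((\<lambda>w. y powr (- (1 / \<alpha> w))) has_real_derivative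
        (\<alpha>' w / (\<alpha> w)\<^sup>2) * (y powr (- (1 / \<alpha> w)) * ln y)) (at w)"
      unfolding powr_def using D[OF w] a(3) y
      by (auto intro!: derivative_eq_intros simp: power2_eq_square)
    have "((\<lambda>w. y powr (- (1 / \<alpha> w)) * f w) has_real_derivative ?F' w) (at w)"
      by (rule DERIV_cong[OF DERIV_mult[OF dy df]]) (simp add: algebra_simps)
    then show "((\<lambda>w. y powr (- (1 / \<alpha> w)) * f w) has_real_derivative ?F' w) (at w within ball u e)"
      by (rule has_field_derivative_at_within)
    have k1: "\<bar>\<alpha>' w / (\<alpha> w)\<^sup>2\<bar> \<le> K / c\<^sup>2"
      unfolding abs_divide using K[OF w] a cd by (intro frac_le power_mono) (auto simp: power2_eq_square intro!: mult_mono)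
    have k2: "y powr (- (1 / \<alpha> w)) * \<bar>f w\<bar> * \<bar>ln y\<bar> \<le> (2 + 2 / \<delta>) * ?g"
      using inv a cd \<delta> s q(1,3)[OF w] y by (intro scaled_ln_le_power_gauge) auto
    have "\<bar>\<alpha>' w / (\<alpha> w)\<^sup>2\<bar> * (y powr (- (1 / \<alpha> w)) * \<bar>f w\<bar> * \<bar>ln y\<bar>) \<le> K / c\<^sup>2 * ((2 + 2 / \<delta>) * ?g)"
      by (rule mult_mono[OF k1 k2]) (use K0 in auto)
    moreover have "y powr (- (1 / \<alpha> w)) * \<bar>deriv f w\<bar> \<le> ?g"
      using inv a \<delta> s q(2)[OF w] y by (intro scaled_le_power_gauge) auto
    moreover have "norm (?F' w) \<le> y powr (- (1 / \<alpha> w)) * \<bar>deriv f w\<bar> + \<bar>\<alpha>' w / (\<alpha> w)\<^sup>2\<bar> * (y powr (- (1 / \<alpha> w)) * \<bar>f w\<bar> * \<bar>ln y\<bar>)"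
      using abs_triangle_ineq[of "y powr (- (1 / \<alpha> w)) * deriv f w" "(\<alpha>' w / (\<alpha> w)\<^sup>2) * (y powr (- (1 / \<alpha> w)) * f w * ln y)"]
      by (simp only: abs_mult real_norm_def abs_of_nonneg[OF powr_ge_zero])
    ultimately have "norm (?F' w) \<le> ?g + K / c\<^sup>2 * ((2 + 2 / \<delta>) * ?g)" by linarith
    then show "norm (?F' w) \<le> (1 + K / c\<^sup>2 * (2 + 2 / \<delta>)) * ?g"
      by (simp only: distrib_right mult_1 mult.assoc)
  qed (use u v in auto)
  then show ?thesis by simp
qed

section \<open>Stability of finite-dimensional limits\<close>

lemma measurable_fdd_vec:
  assumes "\<And>t. Z t \<in> borel_measurable M"
  shows "fdd_vec n ts Z \<in> measurable M borel"
proof (rule measurable_coordinatewise_then_product)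
  fix i
  show "(\<lambda>\<omega>. fdd_vec n ts Z \<omega> i) \<in> borel_measurable M"
    using assms by (cases "i < n") (simp_all add: fdd_vec_def)
qed

lemma dist_sequences_le:
  fixes x y :: "nat \<Rightarrow> real"
  assumes "\<And>i. \<bar>x i - y i\<bar> \<le> \<delta>"
  shows "dist x y \<le> 2 * \<delta>"
proof -
  have \<delta>: "0 \<le> \<delta>" using assms[of 0] by linarith
  have le: "(1/2)^n * min (dist (x (from_nat n)) (y (from_nat n))) 1 \<le> (1/2)^n * \<delta>" for n :: nat
    using assms[of "from_nat n"] by (intro mult_left_mono) (auto simp: dist_real_def)
  have geo: "(\<lambda>n::nat. (1/2)^n * \<delta>) sums (2 * \<delta>)"
    using sums_mult2[OF geometric_sums[of "1/2::real"], of \<delta>] by simp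
  have "summable (\<lambda>n. (1/2)^n * min (dist (x (from_nat n)) (y (from_nat n))) 1)"
    by (rule summable_comparison_test'[OF sums_summable[OF geo], of 0])
       (use le in \<open>auto simp: abs_mult\<close>)
  then have "dist x y \<le> (\<Sum>n. (1/2)^n * \<delta>)"
    unfolding dist_fun_def by (intro suminf_le le sums_summable[OF geo])
  then show ?thesis using geo by (simp add: sums_iff)
qed

lemma compact_box_sequences:
  fixes a b :: "nat \<Rightarrow> real"
  shows "compact {x. \<forall>i. x i \<in> {a i..b i}}"
proof -
  have "compactin (product_topology (\<lambda>_. euclideanreal) UNIV) (\<Pi>\<^sub>E i\<in>UNIV. {a i..b i})"
    by (subst compactin_PiE) (auto simp: PiE_def)
  moreover have "(\<Pi>\<^sub>E i\<in>UNIV. {a i..b i}) = {x. \<forall>i. x i \<in> {a i..b i}}" by (auto simp: PiE_def)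
  ultimately have "compactin (product_topology (\<lambda>_. euclideanreal) UNIV) {x. \<forall>i. x i \<in> {a i..b i}}"
    by (simp only:)
  then show ?thesis by (simp only: euclidean_product_topology compactin_euclidean_iff)
qed

text \<open>
  Vectors in \<open>\<real>\<^sup>n\<close> with bounded coordinates form a compact set of sequences, on which \<open>g\<close> is uniformly
  continuous; closeness in the metric of the product space follows from closeness of all coordinates.
\<close>

lemma continuous_sequences_uniform:
  fixes g :: "(nat \<Rightarrow> real) \<Rightarrow> real"
  assumes g: "continuous_on UNIV g" and e: "0 < e"
  shows "\<exists>\<delta>>0. \<forall>x y. (\<forall>i<n. \<bar>x i\<bar> \<le> R \<and> \<bar>y i - x i\<bar> < \<delta>) \<longrightarrow> (\<forall>i\<ge>n. x i = 0 \<and> y i = 0) \<longrightarrow> \<bar>g y - g x\<bar> < e"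
proof -
  define K where "K = {x. \<forall>i. x i \<in> {(if i < n then - (R + 1) else 0)..(if i < n then R + 1 else 0)}}"
  have "compact K" unfolding K_def by (rule compact_box_sequences)
  then have uc: "uniformly_continuous_on K g"
    by (intro compact_uniformly_continuous continuous_on_subset[OF g]) auto
  obtain d where d: "0 < d" "\<And>x y. x \<in> K \<Longrightarrow> y \<in> K \<Longrightarrow> dist y x < d \<Longrightarrow> dist (g y) (g x) < e"
    by (rule uniformly_continuous_onE[OF uc e]) blast
  define \<delta> where "\<delta> = min 1 (d / 4)"
  have \<delta>: "0 < \<delta>" "\<delta> \<le> 1" "2 * \<delta> < d" using d(1) by (auto simp: \<delta>_def min_def)
  show ?thesis
  proof (intro exI[of _ \<delta>] conjI allI impI \<delta>(1))
    fix x y assume 1: "\<forall>i<n. \<bar>x i\<bar> \<le> R \<and> \<bar>y i - x i\<bar> < \<delta>" and 2: "\<forall>i\<ge>n. x i = 0 \<and> y i = (0::real)"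
    have "x i \<in> {(if i < n then - (R + 1) else 0)..(if i < n then R + 1 else 0)} \<and>
        y i \<in> {(if i < n then - (R + 1) else 0)..(if i < n then R + 1 else 0)} \<and> \<bar>y i - x i\<bar> \<le> \<delta>" for i
    proof (cases "i < n")
      case True
      with 1 have "\<bar>x i\<bar> \<le> R" "\<bar>y i - x i\<bar> < \<delta>" by auto
      then show ?thesis using True \<delta> by (auto simp: abs_le_iff abs_less_iff)
    qed (use 2 \<delta> in auto)
    then have "x \<in> K" "y \<in> K" "dist y x \<le> 2 * \<delta>"
      unfolding K_def by (blast, blast, intro dist_sequences_le, blast)
    then show "\<bar>g y - g x\<bar> < e" using d(2)[of x y] \<delta> by (simp add: dist_real_def)
  qed
qed

text \<open>
  A continuous substitute for the indicator of the complement of a box, to which convergence in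
  distribution applies.
\<close>

definition box_cutoff :: "nat \<Rightarrow> real \<Rightarrow> (nat \<Rightarrow> real) \<Rightarrow> real" where
  "box_cutoff n R x = min 1 (max 0 ((\<Sum>i<n. \<bar>x i\<bar>) - R))"

lemma box_cutoff_range: "0 \<le> box_cutoff n R x" "box_cutoff n R x \<le> 1"
  by (auto simp: box_cutoff_def)

lemma box_cutoff_continuous: "continuous_on UNIV (box_cutoff n R)"
proof -
  have "continuous_on UNIV (\<lambda>x::nat \<Rightarrow> real. x i)" for i
    by (rule continuous_on_product_coordinates)
  then show ?thesis unfolding box_cutoff_def by (intro continuous_intros) auto
qed

text \<open>
  A convergent family is tight: the cut-off has small mean under the limit law once \<open>R\<close> is large, hence
  eventually also along the family.
\<close>

lemma fdd_tendsto_tight: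
  fixes n :: nat and ts :: "nat \<Rightarrow> real"
  assumes M: "prob_space M" and M': "prob_space M'"
    and Z: "\<And>r t. Z r t \<in> borel_measurable M" and Z': "\<And>t. Z' t \<in> borel_measurable M'"
    and lim: "fdd_tendsto M Z M' Z' F" and e: "0 < e"
  shows "\<exists>R>0. \<forall>\<^sub>F r in F. measure M {\<omega> \<in> space M. \<exists>i<n. R < \<bar>Z r (ts i) \<omega>\<bar>} < e"
proof -
  interpret M: prob_space M by fact
  interpret M': prob_space M' by fact
  note [measurable] = measurable_fdd_vec[of "Z r" M n ts for r, OF Z] measurable_fdd_vec[of Z' M' n ts, OF Z'] Z
  have [measurable]: "box_cutoff n R \<in> borel_measurable borel" for R
    by (rule borel_measurable_continuous_onI[OF box_cutoff_continuous])
  have "(\<lambda>k::nat. \<integral>\<omega>. box_cutoff n (real k) (fdd_vec n ts Z' \<omega>) \<partial>M') \<longlonglongrightarrow> (\<integral>\<omega>. 0 \<partial>M')"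
  proof (rule integral_dominated_convergence[where w="\<lambda>_. 1"])
    show "AE \<omega> in M'. (\<lambda>k. box_cutoff n (real k) (fdd_vec n ts Z' \<omega>)) \<longlonglongrightarrow> 0"
    proof (intro AE_I2 tendsto_eventually)
      fix \<omega>
      obtain k0 :: nat where "(\<Sum>i<n. \<bar>fdd_vec n ts Z' \<omega> i\<bar>) < real k0" using reals_Archimedean2 by blast
      then show "\<forall>\<^sub>F k in sequentially. box_cutoff n (real k) (fdd_vec n ts Z' \<omega>) = 0"
        by (intro eventually_sequentiallyI[of k0]) (auto simp: box_cutoff_def)
    qed
  qed (use box_cutoff_range in auto)
  then have "(\<lambda>k::nat. \<integral>\<omega>. box_cutoff n (real k) (fdd_vec n ts Z' \<omega>) \<partial>M') \<longlonglongrightarrow> 0" by simp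
  then have "\<forall>\<^sub>F k in sequentially. (\<integral>\<omega>. box_cutoff n (real k) (fdd_vec n ts Z' \<omega>) \<partial>M') < e"
    using e by (rule order_tendstoD)
  then obtain k :: nat where k: "(\<integral>\<omega>. box_cutoff n (real k) (fdd_vec n ts Z' \<omega>) \<partial>M') < e"
    by (auto dest: eventually_happens)
  have "bounded (range (box_cutoff n (real k)))"
    using box_cutoff_range by (intro boundedI[of _ 1]) auto
  then have "((\<lambda>r. \<integral>\<omega>. box_cutoff n (real k) (fdd_vec n ts (Z r) \<omega>) \<partial>M) \<longlongrightarrow> (\<integral>\<omega>. box_cutoff n (real k) (fdd_vec n ts Z' \<omega>) \<partial>M')) F"
    using lim box_cutoff_continuous unfolding fdd_tendsto_def by blast
  then have "\<forall>\<^sub>F r in F. (\<integral>\<omega>. box_cutoff n (real k) (fdd_vec n ts (Z r) \<omega>) \<partial>M) < e"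
    using k by (rule order_tendstoD)
  then have "\<forall>\<^sub>F r in F. measure M {\<omega> \<in> space M. \<exists>i<n. real k + 1 < \<bar>Z r (ts i) \<omega>\<bar>} < e"
  proof eventually_elim
    case (elim r)
    let ?E = "{\<omega> \<in> space M. \<exists>i<n. real k + 1 < \<bar>Z r (ts i) \<omega>\<bar>}"
    have [measurable]: "?E \<in> sets M" by measurable
    have "measure M ?E = (\<integral>\<omega>. indicator ?E \<omega> \<partial>M)" by simp
    also have "\<dots> \<le> (\<integral>\<omega>. box_cutoff n (real k) (fdd_vec n ts (Z r) \<omega>) \<partial>M)"
    proof (rule integral_mono)
      show "integrable M (\<lambda>\<omega>. box_cutoff n (real k) (fdd_vec n ts (Z r) \<omega>))"
        by (rule M.integrable_const_bound[where B=1]) (use box_cutoff_range in auto)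
      show "integrable M (indicator ?E :: _ \<Rightarrow> real)" by (simp add: M.emeasure_eq_measure)
      fix \<omega>
      show "indicator ?E \<omega> \<le> box_cutoff n (real k) (fdd_vec n ts (Z r) \<omega>)"
      proof (cases "\<omega> \<in> ?E")
        case True
        then obtain i where i: "i < n" "real k + 1 < \<bar>Z r (ts i) \<omega>\<bar>" by auto
        have "\<bar>fdd_vec n ts (Z r) \<omega> i\<bar> \<le> (\<Sum>i<n. \<bar>fdd_vec n ts (Z r) \<omega> i\<bar>)"
          using i by (intro member_le_sum) auto
        then have "real k + 1 < (\<Sum>i<n. \<bar>fdd_vec n ts (Z r) \<omega> i\<bar>)" using i by (simp add: fdd_vec_def)
        then show ?thesis using True by (simp add: box_cutoff_def)
      qed (simp add: box_cutoff_range)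
    qed
    finally show ?case using elim by simp
  qed
  then show ?thesis by (intro exI[of _ "real k + 1"]) auto
qed

text \<open>
  Slutsky's argument. A bounded continuous test function is uniformly continuous on a box that carries
  almost all of the mass, so a perturbation that is small there changes its mean by little.
\<close>

lemma fdd_tendsto_perturb:
  assumes M: "prob_space M" and M': "prob_space M'"
    and Z: "\<And>r t. Z r t \<in> borel_measurable M" and W: "\<And>r t. W r t \<in> borel_measurable M"
    and Z': "\<And>t. Z' t \<in> borel_measurable M'"
    and lim: "fdd_tendsto M Z M' Z' F"
    and close: "\<And>t \<delta>. 0 < \<delta> \<Longrightarrow> ((\<lambda>r. measure M {\<omega> \<in> space M. \<delta> \<le> \<bar>W r t \<omega> - Z r t \<omega>\<bar>}) \<longlongrightarrow> 0) F"
  shows "fdd_tendsto M W M' Z' F"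
  unfolding fdd_tendsto_def
proof (intro allI impI)
  fix n ts and g :: "(nat \<Rightarrow> real) \<Rightarrow> real"
  assume g: "continuous_on UNIV g" and "bounded (range g)"
  then obtain G where G: "0 < G" "\<And>x. \<bar>g x\<bar> \<le> G"
    by (auto simp: bounded_pos)
  interpret M: prob_space M by fact
  note [measurable] = measurable_fdd_vec[of "Z r" M n ts for r, OF Z] measurable_fdd_vec[of "W r" M n ts for r, OF W] Z W
  have [measurable]: "g \<in> borel_measurable borel"
    by (rule borel_measurable_continuous_onI[OF g])
  let ?z = "\<lambda>r \<omega>. g (fdd_vec n ts (Z r) \<omega>)" and ?w = "\<lambda>r \<omega>. g (fdd_vec n ts (W r) \<omega>)"
  have int: "integrable M (?z r)" "integrable M (?w r)" for r
    using G by (auto intro!: M.integrable_const_bound[where B=G])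
  have "((\<lambda>r. (\<integral>\<omega>. ?w r \<omega> \<partial>M) - (\<integral>\<omega>. ?z r \<omega> \<partial>M)) \<longlongrightarrow> 0) F"
  proof (rule tendstoI)
    fix e :: real assume e: "0 < e"
    define e1 where "e1 = e / (2 + 4 * G)"
    have e1: "0 < e1" using e G by (simp add: e1_def)
    obtain R where R: "0 < R" "\<forall>\<^sub>F r in F. measure M {\<omega> \<in> space M. \<exists>i<n. R < \<bar>Z r (ts i) \<omega>\<bar>} < e1"
      using fdd_tendsto_tight[OF M M' Z Z' lim e1] by blast
    obtain \<delta> where \<delta>: "0 < \<delta>"
      "\<And>x y. (\<forall>i<n. \<bar>x i\<bar> \<le> R \<and> \<bar>y i - x i\<bar> < \<delta>) \<Longrightarrow> (\<forall>i\<ge>n. x i = 0 \<and> y i = 0) \<Longrightarrow> \<bar>g y - g x\<bar> < e1"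
      using continuous_sequences_uniform[OF g e1, of n R] by blast
    have "((\<lambda>r. \<Sum>i<n. measure M {\<omega> \<in> space M. \<delta> \<le> \<bar>W r (ts i) \<omega> - Z r (ts i) \<omega>\<bar>}) \<longlongrightarrow> (\<Sum>i<n. 0)) F"
      by (intro tendsto_sum close \<delta>)
    then have "\<forall>\<^sub>F r in F. (\<Sum>i<n. measure M {\<omega> \<in> space M. \<delta> \<le> \<bar>W r (ts i) \<omega> - Z r (ts i) \<omega>\<bar>}) < e1"
      using e1 by (intro order_tendstoD(2)) auto
    with R(2) show "\<forall>\<^sub>F r in F. dist ((\<integral>\<omega>. ?w r \<omega> \<partial>M) - (\<integral>\<omega>. ?z r \<omega> \<partial>M)) 0 < e"
    proof eventually_elim
      case (elim r)
      let ?E1 = "{\<omega> \<in> space M. \<exists>i<n. R < \<bar>Z r (ts i) \<omega>\<bar>}"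
      let ?D = "\<lambda>i. {\<omega> \<in> space M. \<delta> \<le> \<bar>W r (ts i) \<omega> - Z r (ts i) \<omega>\<bar>}"
      let ?E = "?E1 \<union> (\<Union>i<n. ?D i)"
      have [measurable]: "?E1 \<in> sets M" "\<And>i. ?D i \<in> sets M" by measurable
      have "measure M ?E \<le> measure M ?E1 + measure M (\<Union>i<n. ?D i)"
        by (rule measure_Un_le) auto
      also have "measure M (\<Union>i<n. ?D i) \<le> (\<Sum>i<n. measure M (?D i))"
        by (rule M.finite_measure_subadditive_finite) auto
      finally have PE: "measure M ?E < 2 * e1" using elim by linarith
      have "\<bar>(\<integral>\<omega>. ?w r \<omega> \<partial>M) - (\<integral>\<omega>. ?z r \<omega> \<partial>M)\<bar> = \<bar>\<integral>\<omega>. ?w r \<omega> - ?z r \<omega> \<partial>M\<bar>"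
        using int by simp
      also have "\<dots> \<le> (\<integral>\<omega>. \<bar>?w r \<omega> - ?z r \<omega>\<bar> \<partial>M)" by (rule integral_abs_bound)
      also have "\<dots> \<le> (\<integral>\<omega>. e1 + 2 * G * indicator ?E \<omega> \<partial>M)"
      proof (rule integral_mono)
        show "integrable M (\<lambda>\<omega>. \<bar>?w r \<omega> - ?z r \<omega>\<bar>)" using int by auto
        show "integrable M (\<lambda>\<omega>. e1 + 2 * G * indicator ?E \<omega>)"
          by (intro Bochner_Integration.integrable_add integrable_mult_right) (auto simp: M.emeasure_eq_measure)
        fix \<omega> assume \<omega>: "\<omega> \<in> space M"
        show "\<bar>?w r \<omega> - ?z r \<omega>\<bar> \<le> e1 + 2 * G * indicator ?E \<omega>"
        proof (cases "\<omega> \<in> ?E")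
          case True
          have "\<bar>?w r \<omega> - ?z r \<omega>\<bar> \<le> 2 * G"
            using G(2)[of "fdd_vec n ts (W r) \<omega>"] G(2)[of "fdd_vec n ts (Z r) \<omega>"] by linarith
          moreover have "indicator ?E \<omega> = (1::real)" using True by (rule indicator_simps)
          ultimately show ?thesis using e1 by simp
        next
          case False
          then have "\<bar>?w r \<omega> - ?z r \<omega>\<bar> < e1"
          proof (intro \<delta>(2) allI impI conjI)
            fix i assume i: "i < n"
            show "\<bar>fdd_vec n ts (Z r) \<omega> i\<bar> \<le> R"
            proof (rule ccontr)
              assume "\<not> \<bar>fdd_vec n ts (Z r) \<omega> i\<bar> \<le> R"
              then have "\<omega> \<in> ?E" using \<omega> i by (auto simp: fdd_vec_def)
              with False show False by blast
            qed
            show "\<bar>fdd_vec n ts (W r) \<omega> i - fdd_vec n ts (Z r) \<omega> i\<bar> < \<delta>"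
              using False \<omega> i by (auto simp: fdd_vec_def not_le)
          qed (auto simp: fdd_vec_def)
          moreover have "indicator ?E \<omega> = (0::real)" using False by (rule indicator_simps)
          ultimately show ?thesis by simp
        qed
      qed
      also have "\<dots> = e1 + 2 * G * measure M ?E"
        by (subst Bochner_Integration.integral_add) (auto simp: M.emeasure_eq_measure M.prob_space)
      also have "\<dots> < e1 + 2 * G * (2 * e1)" using PE G by (intro add_strict_left_mono mult_strict_left_mono) auto
      also have "\<dots> = e1 * (1 + 4 * G)" by (simp add: algebra_simps)
      also have "\<dots> < e1 * (2 + 4 * G)" using e1 by simp
      also have "\<dots> = e" using G by (simp add: e1_def)
      finally show ?case by (simp add: dist_real_def)
    qed
  qed
  moreover have "((\<lambda>r. \<integral>\<omega>. ?z r \<omega> \<partial>M) \<longlongrightarrow> (\<integral>\<omega>. g (fdd_vec n ts Z' \<omega>) \<partial>M')) F"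
    using lim g \<open>bounded (range g)\<close> by (auto simp: fdd_tendsto_def)
  ultimately have "((\<lambda>r. ((\<integral>\<omega>. ?w r \<omega> \<partial>M) - (\<integral>\<omega>. ?z r \<omega> \<partial>M)) + (\<integral>\<omega>. ?z r \<omega> \<partial>M)) \<longlongrightarrow> 0 + (\<integral>\<omega>. g (fdd_vec n ts Z' \<omega>) \<partial>M')) F"
    by (rule tendsto_add)
  then show "((\<lambda>r. \<integral>\<omega>. ?w r \<omega> \<partial>M) \<longlongrightarrow> (\<integral>\<omega>. g (fdd_vec n ts Z' \<omega>) \<partial>M')) F" by simp
qed

section \<open>The multistable field near the diagonal\<close>

text \<open>
  The three ingredients combined: \<open>signed_series_tail\<close> for the signs, \<open>campbell_marked\<close> for the points,
  and \<open>gauge_dominated_integral\<close> for the coefficients.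
\<close>

lemma marked_signed_series:
  fixes A B :: "'e \<Rightarrow> ennreal"
  assumes M: "prob_space M" and \<Gamma>: "poisson_arrival_times M 1 \<Gamma>" and V: "iid_with_law M L V"
    and \<gamma>: "iid_signs M \<gamma>" and ind: "indep_sequences M borel \<Gamma> L V borel \<gamma>"
    and s: "1 / 2 < s" "s \<le> S"
    and a[measurable]: "(\<lambda>(y, x). a y x) \<in> borel_measurable (borel \<Otimes>\<^sub>M L)"
    and B[measurable]: "B \<in> borel_measurable L"
    and dom: "AE x in L. \<forall>q y. 0 \<le> q \<longrightarrow> A x + B x = ennreal q \<longrightarrow> 0 < y \<longrightarrow> \<bar>a y x\<bar> \<le> C * power_gauge s S (q / y)"
  shows "(\<integral>\<^sup>+x. A x \<partial>L) + (\<integral>\<^sup>+x. B x \<partial>L) < \<infinity> \<Longrightarrow> AE \<omega> in M. summable (\<lambda>i. \<gamma> i \<omega> * a (\<Gamma> i \<omega>) (V i \<omega>))"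
    and "0 < e \<Longrightarrow> 0 < l \<Longrightarrow> gauge_integral s S C l \<le> ennreal e \<Longrightarrow>
      emeasure M {\<omega> \<in> space M. \<exists>k. l \<le> \<bar>\<Sum>i<k. \<gamma> i \<omega> * a (\<Gamma> i \<omega>) (V i \<omega>)\<bar>}
        \<le> ennreal e * ((\<integral>\<^sup>+x. A x \<partial>L) + (\<integral>\<^sup>+x. B x \<partial>L))"
proof -
  interpret prob_space M by fact
  have \<Gamma>_meas[measurable]: "\<Gamma> i \<in> borel_measurable M" for i
    using \<Gamma> by (auto simp: poisson_arrival_times_def)
  have V_meas[measurable]: "V i \<in> measurable M L" for i
    using V by (auto simp: iid_with_law_def indep_vars_def)
  have law: "distr M L (V i) = L" for i using V by (auto simp: iid_with_law_def)
  note [measurable] = iid_signsD(1)[OF \<gamma>]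
  have "prob_space (distr M L (V 0))" by (rule prob_space_distr) simp
  then interpret L: prob_space L by (simp only: law)
  have pair: "distr M (borel \<Otimes>\<^sub>M L) (\<lambda>\<omega>. (\<Gamma> i \<omega>, V i \<omega>)) = distr M borel (\<Gamma> i) \<Otimes>\<^sub>M distr M L (V i)" for i
    by (rule indep_sequences_joint_law[OF M ind]) auto
  have "indep_var real_sequences (\<lambda>\<omega> i. (\<lambda>(y, x). a y x) (\<Gamma> i \<omega>, V i \<omega>)) real_sequences (\<lambda>\<omega> i. \<gamma> i \<omega>)"
    by (rule indep_sequences_indep_var[OF M ind]) auto
  then have seq: "indep_var real_sequences (\<lambda>\<omega> i. a (\<Gamma> i \<omega>) (V i \<omega>)) real_sequences (\<lambda>\<omega> i. \<gamma> i \<omega>)"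
    by simp
  have [measurable]: "(\<lambda>\<omega>. a (\<Gamma> i \<omega>) (V i \<omega>)) \<in> borel_measurable M" for i
    using measurable_compose[OF measurable_Pair[OF \<Gamma>_meas V_meas] a, of i i] by simp
  have mean: "(\<integral>\<^sup>+\<omega>. (\<Sum>i. min 1 (ennreal ((a (\<Gamma> i \<omega>) (V i \<omega>) / l)\<^sup>2))) \<partial>M)
    \<le> ennreal e * ((\<integral>\<^sup>+x. A x \<partial>L) + (\<integral>\<^sup>+x. B x \<partial>L))"
    if "0 < e" "gauge_integral s S C l \<le> ennreal e" for l e
  proof -
    have "(\<integral>\<^sup>+\<omega>. (\<Sum>i. min 1 (ennreal ((a (\<Gamma> i \<omega>) (V i \<omega>) / l)\<^sup>2))) \<partial>M)
        = (\<Sum>i. \<integral>\<^sup>+\<omega>. min 1 (ennreal ((a (\<Gamma> i \<omega>) (V i \<omega>) / l)\<^sup>2)) \<partial>M)"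
      by (rule nn_integral_suminf) measurable
    also have "\<dots> = (\<integral>\<^sup>+y. indicator {0<..} y * (\<integral>\<^sup>+x. min 1 (ennreal ((a y x / l)\<^sup>2)) \<partial>L) \<partial>lborel)"
      by (rule campbell_marked[OF M \<Gamma> V_meas law pair, where g="\<lambda>y x. min 1 (ennreal ((a y x / l)\<^sup>2))"]) measurable
    also have "\<dots> \<le> ennreal e * ((\<integral>\<^sup>+x. A x \<partial>L) + (\<integral>\<^sup>+x. B x \<partial>L))"
      by (rule gauge_dominated_integral[OF L.sigma_finite_measure_axioms _ s(2) a B dom that]) (use s in simp)
    finally show ?thesis .
  qed
  show "emeasure M {\<omega> \<in> space M. \<exists>k. l \<le> \<bar>\<Sum>i<k. \<gamma> i \<omega> * a (\<Gamma> i \<omega>) (V i \<omega>)\<bar>}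
        \<le> ennreal e * ((\<integral>\<^sup>+x. A x \<partial>L) + (\<integral>\<^sup>+x. B x \<partial>L))"
    if "0 < e" "0 < l" "gauge_integral s S C l \<le> ennreal e"
    using signed_series_tail[OF \<gamma> seq that(2)] mean[OF that(1,3)] by (rule order_trans)
  assume fin: "(\<integral>\<^sup>+x. A x \<partial>L) + (\<integral>\<^sup>+x. B x \<partial>L) < \<infinity>"
  define e where "e = enn2real (gauge_integral s S C 1) + 1"
  have e: "0 < e" "gauge_integral s S C 1 \<le> ennreal e"
  proof -
    show "0 < e" by (simp add: e_def add_nonneg_pos)
    have "gauge_integral s S C 1 = ennreal (enn2real (gauge_integral s S C 1))"
      using gauge_integral_finite[OF s, of C 1] by (simp add: less_top)
    also have "\<dots> \<le> ennreal e" unfolding e_def by (rule ennreal_leI) simp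
    finally show "gauge_integral s S C 1 \<le> ennreal e" .
  qed
  have "(\<integral>\<^sup>+\<omega>. (\<Sum>i. min 1 (ennreal ((a (\<Gamma> i \<omega>) (V i \<omega>))\<^sup>2))) \<partial>M) < \<infinity>"
    using mean[OF e] fin by (auto simp: ennreal_mult_less_top intro: order.strict_trans1)
  from signed_series_summable[OF \<gamma> seq this]
  show "AE \<omega> in M. summable (\<lambda>i. \<gamma> i \<omega> * a (\<Gamma> i \<omega>) (V i \<omega>))" .
qed

lemma suminf_abs_le_of_partial_sums:
  fixes x :: "nat \<Rightarrow> real"
  assumes "summable x" and "\<And>k. \<bar>\<Sum>i<k. x i\<bar> < l"
  shows "\<bar>suminf x\<bar> \<le> l"
proof (rule tendsto_upperbound)
  show "(\<lambda>k. \<bar>\<Sum>i<k. x i\<bar>) \<longlonglongrightarrow> \<bar>suminf x\<bar>"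
    by (intro tendsto_rabs summable_LIMSEQ assms)
qed (use assms(2) in \<open>auto intro!: always_eventually less_imp_le\<close>)

text \<open>
  A measure of total mass \<open>0\<close> cannot be the law of the marks, so the normalisation is never degenerate.
\<close>

lemma normalised_measure:
  assumes "finite_measure m" and M: "prob_space M" and V: "iid_with_law M (normalised m) V"
  shows "prob_space (normalised m)" and "0 < measure m (space m)"
    and "AE x in m. P x \<Longrightarrow> AE x in normalised m. P x"
proof -
  interpret M: prob_space M by fact
  interpret m: finite_measure m by fact
  have "V 0 \<in> measurable M (normalised m)" and law: "distr M (normalised m) (V 0) = normalised m"
    using V by (auto simp: iid_with_law_def M.indep_vars_def)
  then have "prob_space (distr M (normalised m) (V 0))" by (intro M.prob_space_distr)
  then show "prob_space (normalised m)" by (simp only: law)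
  then interpret L: prob_space "normalised m" .
  have "space (normalised m) = space m" by (simp add: normalised_def space_scale_measure)
  then have "emeasure (normalised m) (space m) = 1"
    using L.emeasure_space_1 by simp
  then have "emeasure m (space m) \<noteq> 0"
    by (auto simp: normalised_def)
  then show "0 < measure m (space m)"
    by (simp add: m.emeasure_eq_measure zero_less_measure_iff)
  assume "AE x in m. P x"
  then obtain N where "{x \<in> space m. \<not> P x} \<subseteq> N" "emeasure m N = 0" "N \<in> sets m" by (rule AE_E)
  then show "AE x in normalised m. P x"
    by (intro AE_I[of _ _ N]) (auto simp: normalised_def space_scale_measure)
qed

lemma C1_locally_bounded_derivative:
  fixes \<alpha> :: "real \<Rightarrow> real"
  assumes "\<alpha> C1_differentiable_on UNIV"
  obtains \<alpha>' K where "\<And>w. (\<alpha> has_real_derivative \<alpha>' w) (at w)" "\<And>w. w \<in> ball u 1 \<Longrightarrow> \<bar>\<alpha>' w\<bar> \<le> K"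
proof -
  obtain \<alpha>' where D: "\<And>w. (\<alpha> has_vector_derivative \<alpha>' w) (at w)" and cont: "continuous_on UNIV \<alpha>'"
    using assms by (auto simp: C1_differentiable_on_def)
  have "compact (\<alpha>' ` cball u 1)"
    by (intro compact_continuous_image continuous_on_subset[OF cont]) auto
  then obtain K where "\<And>z. z \<in> \<alpha>' ` cball u 1 \<Longrightarrow> \<bar>z\<bar> \<le> K"
    using compact_imp_bounded bounded_iff by (metis real_norm_def)
  then show thesis
    using D by (intro that[of \<alpha>' K]) (auto simp: has_real_derivative_iff_has_vector_derivative)
qed

lemma SUP_nn_integral_bound:
  fixes h :: "real \<Rightarrow> real \<Rightarrow> 'e \<Rightarrow> ennreal"
  assumes "(SUP t\<in>ball u e. \<integral>\<^sup>+x. (SUP w\<in>ball u e. h t w x) \<partial>L) < \<infinity>" and "e' \<le> e"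
  shows "\<exists>K::real\<ge>0. \<forall>t\<in>ball u e'. (\<integral>\<^sup>+x. (SUP w\<in>ball u e'. h t w x) \<partial>L) \<le> ennreal K"
proof -
  let ?S = "SUP t\<in>ball u e. \<integral>\<^sup>+x. (SUP w\<in>ball u e. h t w x) \<partial>L"
  have "(\<integral>\<^sup>+x. (SUP w\<in>ball u e'. h t w x) \<partial>L) \<le> ?S" if "t \<in> ball u e'" for t
  proof -
    have "(\<integral>\<^sup>+x. (SUP w\<in>ball u e'. h t w x) \<partial>L) \<le> (\<integral>\<^sup>+x. (SUP w\<in>ball u e. h t w x) \<partial>L)"
      using assms(2) by (intro nn_integral_mono SUP_subset_mono) auto
    also have "\<dots> \<le> ?S" using that assms(2) by (intro SUP_upper) auto
    finally show ?thesis .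
  qed
  moreover have "?S = ennreal (enn2real ?S)" using assms(1) by (simp add: less_top)
  ultimately show ?thesis by (metis enn2real_nonneg)
qed

lemma measurable_multistable_field:
  assumes \<Gamma>: "\<And>i. \<Gamma> i \<in> borel_measurable M" and V: "\<And>i. V i \<in> measurable M (normalised m)"
    and \<gamma>: "\<And>i. \<gamma> i \<in> borel_measurable M" and f: "\<And>t w. f t w \<in> borel_measurable m"
  shows "multistable_field m \<alpha> b f \<Gamma> V \<gamma> t w \<in> borel_measurable M"
proof -
  note [measurable] = \<Gamma> V \<gamma>
  have [measurable]: "f t w \<in> borel_measurable (normalised m)"
    using f[of t w] by (simp add: normalised_def cong: measurable_cong_sets)
  have [measurable]: "(\<lambda>\<omega>. f t w (V i \<omega>)) \<in> borel_measurable M" for i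
    by measurable
  show ?thesis unfolding multistable_field_def by measurable
qed

text \<open>
  \<open>X(v,v) - X(v,u)\<close> has a part \<open>(P v - P u) * S\<^sub>u\<close> from the factor in front of the series and a part
  \<open>P v * (S\<^sub>v - S\<^sub>u)\<close> from the series itself. The first is of order \<open>\<bar>v - u\<bar>\<close> as \<open>P\<close> is Lipschitz at \<open>u\<close> and
  \<open>S\<^sub>u\<close> is tight; in the second, \<open>(S\<^sub>v - S\<^sub>u) / (v - u)\<close> is again a series of the same form, whose
  coefficients satisfy \<open>scaled_increment_bound\<close>.
\<close>

lemma multistable_increment_tight:
  fixes m :: "'e measure" and V :: "nat \<Rightarrow> 'w \<Rightarrow> 'e" and f :: "real \<Rightarrow> real \<Rightarrow> 'e \<Rightarrow> real"
  assumes M: "prob_space M" and m: "finite_measure m"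
    and cd: "0 < c" "d < 2" and \<alpha>: "\<forall>v. \<alpha> v \<in> {c..d}"
    and \<alpha>_C1: "\<alpha> C1_differentiable_on UNIV" and b_C1: "b C1_differentiable_on UNIV"
    and f: "\<forall>t v. f t v \<in> F_space (\<alpha> v) m"
    and \<Gamma>: "poisson_arrival_times M 1 \<Gamma>" and V: "iid_with_law M (normalised m) V"
    and \<gamma>: "iid_signs M \<gamma>" and ind: "indep_sequences M borel \<Gamma> (normalised m) V borel \<gamma>"
    and C1: "\<exists>\<epsilon>>0. \<forall>t\<in>ball u \<epsilon>. AE x in m. \<forall>v\<in>ball u \<epsilon>. (\<lambda>w. f t w x) differentiable (at v)"
    and C2: "\<exists>\<epsilon>>0. (SUP t\<in>ball u \<epsilon>. \<integral>\<^sup>+x. (SUP w\<in>ball u \<epsilon>.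
               ennreal (\<bar>f t w x\<bar> powr \<alpha> w)) \<partial>(normalised m)) < \<infinity>"
    and C3: "\<exists>\<epsilon>>0. (SUP t\<in>ball u \<epsilon>. \<integral>\<^sup>+x. (SUP w\<in>ball u \<epsilon>.
               ennreal (\<bar>deriv (\<lambda>v. f t v x) w\<bar> powr \<alpha> w)) \<partial>(normalised m)) < \<infinity>"
    and C4: "\<exists>\<epsilon>>0. (SUP t\<in>ball u \<epsilon>. \<integral>\<^sup>+x. (SUP w\<in>ball u \<epsilon>.
               ennreal (\<bar>f t w x * ln \<bar>f t w x\<bar>\<bar> powr \<alpha> w)) \<partial>(normalised m)) < \<infinity>"
    and \<eta>: "0 < \<eta>"
  shows "\<exists>\<Lambda> \<epsilon>. 0 < \<epsilon> \<and> (\<forall>v\<in>ball u \<epsilon>. measure M {\<omega> \<in> space M.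
      \<Lambda> * \<bar>v - u\<bar> < \<bar>multistable_field m \<alpha> b f \<Gamma> V \<gamma> v v \<omega> - multistable_field m \<alpha> b f \<Gamma> V \<gamma> v u \<omega>\<bar>} \<le> \<eta>)"
proof -
  interpret prob_space M by fact
  define L where "L = normalised m"
  interpret L: prob_space L unfolding L_def by (rule normalised_measure[OF m M V])
  have pos: "0 < \<alpha> w" "\<alpha> w < 2" "c \<le> \<alpha> w" "\<alpha> w \<le> d" for w
    using spec[OF \<alpha>, of w] cd by auto
  have \<Gamma>_meas[measurable]: "\<Gamma> i \<in> borel_measurable M" for i
    using \<Gamma> by (auto simp: poisson_arrival_times_def)
  have V_meas[measurable]: "V i \<in> measurable M L" for i
    using V by (auto simp: iid_with_law_def indep_vars_def L_def)
  note [measurable] = iid_signsD(1)[OF \<gamma>]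
  have f_m: "f t w \<in> borel_measurable m" for t w using f by (auto simp: F_space_def)
  then have f_meas[measurable]: "f t w \<in> borel_measurable L" for t w
    by (simp add: L_def normalised_def cong: measurable_cong_sets)
  define P where "P w = b w * measure m (space m) powr (1 / \<alpha> w) * C_stable (\<alpha> w) powr (1 / \<alpha> w)" for w
  obtain \<alpha>' K where D: "\<And>w. (\<alpha> has_real_derivative \<alpha>' w) (at w)" and K: "\<And>w. w \<in> ball u 1 \<Longrightarrow> \<bar>\<alpha>' w\<bar> \<le> K"
    using C1_locally_bounded_derivative[OF \<alpha>_C1, of u] by blast
  obtain b' K' where D': "\<And>w. (b has_real_derivative b' w) (at w)" "\<And>w. w \<in> ball u 1 \<Longrightarrow> \<bar>b' w\<bar> \<le> K'"
    using C1_locally_bounded_derivative[OF b_C1, of u] by blast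
  have "lipschitz_at P u"
    unfolding P_def
    by (rule lipschitz_at_stable_prefactor[OF cd _ D D'(1) normalised_measure(2)[OF m M V]]) (use \<alpha> in auto)
  then obtain Lp where Lp: "0 \<le> Lp" "\<forall>\<^sub>F v in nhds u. \<bar>P v - P u\<bar> \<le> Lp * \<bar>v - u\<bar>"
    using lipschitz_at_nonneg_constant by blast
  then obtain e0 where e0: "0 < e0" "\<And>v. v \<in> ball u e0 \<Longrightarrow> \<bar>P v - P u\<bar> \<le> Lp * \<bar>v - u\<bar>"
    unfolding eventually_nhds_metric by (auto simp: dist_commute)
  obtain e1 where e1: "0 < e1" "\<forall>t\<in>ball u e1. AE x in m. \<forall>v\<in>ball u e1. (\<lambda>w. f t w x) differentiable (at v)"
    using C1 by blast
  let ?h2 = "\<lambda>t w x. ennreal (\<bar>f t w x\<bar> powr \<alpha> w)"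
  let ?h3 = "\<lambda>t w x. ennreal (\<bar>deriv (\<lambda>v. f t v x) w\<bar> powr \<alpha> w)"
  let ?h4 = "\<lambda>t w x. ennreal (\<bar>f t w x * ln \<bar>f t w x\<bar>\<bar> powr \<alpha> w)"
  obtain e2 where e2: "0 < e2" "(SUP t\<in>ball u e2. \<integral>\<^sup>+x. (SUP w\<in>ball u e2. ?h2 t w x) \<partial>L) < \<infinity>"
    using C2 by (auto simp: L_def)
  obtain e3 where e3: "0 < e3" "(SUP t\<in>ball u e3. \<integral>\<^sup>+x. (SUP w\<in>ball u e3. ?h3 t w x) \<partial>L) < \<infinity>"
    using C3 by (auto simp: L_def)
  obtain e4 where e4: "0 < e4" "(SUP t\<in>ball u e4. \<integral>\<^sup>+x. (SUP w\<in>ball u e4. ?h4 t w x) \<partial>L) < \<infinity>"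
    using C4 by (auto simp: L_def)
  define \<epsilon> where "\<epsilon> = Min {1, e0, e1, e2, e3, e4}"
  have \<epsilon>: "0 < \<epsilon>" "\<epsilon> \<le> 1" "\<epsilon> \<le> e0" "\<epsilon> \<le> e1" "\<epsilon> \<le> e2" "\<epsilon> \<le> e3" "\<epsilon> \<le> e4"
    using e0(1) e1(1) e2(1) e3(1) e4(1) by (auto simp: \<epsilon>_def)
  let ?U = "ball u \<epsilon>"
  obtain K2 where K2: "0 \<le> K2" "\<And>t. t \<in> ?U \<Longrightarrow> (\<integral>\<^sup>+x. (SUP w\<in>?U. ?h2 t w x) \<partial>L) \<le> ennreal K2"
    using SUP_nn_integral_bound[OF e2(2) \<epsilon>(5)] by blast
  obtain K3 where K3: "0 \<le> K3" "\<And>t. t \<in> ?U \<Longrightarrow> (\<integral>\<^sup>+x. (SUP w\<in>?U. ?h3 t w x) \<partial>L) \<le> ennreal K3"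
    using SUP_nn_integral_bound[OF e3(2) \<epsilon>(6)] by blast
  obtain K4 where K4: "0 \<le> K4" "\<And>t. t \<in> ?U \<Longrightarrow> (\<integral>\<^sup>+x. (SUP w\<in>?U. ?h4 t w x) \<partial>L) \<le> ennreal K4"
    using SUP_nn_integral_bound[OF e4(2) \<epsilon>(7)] by blast
  have diff: "AE x in L. \<forall>w\<in>?U. (\<lambda>w. f t w x) differentiable (at w)" if "t \<in> ?U" for t
  proof -
    have "AE x in m. \<forall>v\<in>ball u e1. (\<lambda>w. f t w x) differentiable (at v)"
      using e1(2) that \<epsilon> by auto
    then have "AE x in m. \<forall>w\<in>?U. (\<lambda>w. f t w x) differentiable (at w)"
      by eventually_elim (use \<epsilon> in auto)
    then show ?thesis unfolding L_def by (rule normalised_measure(3)[OF m M V])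
  qed
  \<comment> \<open>\<open>d < 2\<close> leaves a gap between \<open>1 / d\<close> and \<open>1 / 2\<close>; half of it is spent on absorbing the logarithm.\<close>
  define \<delta> where "\<delta> = (1 / d - 1 / 2) / 2"
  define s where "s = 1 / d - \<delta>"
  define S where "S = 1 / c + \<delta>"
  have "c \<le> d" using pos(3)[of u] pos(4)[of u] by linarith
  then have d0: "0 < d" using cd by linarith
  then have "1 / 2 < 1 / d" using cd by (intro divide_strict_left_mono) auto
  then have \<delta>: "0 < \<delta>" and s: "1 / 2 < s" by (auto simp: \<delta>_def s_def field_simps)
  have "1 / d \<le> 1 / c" using \<open>c \<le> d\<close> cd d0 by (intro divide_left_mono) auto
  then have sS: "s \<le> S" using \<delta> by (simp add: s_def S_def)
  have inv: "s \<le> 1 / \<alpha> w" "1 / \<alpha> w \<le> S" for w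
  proof -
    have "1 / d \<le> 1 / \<alpha> w" "1 / \<alpha> w \<le> 1 / c"
      using pos[of w] d0 cd by (auto intro!: divide_left_mono)
    then show "s \<le> 1 / \<alpha> w" "1 / \<alpha> w \<le> S" using \<delta> by (auto simp: s_def S_def)
  qed
  define Cm where "Cm = 1 + K / c\<^sup>2 * (2 + 2 / \<delta>)"
  \<comment> \<open>Each of the two exceptional events below gets probability at most \<open>\<eta> / 2\<close>.\<close>
  define e where "e = \<eta> / (2 * (1 + K2 + K3 + K4))"
  have e: "0 < e" using \<eta> K2(1) K3(1) K4(1) by (simp add: e_def)
  have e_le: "e * K2 \<le> \<eta> / 2" "e * (K3 + (K2 + K4)) \<le> \<eta> / 2"
  proof -
    have *: "e * (1 + K2 + K3 + K4) = \<eta> / 2" 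
    proof -
      have "x / (2 * z) * z = x / 2" if "0 < z" for x z :: real using that by simp
      moreover have "0 < 1 + K2 + K3 + K4" using K2(1) K3(1) K4(1) by linarith
      ultimately show ?thesis unfolding e_def by blast
    qed
    have "e * K2 \<le> e * (1 + K2 + K3 + K4)" "e * (K3 + (K2 + K4)) \<le> e * (1 + K2 + K3 + K4)"
      using e K2(1) K3(1) K4(1) by (auto intro!: mult_left_mono)
    then show "e * K2 \<le> \<eta> / 2" "e * (K3 + (K2 + K4)) \<le> \<eta> / 2" using * by auto
  qed
  obtain l1 where l1: "0 < l1" "gauge_integral s S 1 l1 \<le> ennreal e"
    using gauge_integral_small[OF s sS e] by blast
  obtain l3 where l3: "0 < l3" "gauge_integral s S Cm l3 \<le> ennreal e"
    using gauge_integral_small[OF s sS e] by blast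
  define Pb where "Pb = \<bar>P u\<bar> + Lp"
  have Pb: "\<bar>P v\<bar> \<le> Pb" if "v \<in> ?U" for v
  proof -
    have "\<bar>v - u\<bar> \<le> 1" using that \<epsilon> by (auto simp: dist_real_def)
    then have "Lp * \<bar>v - u\<bar> \<le> Lp * 1" using Lp(1) by (intro mult_left_mono)
    moreover have "\<bar>P v - P u\<bar> \<le> Lp * \<bar>v - u\<bar>" using e0(2)[of v] that \<epsilon> by auto
    ultimately show ?thesis unfolding Pb_def by linarith
  qed
  define \<Lambda> where "\<Lambda> = Lp * l1 + Pb * l3"
  have X_meas: "multistable_field m \<alpha> b f \<Gamma> V \<gamma> t w \<in> borel_measurable M" for t w
    using V_meas by (intro measurable_multistable_field f_m iid_signsD(1)[OF \<gamma>]) (auto simp: L_def)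
  have "measure M {\<omega> \<in> space M. \<Lambda> * \<bar>v - u\<bar> <
      \<bar>multistable_field m \<alpha> b f \<Gamma> V \<gamma> v v \<omega> - multistable_field m \<alpha> b f \<Gamma> V \<gamma> v u \<omega>\<bar>} \<le> \<eta>"
    if v: "v \<in> ?U" for v
  proof (cases "v = u")
    case True
    then show ?thesis using \<eta> by simp
  next
    case False
    have u: "u \<in> ?U" using \<epsilon> by simp
    define T where "T w y x = y powr (- (1 / \<alpha> w)) * f v w x" for w y x
    \<comment> \<open>The coefficients of \<open>S\<^sub>v - S\<^sub>u\<close>, divided by \<open>v - u\<close>.\<close>
    define Q where "Q y x = (T v y x - T u y x) / (v - u)" for y x
    have T_meas[measurable]: "(\<lambda>(y, x). T w y x) \<in> borel_measurable (borel \<Otimes>\<^sub>M L)" for w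
      unfolding T_def by measurable
    have Q_meas[measurable]: "(\<lambda>(y, x). Q y x) \<in> borel_measurable (borel \<Otimes>\<^sub>M L)"
      unfolding Q_def using T_meas[of v] T_meas[of u] by (simp add: split_beta')
    have T_dom: "AE x in L. \<forall>q y. 0 \<le> q \<longrightarrow> 0 + ?h2 v w x = ennreal q \<longrightarrow> 0 < y \<longrightarrow> \<bar>T w y x\<bar> \<le> 1 * power_gauge s S (q / y)" for w
    proof (intro AE_I2 allI impI)
      fix x q y assume "0 \<le> q" "0 + ?h2 v w x = ennreal q" "0 < (y::real)"
      then show "\<bar>T w y x\<bar> \<le> 1 * power_gauge s S (q / y)"
        unfolding T_def using scaled_le_power_gauge[of y "\<bar>f v w x\<bar>" "\<alpha> w" s S q] inv[of w] pos[of w] s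
        by (simp add: abs_mult)
    qed
    have T_int: "(\<integral>\<^sup>+x. 0 \<partial>L) + (\<integral>\<^sup>+x. ?h2 v w x \<partial>L) \<le> ennreal K2" if "w \<in> ?U" for w
    proof -
      have "(\<integral>\<^sup>+x. ?h2 v w x \<partial>L) \<le> (\<integral>\<^sup>+x. (SUP w\<in>?U. ?h2 v w x) \<partial>L)"
        using that by (intro nn_integral_mono SUP_upper)
      also have "\<dots> \<le> ennreal K2" by (rule K2(2)[OF v])
      finally show ?thesis by simp
    qed
    have [measurable]: "?h2 v w \<in> borel_measurable L" "?h4 v w \<in> borel_measurable L" for w
      by measurable
    have T_sum: "AE \<omega> in M. summable (\<lambda>i. \<gamma> i \<omega> * T w (\<Gamma> i \<omega>) (V i \<omega>))" if "w \<in> ?U" for w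
      by (rule marked_signed_series(1)[OF M \<Gamma> V[folded L_def] \<gamma> ind[folded L_def] s sS T_meas _ T_dom])
         (use T_int[OF that] in \<open>auto intro: order.strict_trans1\<close>)
    let ?E1 = "{\<omega> \<in> space M. \<exists>k. l1 \<le> \<bar>\<Sum>i<k. \<gamma> i \<omega> * T u (\<Gamma> i \<omega>) (V i \<omega>)\<bar>}"
    let ?E3 = "{\<omega> \<in> space M. \<exists>k. l3 \<le> \<bar>\<Sum>i<k. \<gamma> i \<omega> * Q (\<Gamma> i \<omega>) (V i \<omega>)\<bar>}"
    have E1: "emeasure M ?E1 \<le> ennreal (\<eta> / 2)"
    proof -
      have "emeasure M ?E1 \<le> ennreal e * ((\<integral>\<^sup>+x. 0 \<partial>L) + (\<integral>\<^sup>+x. ?h2 v u x \<partial>L))"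
        by (rule marked_signed_series(2)[OF M \<Gamma> V[folded L_def] \<gamma> ind[folded L_def] s sS T_meas _ T_dom e l1]) auto
      also have "\<dots> \<le> ennreal e * ennreal K2" by (intro mult_left_mono T_int u) auto
      also have "\<dots> \<le> ennreal (\<eta> / 2)" using e e_le K2(1) by (simp add: ennreal_mult'[symmetric] ennreal_leI)
      finally show ?thesis .
    qed
    let ?A = "\<lambda>x. SUP w\<in>?U. ?h3 v w x"
    \<comment> \<open>\<open>?A\<close> is the part that may fail to be measurable; \<open>?B\<close> is a countable supremum.\<close>
    let ?B = "\<lambda>x. (SUP w\<in>?U \<inter> \<rat>. ?h2 v w x) + (SUP w\<in>?U \<inter> \<rat>. ?h4 v w x)"
    have "countable (?U \<inter> \<rat>)" by (simp add: countable_rat)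
    then have [measurable]: "(\<lambda>x. SUP w\<in>?U \<inter> \<rat>. ?h2 v w x) \<in> borel_measurable L"
      "(\<lambda>x. SUP w\<in>?U \<inter> \<rat>. ?h4 v w x) \<in> borel_measurable L"
      by (intro borel_measurable_SUP; measurable)+
    have Q_dom: "AE x in L. \<forall>q y. 0 \<le> q \<longrightarrow> ?A x + ?B x = ennreal q \<longrightarrow> 0 < y \<longrightarrow> \<bar>Q y x\<bar> \<le> Cm * power_gauge s S (q / y)"
      using diff[OF v]
    proof eventually_elim
      case (elim x)
      show ?case
      proof (intro allI impI)
        fix q y :: real assume q: "0 \<le> q" "?A x + ?B x = ennreal q" and y: "0 < y"
        have cont_f: "isCont (\<lambda>w. f v w x) w" if "w \<in> ?U" for w
          using elim that by (auto intro: differentiable_imp_continuous_within)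
        have cont_\<alpha>: "isCont \<alpha> w" for w using D by (rule DERIV_isCont)
        have pw: "isCont (\<lambda>w. \<bar>k w\<bar> powr \<alpha> w) w" if "isCont k w" for k :: "real \<Rightarrow> real" and w
          using that cont_\<alpha>[of w] pos(1)[of w] unfolding isCont_def
          by (intro tendsto_powr' tendsto_rabs) auto
        have c2: "continuous_on ?U (\<lambda>w. \<bar>f v w x\<bar> powr \<alpha> w)"
          by (intro continuous_at_imp_continuous_on ballI pw cont_f)
        have c4: "continuous_on ?U (\<lambda>w. \<bar>f v w x * ln \<bar>f v w x\<bar>\<bar> powr \<alpha> w)"
          by (intro continuous_at_imp_continuous_on ballI pw isCont_o2[OF cont_f isCont_times_ln_abs])
        have le: "r \<le> q" if "ennreal r \<le> ?A x + ?B x" for r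
          using that q by simp
        have "\<bar>y powr (- (1 / \<alpha> v)) * f v v x - y powr (- (1 / \<alpha> u)) * f v u x\<bar>
            \<le> (1 + K / c\<^sup>2 * (2 + 2 / \<delta>)) * power_gauge s S (q / y) * \<bar>v - u\<bar>"
        proof (rule scaled_increment_bound[OF cd _ D _ _ \<delta> _ _ _ _ _ _ y v])
          fix w assume w: "w \<in> ?U"
          show "\<bar>\<alpha>' w\<bar> \<le> K" using K w \<epsilon> by auto
          show "(\<lambda>w. f v w x) differentiable (at w)" using elim w by auto
          have "?h2 v w x \<le> (SUP w\<in>?U \<inter> \<rat>. ?h2 v w x)" by (rule le_SUP_rationals[OF open_ball c2 w])
          also have "\<dots> \<le> ?A x + ?B x" by (simp add: add_increasing add_increasing2)
          finally show "\<bar>f v w x\<bar> powr \<alpha> w \<le> q" by (rule le)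
          have "?h4 v w x \<le> (SUP w\<in>?U \<inter> \<rat>. ?h4 v w x)" by (rule le_SUP_rationals[OF open_ball c4 w])
          also have "\<dots> \<le> ?A x + ?B x" by (simp add: add_increasing add_increasing2)
          finally show "\<bar>f v w x * ln \<bar>f v w x\<bar>\<bar> powr \<alpha> w \<le> q" by (rule le)
          have "?h3 v w x \<le> ?A x" using w by (rule SUP_upper)
          also have "\<dots> \<le> ?A x + ?B x" by (simp add: add_increasing add_increasing2)
          finally show "\<bar>deriv (\<lambda>w. f v w x) w\<bar> powr \<alpha> w \<le> q" by (rule le)
        qed (use \<alpha> s in \<open>auto simp: s_def S_def\<close>)
        then have "\<bar>T v y x - T u y x\<bar> \<le> Cm * power_gauge s S (q / y) * \<bar>v - u\<bar>"
          by (simp only: T_def Cm_def)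
        then show "\<bar>Q y x\<bar> \<le> Cm * power_gauge s S (q / y)"
          using False by (simp add: Q_def abs_divide divide_le_eq)
      qed
    qed
    have Q_int: "(\<integral>\<^sup>+x. ?A x \<partial>L) + (\<integral>\<^sup>+x. ?B x \<partial>L) \<le> ennreal (K3 + (K2 + K4))"
    proof -
      have "(\<integral>\<^sup>+x. (SUP w\<in>?U \<inter> \<rat>. ?h2 v w x) \<partial>L) \<le> (\<integral>\<^sup>+x. (SUP w\<in>?U. ?h2 v w x) \<partial>L)"
        by (intro nn_integral_mono SUP_subset_mono) auto
      also have "\<dots> \<le> ennreal K2" by (rule K2(2)[OF v])
      finally have i2: "(\<integral>\<^sup>+x. (SUP w\<in>?U \<inter> \<rat>. ?h2 v w x) \<partial>L) \<le> ennreal K2" .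
      have "(\<integral>\<^sup>+x. (SUP w\<in>?U \<inter> \<rat>. ?h4 v w x) \<partial>L) \<le> (\<integral>\<^sup>+x. (SUP w\<in>?U. ?h4 v w x) \<partial>L)"
        by (intro nn_integral_mono SUP_subset_mono) auto
      also have "\<dots> \<le> ennreal K4" by (rule K4(2)[OF v])
      finally have i4: "(\<integral>\<^sup>+x. (SUP w\<in>?U \<inter> \<rat>. ?h4 v w x) \<partial>L) \<le> ennreal K4" .
      have "(\<integral>\<^sup>+x. ?B x \<partial>L) = (\<integral>\<^sup>+x. (SUP w\<in>?U \<inter> \<rat>. ?h2 v w x) \<partial>L) + (\<integral>\<^sup>+x. (SUP w\<in>?U \<inter> \<rat>. ?h4 v w x) \<partial>L)"
        by (rule nn_integral_add) measurable
      then have "(\<integral>\<^sup>+x. ?A x \<partial>L) + (\<integral>\<^sup>+x. ?B x \<partial>L) \<le> ennreal K3 + (ennreal K2 + ennreal K4)"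
        using add_mono[OF K3(2)[OF v] add_mono[OF i2 i4]] by simp
      then show ?thesis using K2(1) K3(1) K4(1) by (simp add: ennreal_plus)
    qed
    have E3: "emeasure M ?E3 \<le> ennreal (\<eta> / 2)"
    proof -
      have "emeasure M ?E3 \<le> ennreal e * ((\<integral>\<^sup>+x. ?A x \<partial>L) + (\<integral>\<^sup>+x. ?B x \<partial>L))"
        by (rule marked_signed_series(2)[OF M \<Gamma> V[folded L_def] \<gamma> ind[folded L_def] s sS Q_meas _ Q_dom e l3]) measurable
      also have "\<dots> \<le> ennreal e * ennreal (K3 + (K2 + K4))" by (intro mult_left_mono Q_int) auto
      also have "\<dots> = ennreal (e * (K3 + (K2 + K4)))"
        using e by (intro ennreal_mult'[symmetric]) simp
      also have "\<dots> \<le> ennreal (\<eta> / 2)" by (rule ennreal_leI[OF e_le(2)])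
      finally show ?thesis .
    qed
    have [measurable]: "(\<lambda>\<omega>. T w (\<Gamma> i \<omega>) (V i \<omega>)) \<in> borel_measurable M" "(\<lambda>\<omega>. Q (\<Gamma> i \<omega>) (V i \<omega>)) \<in> borel_measurable M" for w i
      unfolding Q_def T_def by measurable
    have [measurable]: "?E1 \<in> sets M" "?E3 \<in> sets M" by measurable
    have "measure M {\<omega> \<in> space M. \<Lambda> * \<bar>v - u\<bar> <
      \<bar>multistable_field m \<alpha> b f \<Gamma> V \<gamma> v v \<omega> - multistable_field m \<alpha> b f \<Gamma> V \<gamma> v u \<omega>\<bar>} \<le> measure M (?E1 \<union> ?E3)"
    proof (rule finite_measure_mono_AE)
      show "AE \<omega> in M. \<omega> \<in> {\<omega> \<in> space M. \<Lambda> * \<bar>v - u\<bar> <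
          \<bar>multistable_field m \<alpha> b f \<Gamma> V \<gamma> v v \<omega> - multistable_field m \<alpha> b f \<Gamma> V \<gamma> v u \<omega>\<bar>} \<longrightarrow> \<omega> \<in> ?E1 \<union> ?E3"
        using T_sum[OF v] T_sum[OF u]
      proof eventually_elim
        case (elim \<omega>)
        let ?Sv = "\<Sum>i. \<gamma> i \<omega> * T v (\<Gamma> i \<omega>) (V i \<omega>)" and ?Su = "\<Sum>i. \<gamma> i \<omega> * T u (\<Gamma> i \<omega>) (V i \<omega>)"
        let ?SQ = "\<Sum>i. \<gamma> i \<omega> * Q (\<Gamma> i \<omega>) (V i \<omega>)"
        have X: "multistable_field m \<alpha> b f \<Gamma> V \<gamma> v w \<omega> = P w * (\<Sum>i. \<gamma> i \<omega> * T w (\<Gamma> i \<omega>) (V i \<omega>))" for w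
          by (simp add: multistable_field_def P_def T_def mult.assoc)
        have Q_eq: "\<gamma> i \<omega> * Q (\<Gamma> i \<omega>) (V i \<omega>) =
            (\<gamma> i \<omega> * T v (\<Gamma> i \<omega>) (V i \<omega>) - \<gamma> i \<omega> * T u (\<Gamma> i \<omega>) (V i \<omega>)) / (v - u)" for i
          by (simp add: Q_def right_diff_distrib)
        have Q_sum: "summable (\<lambda>i. \<gamma> i \<omega> * Q (\<Gamma> i \<omega>) (V i \<omega>))"
          unfolding Q_eq by (intro summable_divide summable_diff elim)
        have "?SQ = (?Sv - ?Su) / (v - u)"
          unfolding Q_eq using elim by (simp add: suminf_divide summable_diff suminf_diff)
        then have SQ: "?Sv = ?Su + (v - u) * ?SQ" using False by simp
        show ?case
        proof (rule impI, rule ccontr)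
          assume bad: "\<omega> \<in> {\<omega> \<in> space M. \<Lambda> * \<bar>v - u\<bar> <
              \<bar>multistable_field m \<alpha> b f \<Gamma> V \<gamma> v v \<omega> - multistable_field m \<alpha> b f \<Gamma> V \<gamma> v u \<omega>\<bar>}"
            and good: "\<omega> \<notin> ?E1 \<union> ?E3"
          have Su: "\<bar>?Su\<bar> \<le> l1"
            by (rule suminf_abs_le_of_partial_sums[OF elim(2)]) (use good bad in \<open>auto simp: not_le\<close>)
          have SQ': "\<bar>?SQ\<bar> \<le> l3"
            by (rule suminf_abs_le_of_partial_sums[OF Q_sum]) (use good bad in \<open>auto simp: not_le\<close>)
          have "P v * ?Sv - P u * ?Su = (P v - P u) * ?Su + P v * ((v - u) * ?SQ)"
            by (subst SQ) (simp add: algebra_simps)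
          then have "\<bar>P v * ?Sv - P u * ?Su\<bar> \<le> \<bar>P v - P u\<bar> * \<bar>?Su\<bar> + \<bar>P v\<bar> * (\<bar>v - u\<bar> * \<bar>?SQ\<bar>)"
            using abs_triangle_ineq[of "(P v - P u) * ?Su" "P v * ((v - u) * ?SQ)"] by (simp only: abs_mult)
          also have "\<dots> \<le> (Lp * \<bar>v - u\<bar>) * l1 + Pb * (\<bar>v - u\<bar> * l3)"
            using e0(2)[of v] v \<epsilon> Pb[OF v] Su SQ' Lp(1)
            by (intro add_mono mult_mono mult_left_mono) (auto intro: order_trans[OF abs_ge_zero])
          also have "\<dots> = \<Lambda> * \<bar>v - u\<bar>" by (simp add: \<Lambda>_def algebra_simps)
          finally show False using bad by (simp add: X)
        qed
      qed
    qed measurable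
    also have "\<dots> \<le> measure M ?E1 + measure M ?E3" by (rule measure_Un_le) measurable
    also have "\<dots> \<le> \<eta> / 2 + \<eta> / 2"
      using E1 E3 \<eta> by (intro add_mono) (simp_all add: emeasure_eq_measure)
    finally show ?thesis by simp
  qed
  then show ?thesis using \<epsilon>(1) by blast
qed

theorem theorem3:
  fixes M :: "'w measure" and M' :: "'v measure" and m :: "'e measure"
    and \<alpha> b :: "real \<Rightarrow> real" and c d u h :: real
    and f :: "real \<Rightarrow> real \<Rightarrow> 'e \<Rightarrow> real"
    and \<Gamma> \<gamma> :: "nat \<Rightarrow> 'w \<Rightarrow> real" and V :: "nat \<Rightarrow> 'w \<Rightarrow> 'e"
    and X'u :: "real \<Rightarrow> 'v \<Rightarrow> real"
  assumes "prob_space M"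
    and "finite_measure m"
    and "0 < c" and "d < 2" and "\<forall>v. \<alpha> v \<in> {c..d}"
    and "\<alpha> C1_differentiable_on UNIV"
    and "b C1_differentiable_on UNIV"
    and "\<forall>t v. f t v \<in> F_space (\<alpha> v) m"
    and "poisson_arrival_times M 1 \<Gamma>"
    and "iid_with_law M (normalised m) V"
    and "iid_signs M \<gamma>"
    and "indep_sequences M borel \<Gamma> (normalised m) V borel \<gamma>"
    and "0 < h" and "h < 1"
    and "localisable M (\<lambda>t. multistable_field m \<alpha> b f \<Gamma> V \<gamma> t u) u h M' X'u"
    and C1: "\<exists>\<epsilon>>0. \<forall>t\<in>ball u \<epsilon>. AE x in m. \<forall>v\<in>ball u \<epsilon>. (\<lambda>w. f t w x) differentiable (at v)"
    and C2: "\<exists>\<epsilon>>0. (SUP t\<in>ball u \<epsilon>. \<integral>\<^sup>+x. (SUP w\<in>ball u \<epsilon>.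
               ennreal (\<bar>f t w x\<bar> powr \<alpha> w)) \<partial>(normalised m)) < \<infinity>"
    and C3: "\<exists>\<epsilon>>0. (SUP t\<in>ball u \<epsilon>. \<integral>\<^sup>+x. (SUP w\<in>ball u \<epsilon>.
               ennreal (\<bar>deriv (\<lambda>v. f t v x) w\<bar> powr \<alpha> w)) \<partial>(normalised m)) < \<infinity>"
    and C4: "\<exists>\<epsilon>>0. (SUP t\<in>ball u \<epsilon>. \<integral>\<^sup>+x. (SUP w\<in>ball u \<epsilon>.
               ennreal (\<bar>f t w x * ln \<bar>f t w x\<bar>\<bar> powr \<alpha> w)) \<partial>(normalised m)) < \<infinity>"
  shows "localisable M (\<lambda>t. multistable_field m \<alpha> b f \<Gamma> V \<gamma> t t) u h M' X'u"
proof -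
  let ?X = "multistable_field m \<alpha> b f \<Gamma> V \<gamma>"
  let ?Z = "\<lambda>r t \<omega>. (?X (u + r * t) u \<omega> - ?X u u \<omega>) / r powr h"
  let ?W = "\<lambda>r t \<omega>. (?X (u + r * t) (u + r * t) \<omega> - ?X u u \<omega>) / r powr h"
  interpret prob_space M by fact
  have loc: "prob_space M'" "\<forall>t. X'u t \<in> borel_measurable M'" "nontrivial_process M' X'u"
    "fdd_tendsto M ?Z M' X'u (at_right 0)"
    using assms(15) by (auto simp: localisable_def)
  have X_meas[measurable]: "?X t w \<in> borel_measurable M" for t w
    using assms(8,9,10,11) iid_signsD(1)
    by (intro measurable_multistable_field)
       (auto simp: poisson_arrival_times_def iid_with_law_def indep_vars_def F_space_def)
  have close: "((\<lambda>r. measure M {\<omega> \<in> space M. \<delta> \<le> \<bar>?W r t \<omega> - ?Z r t \<omega>\<bar>}) \<longlongrightarrow> 0) (at_right 0)"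
    if \<delta>: "0 < \<delta>" for t \<delta>
  proof (rule tendstoI)
    fix \<eta> :: real assume \<eta>: "0 < \<eta>"
    obtain \<Lambda> \<epsilon> where \<epsilon>: "0 < \<epsilon>" and tight: "\<And>v. v \<in> ball u \<epsilon> \<Longrightarrow>
        measure M {\<omega> \<in> space M. \<Lambda> * \<bar>v - u\<bar> < \<bar>?X v v \<omega> - ?X v u \<omega>\<bar>} \<le> \<eta> / 2"
      using multistable_increment_tight[OF assms(1-12) C1 C2 C3 C4 half_gt_zero[OF \<eta>]] by blast
    have "((\<lambda>r::real. r * \<bar>t\<bar>) \<longlongrightarrow> 0 * \<bar>t\<bar>) (at_right 0)"
      by (intro tendsto_intros)
    then have near: "\<forall>\<^sub>F r in at_right (0::real). r * \<bar>t\<bar> < \<epsilon>"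
      using \<epsilon> by (intro order_tendstoD(2)) auto
    have "((\<lambda>r::real. r powr (1 - h)) \<longlongrightarrow> 0 powr (1 - h)) (at_right 0)"
      using assms(14) by (intro tendsto_powr' tendsto_intros) (auto simp: eventually_at_right_less eventually_at_topological)
    then have "((\<lambda>r::real. \<Lambda> * \<bar>t\<bar> * r powr (1 - h)) \<longlongrightarrow> \<Lambda> * \<bar>t\<bar> * 0 powr (1 - h)) (at_right 0)"
      by (intro tendsto_mult tendsto_const)
    then have small: "\<forall>\<^sub>F r in at_right (0::real). \<Lambda> * \<bar>t\<bar> * r powr (1 - h) < \<delta>"
      using \<delta> by (intro order_tendstoD(2)) auto
    show "\<forall>\<^sub>F r in at_right 0. dist (measure M {\<omega> \<in> space M. \<delta> \<le> \<bar>?W r t \<omega> - ?Z r t \<omega>\<bar>}) 0 < \<eta>"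
      using near small eventually_at_right_less[of "0::real"]
    proof eventually_elim
      case (elim r)
      let ?v = "u + r * t"
      have v: "?v \<in> ball u \<epsilon>" using elim by (simp add: dist_real_def abs_mult)
      \<comment> \<open>The threshold \<open>\<Lambda> * r * \<bar>t\<bar>\<close> is \<open>\<Lambda> * \<bar>t\<bar> * r powr (1 - h)\<close> after division by \<open>r powr h\<close>.\<close>
      have r: "r powr (1 - h) * r powr h = r" using elim by (simp add: powr_add[symmetric])
      have "measure M {\<omega> \<in> space M. \<delta> \<le> \<bar>?W r t \<omega> - ?Z r t \<omega>\<bar>}
          \<le> measure M {\<omega> \<in> space M. \<Lambda> * \<bar>?v - u\<bar> < \<bar>?X ?v ?v \<omega> - ?X ?v u \<omega>\<bar>}"
      proof (rule finite_measure_mono)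
        show "{\<omega> \<in> space M. \<delta> \<le> \<bar>?W r t \<omega> - ?Z r t \<omega>\<bar>}
          \<subseteq> {\<omega> \<in> space M. \<Lambda> * \<bar>?v - u\<bar> < \<bar>?X ?v ?v \<omega> - ?X ?v u \<omega>\<bar>}"
        proof safe
          fix \<omega> assume "\<delta> \<le> \<bar>?W r t \<omega> - ?Z r t \<omega>\<bar>"
          also have "?W r t \<omega> - ?Z r t \<omega> = (?X ?v ?v \<omega> - ?X ?v u \<omega>) / r powr h"
            by (simp add: diff_divide_distrib)
          finally have "\<delta> * r powr h \<le> \<bar>?X ?v ?v \<omega> - ?X ?v u \<omega>\<bar>"
            using elim by (simp add: abs_divide le_divide_eq)
          moreover have "\<Lambda> * \<bar>t\<bar> * r powr (1 - h) * r powr h < \<delta> * r powr h"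
            using elim by (intro mult_strict_right_mono) auto
          moreover have "\<Lambda> * \<bar>t\<bar> * r powr (1 - h) * r powr h = \<Lambda> * \<bar>?v - u\<bar>"
            using r elim by (simp add: mult.assoc abs_mult)
          ultimately show "\<Lambda> * \<bar>?v - u\<bar> < \<bar>?X ?v ?v \<omega> - ?X ?v u \<omega>\<bar>" by linarith
        qed
      qed measurable
      also have "\<dots> \<le> \<eta> / 2" by (rule tight[OF v])
      finally show ?case using \<eta> by (simp add: dist_real_def)
    qed
  qed
  have "fdd_tendsto M ?W M' X'u (at_right 0)"
    by (rule fdd_tendsto_perturb[OF assms(1) loc(1) _ _ _ loc(4) close]) (use loc(2) in auto)
  then show ?thesis
    using loc assms(1) by (simp add: localisable_def)
qed

end
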